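(* Let $q\ge1$ and let $\mathcal{B}=\mathcal{B}_{\mathrm{good}}\sqcup\mathcal{B}_{\mathrm{bad}}$ be a factor-parity Hall set on $X=\{X_0,X_1,\dots,X_q\}$ with $X_{\mathrm{good}}=\{X_1,\dots,X_q\}$ and $X_{\mathrm{bad}}=\{X_0\}$. Let $G\subset\mathcal{B}_{\mathrm{good}}$ be finite and factor-stable. Then the canonical system $\Sigma_G$ is small-time globally controllable. More precisely, for all $T>0$ and $x^\circ,x^*\in\mathbb{R}^G$, there exists $u\in L^\infty((0,T);\mathbb{R}^q)$ such that the solution of $\Sigma_G$ with control $u$ and initial condition $x(0)=x^\circ$ satisfies $x(T)=x^*$.
   Context: Free magma. For a set $X$, $\mathrm{Br}(X)$ is the free magma on $X$ (product written $(a,b)$). Put $\mathrm{ad}_a(b):=(a,b)$. Every $b\in\mathrm{Br}(X)$ is uniquely of the form $b=\mathrm{ad}_{a_r}^{m_r}\cdots\mathrm{ad}_{a_1}^{m_1}(x)$ with $r\ge 0$, $m_j\ge1$, $a_j\in\mathrm{Br}(X)$, $a_j\ne a_{j+1}$, $x\in X$ (the factorization of $b$). Set $\mathrm{seed}(b):=x$ and $\mathrm{Fac}(b):=\{a_1,\dots,a_r\}$ (empty if $b\in X$). A subset $H\subset\mathrm{Br}(X)$ is factor-stable when $\mathrm{Fac}(b)\subset H$ for all $b\in H$. Hall set. A Hall set on $X$ is a totally ordered subset $(\mathcal{B},<)$ of $\mathrm{Br}(X)$ such that: $X\subset\mathcal{B}$; for $a,b\in\mathrm{Br}(X)$, $(a,b)\in\mathcal{B}$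 iff $a,b\in\mathcal{B}$, $a<b$ and either $b\in X$ or $b=(b',b'')$ with $b'\le a$; for all $a,b\in\mathcal{B}$ with $(a,b)\in\mathcal{B}$, $a<(a,b)$. Factor-parity Hall set. Given a partition $X=X_{\mathrm{good}}\sqcup X_{\mathrm{bad}}$, a Hall set $\mathcal{B}$ on $X$ is factor-parity if it splits as $\mathcal{B}=\mathcal{B}_{\mathrm{good}}\sqcup\mathcal{B}_{\mathrm{bad}}$ with $a<b$ for all $a\in\mathcal{B}_{\mathrm{good}}$, $b\in\mathcal{B}_{\mathrm{bad}}$, and, for every $b\in\mathcal{B}$, written uniquely as $b=\mathrm{ad}_{a_r}^{m_r}\cdots\mathrm{ad}_{a_1}^{m_1}(x)$ with $r\ge 0$, $m_j\ge1$, $a_j\in\mathrm{Br}(X)$, $a_j\ne a_{j+1}$, $x\in X$, one has $b\in\mathcal{B}_{\mathrm{good}}$ iff ($\mathrm{Fac}(b)\subset\mathcal{B}_{\mathrm{good}}$ and ($\mathrm{seed}(b)\in X_{\mathrm{good}}$ or some $m_j$ is odd)). (In particular $X_0\notin\mathcal{B}_{\mathrm{good}}$.) Canonical system. For a finite factor-stable $H\subset\mathcal{B}\setminus\{X_0\}$, $\Sigma_H$ is the polynomial control system on $\mathbb{R}^H$ with control $u=(u_1,\dots,u_q)$ given, with the convention $u_0\equiv1$, by $$\dot x_b=\frac{x_{a_r}^{m_r}}{m_r!}\cdots\frac{x_{a_1}^{m_1}}{m_1!}\,u_i\qquad\text{for } b=\mathrm{ad}_{a_r}^{m_r}\cdots\mathrm{ad}_{a_1}^{m_1}(X_i)\in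 H,$$ where the expression of $b$ is its factorization. Solutions are absolutely continuous, satisfying the equation almost everywhere. *)

theory Defs
  imports "HOL-Analysis.Analysis"
begin

section \<open>Free magmas and factorizations\<close>

datatype (gens: 'x) br = Gen 'x | Prd "'x br" "'x br"

definition Br :: "'x set \<Rightarrow> 'x br set" where
  "Br X = {b. gens b \<subseteq> X}"

definition ad :: "'x br \<Rightarrow> 'x br \<Rightarrow> 'x br" where
  "ad a b = Prd a b"

text \<open>
  A factorization ad_{a_r}^{m_r} ... ad_{a_1}^{m_1} (x) is encoded by the pair of x and the list
  [(a_1, m_1), ..., (a_r, m_r)]: the innermost factor comes first, and \<open>fold\<close> applies it first.
\<close>

definition is_factorization :: "'x br \<Rightarrow> 'x \<times> ('x br \<times> nat) list \<Rightarrow> bool" where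
  "is_factorization b = (\<lambda>(x, ams).
     b = fold (\<lambda>(a, m). ad a ^^ m) ams (Gen x) \<and>
     (\<forall>(a, m) \<in> set ams. 1 \<le> m) \<and>
     distinct_adj (map fst ams))"

lemma is_factorization_Gen_iff: "is_factorization (Gen y) p \<longleftrightarrow> p = (y, [])"
proof -
  have "ams = []" if "is_factorization (Gen y) (x, ams)" for x ams
  proof (rule ccontr)
    assume "ams \<noteq> []"
    then obtain l a m where l: "ams = l @ [(a, m)]"
      by (metis rev_exhaust surj_pair)
    with that obtain k where "m = Suc k"
      by (cases m) (auto simp: is_factorization_def)
    with that l show False
      by (auto simp: is_factorization_def ad_def)
  qed
  then have "is_factorization (Gen y) (x, ams) \<longleftrightarrow> x = y \<and> ams = []" for x ams
    by (cases "ams = []") (auto simp: is_factorization_def)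
  then show ?thesis
    by (cases p) auto
qed

lemma is_factorization_PrdE:
  assumes "is_factorization (Prd a b) (x, ams)"
  obtains (grow) l m where "ams = l @ [(a, Suc m)]" "1 \<le> m" "is_factorization b (x, l @ [(a, m)])"
  | (new) l where "ams = l @ [(a, 1)]" "is_factorization b (x, l)" "l = [] \<or> fst (last l) \<noteq> a"
proof -
  have "ams \<noteq> []"
    using assms by (auto simp: is_factorization_def)
  then obtain l a' m' where l: "ams = l @ [(a', m')]"
    by (metis rev_exhaust surj_pair)
  with assms obtain m where m: "m' = Suc m"
    by (cases m') (auto simp: is_factorization_def)
  have a: "a' = a" and b: "b = (ad a ^^ m) (fold (\<lambda>(a, m). ad a ^^ m) l (Gen x))"
    using assms l m by (auto simp: is_factorization_def ad_def)
  show thesis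
  proof (cases "m = 0")
    case True
    with assms l m a b show ?thesis
      by (intro new[of l]) (auto simp: is_factorization_def distinct_adj_append_iff last_map)
  next
    case False
    with assms l m a b show ?thesis
      by (intro grow[of l m]) (auto simp: is_factorization_def)
  qed
qed

lemma ex1_factorization: "\<exists>!p. is_factorization b p"
proof (induction b)
  case (Gen y)
  then show ?case
    by (simp add: is_factorization_Gen_iff)
next
  case (Prd a b)
  from Prd(2) obtain x l where f: "is_factorization b (x, l)"
    and u: "\<And>p. is_factorization b p \<Longrightarrow> p = (x, l)"
    by (metis surj_pair)
  show ?case
  proof (cases "l \<noteq> [] \<and> fst (last l) = a")
    case True
    then obtain l' m where l: "l = l' @ [(a, m)]"
      by (metis append_butlast_last_id prod.collapse)
    have "is_factorization (Prd a b) (x, l' @ [(a, Suc m)])"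
      using f l by (auto simp: is_factorization_def ad_def)
    moreover have "p = (x, l' @ [(a, Suc m)])" if "is_factorization (Prd a b) p" for p
    proof (cases p)
      case (Pair y ams)
      with that have "is_factorization (Prd a b) (y, ams)" by simp
      then show ?thesis
        by (cases rule: is_factorization_PrdE) (use u l Pair in fastforce)+
    qed
    ultimately show ?thesis by blast
  next
    case False
    have "is_factorization (Prd a b) (x, l @ [(a, 1)])"
      using f False
      by (auto simp: is_factorization_def ad_def distinct_adj_append_iff last_map)
    moreover have "p = (x, l @ [(a, 1)])" if "is_factorization (Prd a b) p" for p
    proof (cases p)
      case (Pair y ams)
      with that have "is_factorization (Prd a b) (y, ams)" by simp
      then show ?thesis
        by (cases rule: is_factorization_PrdE) (use u False Pair in fastforce)+
    qed
    ultimately show ?thesis by blast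
  qed
qed

definition factorization :: "'x br \<Rightarrow> 'x \<times> ('x br \<times> nat) list" where
  "factorization b = (THE p. is_factorization b p)"

lemma is_factorization_factorization: "is_factorization b (factorization b)"
  unfolding factorization_def by (rule theI') (rule ex1_factorization)

definition seed :: "'x br \<Rightarrow> 'x" where
  "seed b = fst (factorization b)"

definition factors :: "'x br \<Rightarrow> ('x br \<times> nat) list" where
  "factors b = snd (factorization b)"

definition Fac :: "'x br \<Rightarrow> 'x br set" where
  "Fac b = fst ` set (factors b)"

definition factor_stable :: "'x br set \<Rightarrow> bool" where
  "factor_stable H \<longleftrightarrow> (\<forall>b \<in> H. Fac b \<subseteq> H)"

section \<open>Hall sets\<close>

text \<open>The strict order \<open>lt\<close> is only ever consulted on elements of the Hall set.\<close>

definition Hall_set :: "'x set \<Rightarrow> 'x br set \<Rightarrow> ('x br \<Rightarrow> 'x br \<Rightarrow> bool) \<Rightarrow> bool" where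
  "Hall_set X B lt \<longleftrightarrow>
     B \<subseteq> Br X \<and>
     irreflp_on B lt \<and> transp_on B lt \<and> totalp_on B lt \<and>
     Gen ` X \<subseteq> B \<and>
     (\<forall>a \<in> Br X. \<forall>b \<in> Br X.
        Prd a b \<in> B \<longleftrightarrow>
          a \<in> B \<and> b \<in> B \<and> lt a b \<and>
          (b \<in> Gen ` X \<or> (\<exists>b' b''. b = Prd b' b'' \<and> (lt b' a \<or> b' = a)))) \<and>
     (\<forall>a \<in> B. \<forall>b \<in> B. Prd a b \<in> B \<longrightarrow> lt a (Prd a b))"

definition factor_parity_Hall_set ::
  "'x set \<Rightarrow> 'x set \<Rightarrow> 'x br set \<Rightarrow> ('x br \<Rightarrow> 'x br \<Rightarrow> bool) \<Rightarrow> 'x br set \<Rightarrow> 'x br set \<Rightarrow> bool" where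
  "factor_parity_Hall_set Xgood Xbad B lt Bgood Bbad \<longleftrightarrow>
     Xgood \<inter> Xbad = {} \<and>
     Hall_set (Xgood \<union> Xbad) B lt \<and>
     B = Bgood \<union> Bbad \<and> Bgood \<inter> Bbad = {} \<and>
     (\<forall>a \<in> Bgood. \<forall>b \<in> Bbad. lt a b) \<and>
     (\<forall>b \<in> B. b \<in> Bgood \<longleftrightarrow>
        Fac b \<subseteq> Bgood \<and> (seed b \<in> Xgood \<or> (\<exists>(a, m) \<in> set (factors b). odd m)))"

section \<open>The canonical system\<close>

text \<open>
  The indeterminate X_i is \<open>Gen i\<close>. A point of R^H is a function on brackets of which only the
  values on \<open>H\<close> matter, and a control value in R^q is a function \<open>u\<close> of which only the values
  u_1, ..., u_q matter; the value \<open>u 0\<close> is never read, in accordance with the convention u_0 = 1.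
\<close>

definition canonical_rhs :: "(nat br \<Rightarrow> real) \<Rightarrow> (nat \<Rightarrow> real) \<Rightarrow> nat br \<Rightarrow> real" where
  "canonical_rhs x u b =
     (\<Prod>(a, m) \<leftarrow> factors b. x a ^ m / fact m) * (if seed b = 0 then 1 else u (seed b))"

text \<open>
  The usual epsilon-delta definition: the elements of a division are finitely many
  non-overlapping nonempty compact intervals.
\<close>

definition abs_continuous_on :: "real set \<Rightarrow> (real \<Rightarrow> real) \<Rightarrow> bool" where
  "abs_continuous_on I f \<longleftrightarrow>
     (\<forall>\<epsilon>>0. \<exists>\<delta>>0. \<forall>\<D> S. \<D> division_of S \<and> S \<subseteq> I \<and> (\<Sum>K\<in>\<D>. Sup K - Inf K) < \<delta> \<longrightarrow>
        (\<Sum>K\<in>\<D>. \<bar>f (Sup K) - f (Inf K)\<bar>) < \<epsilon>)"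

definition Linfty_control :: "nat \<Rightarrow> real \<Rightarrow> (real \<Rightarrow> nat \<Rightarrow> real) \<Rightarrow> bool" where
  "Linfty_control q T u \<longleftrightarrow>
     (\<forall>i \<in> {1..q}.
        (\<lambda>t. u t i) \<in> borel_measurable (lebesgue_on {0<..<T}) \<and>
        (\<exists>C. AE t in lebesgue_on {0<..<T}. \<bar>u t i\<bar> \<le> C))"

definition canonical_solution ::
  "nat br set \<Rightarrow> real \<Rightarrow> (real \<Rightarrow> nat \<Rightarrow> real) \<Rightarrow> (nat br \<Rightarrow> real) \<Rightarrow> (real \<Rightarrow> nat br \<Rightarrow> real) \<Rightarrow> bool"
  where
  "canonical_solution H T u x0 x \<longleftrightarrow>
     (\<forall>b \<in> H. abs_continuous_on {0..T} (\<lambda>t. x t b)) \<and>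
     (AE t in lebesgue_on {0<..<T}.
        \<forall>b \<in> H. ((\<lambda>s. x s b) has_real_derivative canonical_rhs (x t) (u t) b) (at t)) \<and>
     (\<forall>b \<in> H. x 0 b = x0 b)"

end

theory Submission
  imports Defs "HOL-Computational_Algebra.Polynomial"
begin

text \<open>
  Listed in increasing Hall order, the coordinates of the canonical system satisfy
  x_c' = kappa_c * (x_0^{m c 0} * ... * x_{c-1}^{m c (c-1)}) * u_{seed c}, because every factor of a
  Hall element precedes that element. Two properties of the exponents carry the whole proof:
  a coordinate with seed 0 has an odd exponent (this is the factor-parity condition), and for
  b < c the seed of c together with the exponents m c 0, ..., m c (b-1) never equals the seed and
  the exponents of b (a truncated factorization of c is again a Hall element, and it lies above the
  next factor of c).

  The idea is Lazard's elimination, made analytic. The coordinate x_0 has no factors, so its seed is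
  free, and no other coordinate has the same seed. Hence x_0 can be driven along an arbitrary path
  that starts and ends at 0, and the products x_0^j * u_l act as inputs of the remaining coordinates.
  If x_0 oscillates fast, only the averages of these products matter. A profile that is symmetric
  under x_0 |-> - x_0, with the free u_l at 0, gives average 0 to the products with j odd or with a
  free u_l; and around such a profile the averages of all products can be prescribed independently
  of each other, within a small radius. This suggests the class of systems \<open>control_system\<close> below:
  inputs are labelled by letters; good letters are free controls, the drift letter is constantly 1,
  and every other (bad) letter may only be moved slightly around a prescribed value. The class is
  stable under the elimination of the first coordinate: the product of x_0^j with the input of l is
  the input of the letter j # l, which is good if l is good or j is odd
  (\<open>lifted_parity_condition\<close>, \<open>excursion_realize\<close>). Trajectories of the eliminated system whose inputs
  stay within the radius are limits of trajectories of the given one (\<open>flow_average\<close>,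
  \<open>approx_from_lifted\<close>).

  That averages can only be prescribed within a small radius is harmless: multiplying the good
  inputs by mu, and leaving the bad ones alone, multiplies x_c by mu^{weight c} with a positive
  weight (\<open>steers_scale\<close>). So a motion with large good inputs can be shrunk to one with small good
  inputs.

  Exact controllability is proved by induction on the number of coordinates, for all systems of the
  class at once. Two smaller systems are used. Eliminating the first coordinate yields motions that
  start at 0 and end close to +delta or -delta on the axis of the last coordinate. Dropping the last
  coordinate yields an exactly controllable system; it returns all other coordinates to 0, at
  the price of a motion of the last coordinate that is negligible, again by scaling. Hence there are
  loops that change only the last coordinate, in both directions, and by scaling in any amount
  (\<open>controllable_Suc\<close>).

  Flows are given by iterated integrals. That they are the only solutions is proved one
  coordinate after the other: an absolutely continuous function whose derivative vanishes almost
  everywhere is constant (\<open>abs_continuous_zero_derivative\<close>).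
\<close>

section \<open>Bounded inputs with finitely many discontinuities\<close>

definition regular_input :: "(real \<Rightarrow> real) \<Rightarrow> bool" where
  "regular_input h \<longleftrightarrow> bounded (range h) \<and> finite {t. \<not> isCont h t}"

lemma regular_input_const: "regular_input (\<lambda>t. a)"
  by (simp add: regular_input_def)

lemma regular_input_cmult:
  assumes "regular_input h"
  shows "regular_input (\<lambda>t. a * h t)"
proof -
  have "bounded (range (\<lambda>t. a * h t))"
    using bounded_scaling[of "range h" a] assms
    by (simp add: regular_input_def image_image)
  moreover have "{t. \<not> isCont (\<lambda>t. a * h t) t} \<subseteq> {t. \<not> isCont h t}"
    by auto
  then have "finite {t. \<not> isCont (\<lambda>t. a * h t) t}"
    by (rule finite_subset) (use assms in \<open>simp add: regular_input_def\<close>)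
  ultimately show ?thesis
    unfolding regular_input_def by blast
qed

lemma regular_input_append:
  assumes "regular_input f" "regular_input g"
  shows "regular_input (\<lambda>t. if t < a then f t else g (t - a))"
    (is "regular_input ?h")
proof -
  have "range ?h \<subseteq> range f \<union> range g"
    by auto
  then have "bounded (range ?h)"
    by (rule bounded_subset[rotated]) (use assms in \<open>simp add: regular_input_def\<close>)
  moreover have "{t. \<not> isCont ?h t} \<subseteq> {a} \<union> {t. \<not> isCont f t} \<union> (\<lambda>t. t + a) ` {t. \<not> isCont g t}"
  proof
    fix t assume t: "t \<in> {t. \<not> isCont ?h t}"
    show "t \<in> {a} \<union> {t. \<not> isCont f t} \<union> (\<lambda>t. t + a) ` {t. \<not> isCont g t}"
    proof (cases t a rule: linorder_cases)
      case less
      have "eventually (\<lambda>s. ?h s = f s) (nhds t)"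
        using eventually_nhds_in_open[of "{..<a}" t] less by (auto elim!: eventually_mono)
      from isCont_cong[OF this] t show ?thesis by simp
    next
      case greater
      have "eventually (\<lambda>s. ?h s = g (s - a)) (nhds t)"
        using eventually_nhds_in_open[of "{a<..}" t] greater by (auto elim!: eventually_mono)
      from isCont_cong[OF this] t have "\<not> isCont (\<lambda>s. g (s - a)) t" by simp
      then have "\<not> isCont g (t - a)"
        using isCont_o2[of t "\<lambda>s. s - a" g] by auto
      then show ?thesis by (auto intro!: image_eqI[of _ _ "t - a"])
    qed auto
  qed
  then have "finite {t. \<not> isCont ?h t}"
    by (rule finite_subset) (use assms in \<open>simp add: regular_input_def\<close>)
  ultimately show ?thesis
    unfolding regular_input_def by blast
qed

lemma regular_input_measurable:
  assumes "regular_input h"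
  shows "h \<in> borel_measurable borel"
proof (rule borel_measurable_continuous_countable_exceptions)
  show "countable {t. \<not> isCont h t}"
    using assms by (simp add: regular_input_def countable_finite)
  show "continuous_on (- {t. \<not> isCont h t}) h"
    by (auto intro!: continuous_at_imp_continuous_on)
qed

lemma regular_input_integrable:
  fixes g :: "real \<Rightarrow> real"
  assumes "continuous_on {a..b} g" "regular_input h"
  shows "(\<lambda>t. g t * h t) integrable_on {a..b}"
proof -
  obtain B where B: "\<And>t. norm (h t) \<le> B"
    using assms(2) unfolding regular_input_def bounded_iff by blast
  have "bounded (g ` {a..b})"
    using assms(1) compact_continuous_image compact_imp_bounded by blast
  then obtain D where D: "\<And>t. t \<in> {a..b} \<Longrightarrow> norm (g t) \<le> D"
    unfolding bounded_iff by blast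
  show ?thesis
  proof (rule measurable_bounded_by_integrable_imp_integrable)
    have "h \<in> borel_measurable (lebesgue_on {a..b})"
      using regular_input_measurable[OF assms(2)]
      by (simp add: measurable_completion measurable_restrict_space1)
    moreover have "g \<in> borel_measurable (lebesgue_on {a..b})"
      by (simp add: assms(1) continuous_imp_measurable_on_sets_lebesgue)
    ultimately show "(\<lambda>t. g t * h t) \<in> borel_measurable (lebesgue_on {a..b})"
      by simp
    show "(\<lambda>t. D * B) integrable_on {a..b}"
      by (rule integrable_const_ivl)
    show "norm (g t * h t) \<le> D * B" if "t \<in> {a..b}" for t
      using mult_mono[OF D[OF that] B[of t]] D[OF that] norm_ge_zero[of "g t"]
      by (auto simp: abs_mult intro: order_trans)
    show "{a..b} \<in> sets lebesgue" by simp
  qed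
qed

section \<open>Flows of triangular monomial systems\<close>

text \<open>
  The solution of x_c' = (prod_{j<c} x_j^{m c j}) * h_c with x(0) = p. The system is triangular, so its
  integral equation is a recursion on the coordinate.
\<close>

function flow ::
    "(nat \<Rightarrow> nat \<Rightarrow> nat) \<Rightarrow> (real \<Rightarrow> nat \<Rightarrow> real) \<Rightarrow> (nat \<Rightarrow> real) \<Rightarrow> real \<Rightarrow> nat \<Rightarrow> real"
  where
  "flow m h p t c = p c + integral {0..t} (\<lambda>s. (\<Prod>j<c. flow m h p s j ^ m c j) * h s c)"
  by pat_completeness auto
termination
  by (relation "Wellfounded.measure (\<lambda>(m, h, p, t, c). c)") simp_all

declare flow.simps [simp del]

lemma flow_0 [simp]: "flow m h p 0 c = p c"
  using flow.simps[of m h p 0 c] by simp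

lemma flow_continuous:
  assumes "\<And>c. c < n \<Longrightarrow> regular_input (\<lambda>t. h t c)" "c < n"
  shows "continuous_on {0..T} (\<lambda>t. flow m h p t c)"
  using assms(2)
proof (induction c rule: less_induct)
  case (less c)
  have "(\<lambda>s. (\<Prod>j<c. flow m h p s j ^ m c j) * h s c) integrable_on {0..T}"
    using less by (intro regular_input_integrable continuous_on_prod continuous_on_power assms(1)) auto
  then show ?case
    by (subst flow.simps) (intro continuous_intros indefinite_integral_continuous_1)
qed

lemma flow_integrable:
  assumes "\<And>c. c < n \<Longrightarrow> regular_input (\<lambda>t. h t c)" "c < n" "0 \<le> a"
  shows "(\<lambda>s. (\<Prod>j<c. flow m h p s j ^ m c j) * h s c) integrable_on {a..b}"
proof -
  have "continuous_on {0..b} (\<lambda>t. flow m h p t j)" if "j < c" for j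
    using flow_continuous[of n h j] assms that by auto
  then have "continuous_on {a..b} (\<lambda>t. flow m h p t j)" if "j < c" for j
    using assms(3) continuous_on_subset that by fastforce
  then show ?thesis
    using assms by (intro regular_input_integrable continuous_on_prod continuous_on_power) auto
qed

text \<open>
  Uniqueness for the integral equation. The scaling and concatenation rules below are instances:
  the transformed flow satisfies the integral equation of the transformed data.
\<close>

lemma flow_eqI:
  assumes "\<And>t c. t \<in> {0..T} \<Longrightarrow> c < n \<Longrightarrow>
      y t c = p c + integral {0..t} (\<lambda>s. (\<Prod>j<c. y s j ^ m c j) * h s c)"
    and "t \<in> {0..T}" "c < n"
  shows "y t c = flow m h p t c"
  using assms(2,3)
proof (induction c arbitrary: t rule: less_induct)
  case (less c)
  have "integral {0..t} (\<lambda>s. (\<Prod>j<c. y s j ^ m c j) * h s c)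
      = integral {0..t} (\<lambda>s. (\<Prod>j<c. flow m h p s j ^ m c j) * h s c)"
    using less by (intro Henstock_Kurzweil_Integration.integral_cong) simp
  then show ?case
    using assms(1)[OF less.prems] flow.simps[of m h p t c] by simp
qed

lemma flow_cong:
  assumes "\<And>j c. j < c \<Longrightarrow> c < n \<Longrightarrow> m c j = m' c j"
    and "\<And>s c. s \<in> {0..T} \<Longrightarrow> c < n \<Longrightarrow> h s c = h' s c"
    and "\<And>c. c < n \<Longrightarrow> p c = p' c" "t \<in> {0..T}" "c < n"
  shows "flow m h p t c = flow m' h' p' t c"
proof (rule flow_eqI[of T n "flow m h p"])
  fix t c assume tc: "t \<in> {0..T}" "c < n"
  have "integral {0..t} (\<lambda>s. (\<Prod>j<c. flow m h p s j ^ m c j) * h s c)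
     = integral {0..t} (\<lambda>s. (\<Prod>j<c. flow m h p s j ^ m' c j) * h' s c)"
    using tc assms by (intro Henstock_Kurzweil_Integration.integral_cong) simp
  then show "flow m h p t c = p' c + integral {0..t} (\<lambda>s. (\<Prod>j<c. flow m h p s j ^ m' c j) * h' s c)"
    using assms(3) tc flow.simps[of m h p t c] by simp
qed (use assms in auto)

lemma integral_shift_right:
  fixes f :: "real \<Rightarrow> real"
  shows "integral {a..a + s} f = integral {0..s} (\<lambda>t. f (a + t))"
  using integral_shift_real_ivl[of a a "a + s" f] by (simp add: add.commute)

lemma flow_append:
  assumes reg: "\<And>c. c < n \<Longrightarrow> regular_input (\<lambda>t. h t c)"
      "\<And>c. c < n \<Longrightarrow> regular_input (\<lambda>t. k t c)"
    and "0 \<le> a" "0 \<le> t" "c < n"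
  shows "flow m (\<lambda>t. if t < a then h t else k (t - a)) p (a + t) c
       = flow m k (flow m h p a) t c" (is "flow m ?w p _ _ = _")
proof -
  have regw: "regular_input (\<lambda>t. ?w t c)" if "c < n" for c
    using regular_input_append[OF reg[OF that], of a] by (simp add: if_distrib if_distribR cong: if_cong)
  have before: "flow m ?w p s c = flow m h p s c" if "s \<in> {0..a}" "c < n" for s c
    using that
  proof (induction c arbitrary: s rule: less_induct)
    case (less c)
    have "integral {0..s} (\<lambda>s. (\<Prod>j<c. flow m ?w p s j ^ m c j) * ?w s c)
      = integral {0..s} (\<lambda>s. (\<Prod>j<c. flow m h p s j ^ m c j) * h s c)"
      using less by (intro integral_spike[of "{a}"]) auto
    then show ?case
      using flow.simps[of m ?w p s c] flow.simps[of m h p s c] by simp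
  qed
  show ?thesis
  proof (rule flow_eqI[of t n "\<lambda>t c. flow m ?w p (a + t) c"])
    fix s c assume s: "s \<in> {0..t}" "c < n"
    let ?f = "\<lambda>s. (\<Prod>j<c. flow m ?w p s j ^ m c j) * ?w s c"
    have "flow m ?w p (a + s) c = p c + (integral {0..a} ?f + integral {a..a+s} ?f)"
      using s assms(3) flow_integrable[where h = ?w and n = n and a = 0 and b = "a + s"] regw
      by (subst flow.simps) (auto simp: Henstock_Kurzweil_Integration.integral_combine)
    also have "\<dots> = flow m ?w p a c + integral {a..a+s} ?f"
      using flow.simps[of m ?w p a c] by simp
    also have "flow m ?w p a c = flow m h p a c"
      using before s assms(3) by simp
    also have "integral {a..a+s} ?f = integral {0..s} (\<lambda>s. ?f (a + s))"
      by (rule integral_shift_right)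
    also have "\<dots> = integral {0..s} (\<lambda>s. (\<Prod>j<c. flow m ?w p (a + s) j ^ m c j) * k s c)"
      by (intro Henstock_Kurzweil_Integration.integral_cong) simp
    finally show "flow m ?w p (a + s) c = flow m h p a c
        + integral {0..s} (\<lambda>s. (\<Prod>j<c. flow m ?w p (a + s) j ^ m c j) * k s c)" .
  qed (use assms in auto)
qed

lemma flow_append_before:
  assumes "s \<in> {0..a}" "c < n"
  shows "flow m (\<lambda>t. if t < a then h t else k (t - a)) p s c = flow m h p s c" (is "flow m ?w p _ _ = _")
    using assms
  proof (induction c arbitrary: s rule: less_induct)
    case (less c)
    have "integral {0..s} (\<lambda>s. (\<Prod>j<c. flow m ?w p s j ^ m c j) * ?w s c)
      = integral {0..s} (\<lambda>s. (\<Prod>j<c. flow m h p s j ^ m c j) * h s c)"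
      using less by (intro integral_spike[of "{a}"]) auto
    then show ?case
      using flow.simps[of m ?w p s c] flow.simps[of m h p s c] by simp
  qed

lemma flow_scale:
  fixes g w :: "nat \<Rightarrow> nat"
  assumes g: "\<And>c. c < n \<Longrightarrow> g c = w c + (\<Sum>j<c. m c j * g j)" and "c < n" "0 \<le> t"
  shows "flow m (\<lambda>t c. \<mu> ^ w c * h t c) (\<lambda>c. \<mu> ^ g c * p c) t c = \<mu> ^ g c * flow m h p t c"
proof -
  have "\<mu> ^ g c * flow m h p t c = flow m (\<lambda>t c. \<mu> ^ w c * h t c) (\<lambda>c. \<mu> ^ g c * p c) t c"
  proof (rule flow_eqI[of t n "\<lambda>t c. \<mu> ^ g c * flow m h p t c"])
    fix s c assume s: "s \<in> {0..t}" "c < n"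
    have "(\<Prod>j<c. (\<mu> ^ g j * flow m h p \<tau> j) ^ m c j) * (\<mu> ^ w c * h \<tau> c)
      = \<mu> ^ g c * ((\<Prod>j<c. flow m h p \<tau> j ^ m c j) * h \<tau> c)" for \<tau>
    proof -
      have "(\<Prod>j<c. (\<mu> ^ g j * flow m h p \<tau> j) ^ m c j)
          = \<mu> ^ (\<Sum>j<c. m c j * g j) * (\<Prod>j<c. flow m h p \<tau> j ^ m c j)"
        by (simp add: power_mult_distrib prod.distrib power_sum mult.commute flip: power_mult)
      then show ?thesis using g[OF s(2)] by (simp add: power_add mult_ac)
    qed
    then have "integral {0..s} (\<lambda>\<tau>. (\<Prod>j<c. (\<mu> ^ g j * flow m h p \<tau> j) ^ m c j) * (\<mu> ^ w c * h \<tau> c))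
      = \<mu> ^ g c * integral {0..s} (\<lambda>s. (\<Prod>j<c. flow m h p s j ^ m c j) * h s c)"
      by (simp only: integral_mult_right)
    then show "\<mu> ^ g c * flow m h p s c = \<mu> ^ g c * p c
      + integral {0..s} (\<lambda>\<tau>. (\<Prod>j<c. (\<mu> ^ g j * flow m h p \<tau> j) ^ m c j) * (\<mu> ^ w c * h \<tau> c))"
      using flow.simps[of m h p s c] by (simp only: distrib_left)
  qed (use assms in auto)
  then show ?thesis by simp
qed

text \<open>
  The first coordinate is absorbed into the inputs. This identity is the algebraic half of the
  elimination step.
\<close>

lemma flow_Suc:
  "flow m h p t (Suc c) = flow (\<lambda>c j. m (Suc c) (Suc j))
     (\<lambda>t c. flow m h p t 0 ^ m (Suc c) 0 * h t (Suc c)) (\<lambda>c. p (Suc c)) t c"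
proof (induction c arbitrary: t rule: less_induct)
  case (less c)
  have "(\<Prod>j<Suc c. flow m h p s j ^ m (Suc c) j) * h s (Suc c) =
     (\<Prod>j<c. flow m h p s (Suc j) ^ m (Suc c) (Suc j)) * (flow m h p s 0 ^ m (Suc c) 0 * h s (Suc c))" for s
    by (simp only: prod.lessThan_Suc_shift) simp
  moreover have "(\<Prod>j<c. flow m h p s (Suc j) ^ m (Suc c) (Suc j))
    = (\<Prod>j<c. flow (\<lambda>c j. m (Suc c) (Suc j)) (\<lambda>t c. flow m h p t 0 ^ m (Suc c) 0 * h t (Suc c))
        (\<lambda>c. p (Suc c)) s j ^ m (Suc c) (Suc j))" for s
    using less by (intro prod.cong) auto
  ultimately show ?case
    by (simp only: flow.simps[of m h p t "Suc c"] flow.simps[of "\<lambda>c j. m (Suc c) (Suc j)" _ _ t c])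
qed

lemma abs_integral_le:
  fixes f :: "real \<Rightarrow> real"
  assumes "f integrable_on {a..b}" "a \<le> b" "\<And>t. t \<in> {a..b} \<Longrightarrow> \<bar>f t\<bar> \<le> B"
  shows "\<bar>integral {a..b} f\<bar> \<le> B * (b - a)"
proof -
  have "norm (integral {a..b} f) \<le> integral {a..b} (\<lambda>_. B)"
    by (rule integral_norm_bound_integral) (use assms in auto)
  then show ?thesis using assms(2) by (simp add: mult.commute)
qed

lemma abs_power_diff_le:
  fixes x y K :: real
  assumes "\<bar>x\<bar> \<le> K" "\<bar>y\<bar> \<le> K"
  shows "\<bar>x ^ k - y ^ k\<bar> \<le> real k * K ^ (k - 1) * \<bar>x - y\<bar>"
proof -
  have "\<bar>\<Sum>i<k. y ^ (k - Suc i) * x ^ i\<bar> \<le> (\<Sum>i<k. K ^ (k - 1))"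
  proof (rule sum_abs[THEN order_trans], rule sum_mono)
    fix i assume "i \<in> {..<k}"
    then have "K ^ (k - 1) = K ^ (k - Suc i) * K ^ i"
      by (simp flip: power_add)
    then show "\<bar>y ^ (k - Suc i) * x ^ i\<bar> \<le> K ^ (k - 1)"
      using assms by (simp add: abs_mult power_abs mult_mono power_mono)
  qed
  moreover have "x ^ k - y ^ k = (x - y) * (\<Sum>i<k. y ^ (k - Suc i) * x ^ i)"
    by (rule power_diff_sumr2)
  ultimately show ?thesis
    using mult_left_mono[of _ _ "\<bar>x - y\<bar>"] by (fastforce simp: abs_mult mult_ac)
qed

lemma abs_monomial_le:
  fixes a :: "nat \<Rightarrow> real"
  assumes "\<And>j. j < c \<Longrightarrow> \<bar>a j\<bar> \<le> K"
  shows "\<bar>\<Prod>j<c. a j ^ e j\<bar> \<le> (\<Prod>j<c. K ^ e j)"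
  unfolding abs_prod power_abs by (rule prod_mono) (use assms in \<open>simp add: power_mono\<close>)

lemma monomial_lipschitz:
  fixes K :: real and e :: "nat \<Rightarrow> nat"
  assumes "0 \<le> K"
  shows "\<exists>\<Lambda>\<ge>0. \<forall>a b d. (\<forall>j<c. \<bar>a j\<bar> \<le> K \<and> \<bar>b j\<bar> \<le> K \<and> \<bar>a j - b j\<bar> \<le> d) \<and> 0 \<le> d \<longrightarrow>
     \<bar>(\<Prod>j<c. a j ^ e j) - (\<Prod>j<c. b j ^ e j)\<bar> \<le> \<Lambda> * d"
proof (induction c)
  case 0
  then show ?case by (intro exI[of _ 0]) auto
next
  case (Suc c)
  then obtain \<Lambda> where \<Lambda>: "0 \<le> \<Lambda>" and lip: "\<And>a b d. \<lbrakk>\<forall>j<c. \<bar>a j\<bar> \<le> K \<and> \<bar>b j\<bar> \<le> K \<and> \<bar>a j - b j\<bar> \<le> d; 0 \<le> d\<rbrakk>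
      \<Longrightarrow> \<bar>(\<Prod>j<c. a j ^ e j) - (\<Prod>j<c. b j ^ e j)\<bar> \<le> \<Lambda> * d"
    by blast
  let ?M = "\<Prod>j<c. K ^ e j" and ?D = "real (e c) * K ^ (e c - 1)"
  have M: "0 \<le> ?M" "0 \<le> ?D" using assms by (auto intro: prod_nonneg)
  have "\<bar>(\<Prod>j<Suc c. a j ^ e j) - (\<Prod>j<Suc c. b j ^ e j)\<bar> \<le> (\<Lambda> * K ^ e c + ?M * ?D) * d"
    if ab: "\<forall>j<Suc c. \<bar>a j\<bar> \<le> K \<and> \<bar>b j\<bar> \<le> K \<and> \<bar>a j - b j\<bar> \<le> d" "0 \<le> d" for a b d
  proof -
    let ?A = "\<Prod>j<c. a j ^ e j" and ?B = "\<Prod>j<c. b j ^ e j"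
    have "\<bar>?A - ?B\<bar> * \<bar>a c ^ e c\<bar> \<le> (\<Lambda> * d) * K ^ e c"
      using lip[of a b d] ab \<Lambda> by (intro mult_mono) (auto simp: power_abs power_mono)
    moreover have "\<bar>a c ^ e c - b c ^ e c\<bar> \<le> ?D * d"
      using abs_power_diff_le[of "a c" K "b c" "e c"] ab mult_left_mono[of "\<bar>a c - b c\<bar>" d ?D] M by
          fastforce
    then have "\<bar>?B\<bar> * \<bar>a c ^ e c - b c ^ e c\<bar> \<le> ?M * (?D * d)"
      using abs_monomial_le[of c b K e] ab M by (intro mult_mono) auto
    moreover have "?A * a c ^ e c - ?B * b c ^ e c = (?A - ?B) * a c ^ e c + ?B * (a c ^ e c - b c ^ e c)"
      by (simp add: algebra_simps)
    then have "\<bar>?A * a c ^ e c - ?B * b c ^ e c\<bar> \<le> \<bar>?A - ?B\<bar> * \<bar>a c ^ e c\<bar> + \<bar>?B\<bar> * \<bar>a c ^ e c - b c ^ e c\<bar>"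
      using abs_triangle_ineq[of "(?A - ?B) * a c ^ e c" "?B * (a c ^ e c - b c ^ e c)"]
      by (simp only: abs_mult)
    ultimately have "\<bar>?A * a c ^ e c - ?B * b c ^ e c\<bar> \<le> \<Lambda> * d * K ^ e c + ?M * (?D * d)"
      by linarith
    then show ?thesis
      by (simp add: algebra_simps)
  qed
  moreover have "0 \<le> \<Lambda> * K ^ e c + ?M * ?D" using \<Lambda> M assms by simp
  ultimately show ?case by blast
qed

text \<open>
  The bound C is a parameter since the constants of \<open>flow_bound\<close> and \<open>flow_average\<close> may
  depend on it, but not on how fast an input oscillates.
\<close>

definition tame_inputs :: "nat \<Rightarrow> real \<Rightarrow> real \<Rightarrow> (real \<Rightarrow> nat \<Rightarrow> real) \<Rightarrow> bool" where
  "tame_inputs n T C h \<longleftrightarrow>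
     (\<forall>c<n. regular_input (\<lambda>t. h t c) \<and> (\<forall>t\<in>{0..T}. \<bar>h t c\<bar> \<le> C))"

lemma flow_bound:
  assumes "0 \<le> T" "0 \<le> C"
  shows "\<exists>K\<ge>0. \<forall>h p. tame_inputs n T C h \<and> (\<forall>c<n. \<bar>p c\<bar> \<le> P) \<longrightarrow>
           (\<forall>t\<in>{0..T}. \<forall>c<n. \<bar>flow m h p t c\<bar> \<le> K)"
proof (induction n)
  case 0
  then show ?case by auto
next
  case (Suc n)
  then obtain K where K: "0 \<le> K" and le_K: "\<And>h p t c. \<lbrakk>tame_inputs n T C h; \<forall>c<n. \<bar>p c\<bar> \<le> P; t \<in> {0..T};
      c < n\<rbrakk>
      \<Longrightarrow> \<bar>flow m h p t c\<bar> \<le> K"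
    by blast
  let ?M = "(\<Prod>j<n. K ^ m n j) * C"
  have M: "0 \<le> ?M" using K assms by (auto intro!: mult_nonneg_nonneg prod_nonneg)
  have "\<bar>flow m h p t c\<bar> \<le> max K (P + ?M * T)"
    if h: "tame_inputs (Suc n) T C h" and p: "\<forall>c<Suc n. \<bar>p c\<bar> \<le> P" and t: "t \<in> {0..T}"
        and c: "c < Suc n" for h p t c
  proof (cases "c = n")
    case True
    have hn: "tame_inputs n T C h" using h by (simp add: tame_inputs_def)
    have "\<bar>integral {0..t} (\<lambda>s. (\<Prod>j<n. flow m h p s j ^ m n j) * h s n)\<bar> \<le> ?M * (t - 0)"
    proof (rule abs_integral_le)
      show "(\<lambda>s. (\<Prod>j<n. flow m h p s j ^ m n j) * h s n) integrable_on {0..t}"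
        by (rule flow_integrable[of "Suc n"]) (use h in \<open>auto simp: tame_inputs_def\<close>)
      show "\<bar>(\<Prod>j<n. flow m h p s j ^ m n j) * h s n\<bar> \<le> ?M" if "s \<in> {0..t}" for s
        unfolding abs_mult
      proof (rule mult_mono)
        show "\<bar>\<Prod>j<n. flow m h p s j ^ m n j\<bar> \<le> (\<Prod>j<n. K ^ m n j)"
          using that t p by (intro abs_monomial_le le_K[OF hn]) auto
        show "\<bar>h s n\<bar> \<le> C" using that t h by (auto simp: tame_inputs_def)
        show "0 \<le> (\<Prod>j<n. K ^ m n j)" using K by (auto intro: prod_nonneg)
      qed simp
    qed (use t in auto)
    also have "\<dots> \<le> ?M * T" using M t by (intro mult_left_mono) auto
    finally show ?thesis
      using p True flow.simps[of m h p t n] by (fastforce simp: abs_le_iff)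
  next
    case False
    then have "c < n" using c by simp
    then show ?thesis
      using le_K[of h p t c] h p t by (fastforce simp: tame_inputs_def)
  qed
  then show ?case using K by (intro exI[of _ "max K (P + ?M * T)"]) auto
qed

lemma flow_lipschitz:
  assumes h: "tame_inputs n T C h" and c: "c < n" and K: "\<And>t j. t \<in> {0..T} \<Longrightarrow> j < c \<Longrightarrow> \<bar>flow m h p t j\<bar> \<le> K"
    and C: "0 \<le> C" and st: "0 \<le> s" "s \<le> t" "t \<le> T"
  shows "\<bar>flow m h p t c - flow m h p s c\<bar> \<le> (\<Prod>j<c. K ^ m c j) * C * (t - s)"
proof -
  let ?f = "\<lambda>s. (\<Prod>j<c. flow m h p s j ^ m c j) * h s c"
  have int: "?f integrable_on {a..b}" if "0 \<le> a" for a b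
    by (rule flow_integrable[of n]) (use h c that in \<open>auto simp: tame_inputs_def\<close>)
  have "integral {0..s} ?f + integral {s..t} ?f = integral {0..t} ?f"
    using st int by (intro Henstock_Kurzweil_Integration.integral_combine) auto
  then have "flow m h p t c - flow m h p s c = integral {s..t} ?f"
    using flow.simps[of m h p t c] flow.simps[of m h p s c] by simp
  moreover have "\<bar>integral {s..t} ?f\<bar> \<le> (\<Prod>j<c. K ^ m c j) * C * (t - s)"
  proof (rule abs_integral_le)
    show "\<bar>?f r\<bar> \<le> (\<Prod>j<c. K ^ m c j) * C" if "r \<in> {s..t}" for r
      unfolding abs_mult
    proof (rule mult_mono)
      show le: "\<bar>\<Prod>j<c. flow m h p r j ^ m c j\<bar> \<le> (\<Prod>j<c. K ^ m c j)"
        using that st by (intro abs_monomial_le K) auto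
      show "\<bar>h r c\<bar> \<le> C" using that st h c by (auto simp: tame_inputs_def)
      show "0 \<le> (\<Prod>j<c. K ^ m c j)" using order_trans[OF abs_ge_zero le] .
    qed simp
  qed (use st int in auto)
  ultimately show ?thesis by simp
qed

lemma flow_has_derivative:
  assumes reg: "\<And>c. c < n \<Longrightarrow> regular_input (\<lambda>t. h t c)" and c: "c < n"
    and t: "0 < t" and cont: "isCont (\<lambda>s. h s c) t"
  shows "((\<lambda>s. flow m h p s c) has_real_derivative (\<Prod>j<c. flow m h p t j ^ m c j) * h t c) (at t)"
proof -
  let ?f = "\<lambda>s. (\<Prod>j<c. flow m h p s j ^ m c j) * h s c" and ?T = "t + 1"
  have "continuous (at t within {0..?T}) (\<lambda>s. flow m h p s j)" if "j < c" for j
    using flow_continuous[of n h j ?T m p] reg c that t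
    by (simp add: continuous_on_eq_continuous_within)
  moreover have "continuous (at t within {0..?T}) (\<lambda>s. h s c)"
    using cont by (rule continuous_at_imp_continuous_at_within)
  ultimately have "continuous (at t within {0..?T}) ?f"
    by (intro continuous_mult continuous_prod continuous_power) auto
  then have "((\<lambda>s. integral {0..s} ?f) has_vector_derivative ?f t) (at t within {0..?T})"
    using integral_has_vector_derivative_continuous_at[of ?f 0 ?T t "{}"]
      flow_integrable[of n h c 0 m p ?T] reg c t by simp
  then have "((\<lambda>s. integral {0..s} ?f) has_real_derivative ?f t) (at t)"
    using t by (simp add: has_real_derivative_iff_has_vector_derivative at_within_Icc_at)
  from DERIV_add[OF DERIV_const[of "p c"] this]
  show ?thesis by (simp add: flow.simps[of m h p _ c, symmetric])
qed

section \<open>Averaging of fast oscillations\<close>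

text \<open>
  On each cell the slowly varying G may be replaced by its value at the left end, up to an error of
  order \<open>\<tau>\<close>, and the constant then integrates to 0 against f. The error is of order
  \<open>\<tau>\<^sup>2\<close> per cell, hence of order \<open>\<tau>\<close> in total.
\<close>

lemma integral_oscillating:
  fixes G f :: "real \<Rightarrow> real"
  assumes G: "continuous_on {0..T} G" "\<And>t. t \<in> {0..T} \<Longrightarrow> \<bar>G t\<bar> \<le> K"
      "\<And>s t. \<lbrakk>0 \<le> s; s \<le> t; t \<le> T\<rbrakk> \<Longrightarrow> \<bar>G t - G s\<bar> \<le> \<Lambda> * (t - s)"
    and f: "regular_input f" "\<And>t. t \<in> {0..T} \<Longrightarrow> \<bar>f t\<bar> \<le> C"
    and \<tau>: "0 < \<tau>" "T = real N * \<tau>"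
    and cells: "\<And>i. i < N \<Longrightarrow> integral {real i * \<tau>..real (Suc i) * \<tau>} f = 0"
    and "0 \<le> \<Lambda>" "0 \<le> C" "0 \<le> K" and t: "t \<in> {0..T}"
  shows "\<bar>integral {0..t} (\<lambda>s. G s * f s)\<bar> \<le> (\<Lambda> * C * T + K * C) * \<tau>"
proof -
  let ?g = "\<lambda>s. G s * f s"
  have intg: "?g integrable_on {a..b}" if "0 \<le> a" "b \<le> T" for a b
    using that G(1) f(1) by (intro regular_input_integrable) (auto intro: continuous_on_subset)
  have intf: "f integrable_on {a..b}" for a b
    using regular_input_integrable[of a b "\<lambda>_. 1" f] f(1) by simp
  have grid: "\<bar>integral {0..real i * \<tau>} ?g\<bar> \<le> real i * (\<Lambda> * C * \<tau> * \<tau>)" if "i \<le> N" for i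
    using that
  proof (induction i)
    case (Suc i)
    let ?a = "real i * \<tau>" and ?b = "real (Suc i) * \<tau>"
    have ab: "0 \<le> ?a" "?a \<le> ?b" "?b \<le> T" "?b - ?a = \<tau>"
      using \<tau> mult_right_mono[of "real (Suc i)" "real N" \<tau>] Suc.prems by (auto simp: distrib_right)
    have "integral {?a..?b} ?g = integral {?a..?b} (\<lambda>s. ?g s - G ?a * f s)"
      using intg[of ?a ?b] intf[of ?a ?b] ab cells[of i] Suc.prems
      by (subst integral_diff) (auto intro: integrable_on_mult_right)
    moreover have "\<bar>integral {?a..?b} (\<lambda>s. ?g s - G ?a * f s)\<bar> \<le> \<Lambda> * \<tau> * C * (?b - ?a)"
    proof (rule abs_integral_le)
      show "(\<lambda>s. ?g s - G ?a * f s) integrable_on {?a..?b}"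
        using intg[of ?a ?b] intf[of ?a ?b] ab by (intro integrable_diff integrable_on_mult_right) auto
      fix s assume s: "s \<in> {?a..?b}"
      have "\<bar>G s - G ?a\<bar> \<le> \<Lambda> * (s - ?a)" using G(3)[of ?a s] s ab by auto
      also have "\<dots> \<le> \<Lambda> * \<tau>" using s ab \<open>0 \<le> \<Lambda>\<close> by (intro mult_left_mono) auto
      finally have "\<bar>G s - G ?a\<bar> * \<bar>f s\<bar> \<le> (\<Lambda> * \<tau>) * C"
      proof (rule mult_mono)
        have "s \<in> {0..T}" using s ab by (meson atLeastAtMost_iff order_trans)
        then show "\<bar>f s\<bar> \<le> C" by (rule f(2))
      qed (use \<tau> \<open>0 \<le> \<Lambda>\<close> in auto)
      then show "\<bar>?g s - G ?a * f s\<bar> \<le> \<Lambda> * \<tau> * C"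
        by (simp add: abs_mult flip: left_diff_distrib)
    qed (use ab in auto)
    moreover have "integral {0..?b} ?g = integral {0..?a} ?g + integral {?a..?b} ?g"
      using intg[of 0 ?b] ab by (intro Henstock_Kurzweil_Integration.integral_combine[symmetric]) auto
    ultimately have "\<bar>integral {0..?b} ?g\<bar> \<le> real i * (\<Lambda> * C * \<tau> * \<tau>) + \<Lambda> * \<tau> * C * \<tau>"
      using Suc ab(4) by simp
    then show ?case by (simp add: algebra_simps)
  qed simp
  define i where "i = nat \<lfloor>t / \<tau>\<rfloor>"
  have ti: "real i \<le> t / \<tau>" "t / \<tau> < real i + 1"
    using t \<tau> by (auto simp: i_def)
  then have it: "real i * \<tau> \<le> t" "t - real i * \<tau> \<le> \<tau>"
    using \<tau> by (auto simp: field_simps)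
  have "real i * \<tau> \<le> real N * \<tau>"
    using it(1) t \<tau>(2) by (metis atLeastAtMost_iff order_trans)
  then have "real i \<le> real N" using \<tau>(1) by (rule mult_right_le_imp_le)
  then have "i \<le> N" by simp
  have "\<bar>integral {real i * \<tau>..t} ?g\<bar> \<le> K * C * (t - real i * \<tau>)"
  proof (rule abs_integral_le)
    show "\<bar>?g s\<bar> \<le> K * C" if "s \<in> {real i * \<tau>..t}" for s
      unfolding abs_mult using that t \<tau> \<open>0 \<le> K\<close> order_trans[of 0 "real i * \<tau>" s]
      by (intro mult_mono G(2) f(2)) auto
  qed (use it t \<tau> intg in auto)
  also have "\<dots> \<le> K * C * \<tau>" using it assms by (intro mult_left_mono) auto
  finally have "\<bar>integral {real i * \<tau>..t} ?g\<bar> \<le> K * C * \<tau>" .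
  moreover have "\<bar>integral {0..real i * \<tau>} ?g\<bar> \<le> \<Lambda> * C * T * \<tau>"
  proof -
    have "real i * (\<Lambda> * C * \<tau> * \<tau>) \<le> real N * (\<Lambda> * C * \<tau> * \<tau>)"
      using \<open>i \<le> N\<close> assms by (intro mult_right_mono) auto
    with grid[OF \<open>i \<le> N\<close>] show ?thesis using \<tau> by (simp add: mult_ac)
  qed
  moreover have "integral {0..t} ?g = integral {0..real i * \<tau>} ?g + integral {real i * \<tau>..t} ?g"
    using intg[of 0 t] it t \<tau> by (intro Henstock_Kurzweil_Integration.integral_combine[symmetric]) auto
  ultimately show ?thesis by (simp add: algebra_simps)
qed

text \<open>
  Inputs with equal means on the cells of a grid have flows that differ by the order of the
  mesh. Coordinate after coordinate, the difference of the integrands splits into a difference of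
  monomials, controlled by the previous coordinates, and an oscillating integral.
\<close>

lemma flow_average:
  assumes T: "0 < T" and C: "0 \<le> C"
  shows "\<exists>K\<ge>0. \<forall>N h h' p. 0 < N \<and> tame_inputs n T C h \<and> tame_inputs n T C h' \<and> (\<forall>c<n. \<bar>p c\<bar> \<le> P) \<and>
      (\<forall>i<N. \<forall>c<n. integral {real i * (T / N)..real (Suc i) * (T / N)} (\<lambda>t. h t c)
                   = integral {real i * (T / N)..real (Suc i) * (T / N)} (\<lambda>t. h' t c)) \<longrightarrow>
      (\<forall>t\<in>{0..T}. \<forall>c<n. \<bar>flow m h p t c - flow m h' p t c\<bar> \<le> K * (T / N))"
proof -
  obtain B where B: "0 \<le> B" and le_B: "\<And>h p t c. \<lbrakk>tame_inputs n T C h; \<forall>c<n. \<bar>p c\<bar> \<le> P; t \<in> {0..T}; c < n\<rbrakk>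
      \<Longrightarrow> \<bar>flow m h p t c\<bar> \<le> B"
    using flow_bound[of T C n P m] T C by (metis less_imp_le)
  let ?Q = "\<lambda>k K. \<forall>N h h' p. 0 < N \<and> tame_inputs n T C h \<and> tame_inputs n T C h' \<and> (\<forall>c<n. \<bar>p c\<bar> \<le> P) \<and>
      (\<forall>i<N. \<forall>c<n. integral {real i * (T / N)..real (Suc i) * (T / N)} (\<lambda>t. h t c)
                   = integral {real i * (T / N)..real (Suc i) * (T / N)} (\<lambda>t. h' t c)) \<longrightarrow>
      (\<forall>t\<in>{0..T}. \<forall>c<k. \<bar>flow m h p t c - flow m h' p t c\<bar> \<le> K * (T / N))"
  have "\<exists>K\<ge>0. ?Q k K" if "k \<le> n" for k
    using that
  proof (induction k)
    case (Suc k)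
    then obtain K where K: "0 \<le> K" and QK: "?Q k K" by auto
    have kn: "k < n" using Suc.prems by simp
    obtain \<Lambda> where \<Lambda>: "0 \<le> \<Lambda>" and lip: "\<And>a b d. \<lbrakk>\<forall>j<k. \<bar>a j\<bar> \<le> B \<and> \<bar>b j\<bar> \<le> B \<and> \<bar>a j - b j\<bar> \<le> d; 0 \<le> d\<rbrakk>
      \<Longrightarrow> \<bar>(\<Prod>j<k. a j ^ m k j) - (\<Prod>j<k. b j ^ m k j)\<bar> \<le> \<Lambda> * d"
      using monomial_lipschitz[OF B, where c = k and e = "m k"] by blast
    define M where "M = (\<Sum>c<n. (\<Prod>j<c. B ^ m c j) * C)"
    have M: "(\<Prod>j<c. B ^ m c j) * C \<le> M" "0 \<le> (\<Prod>j<c. B ^ m c j) * C" if "c < n" for c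
    proof -
      have nn: "0 \<le> (\<Prod>j<c. B ^ m c j) * C" for c using B C by (auto intro!: mult_nonneg_nonneg prod_nonneg)
      then show "0 \<le> (\<Prod>j<c. B ^ m c j) * C" .
      show "(\<Prod>j<c. B ^ m c j) * C \<le> M"
        unfolding M_def using that nn by (intro member_le_sum) auto
    qed
    have M0: "0 \<le> M" using M[OF kn] by linarith
    define Bk where "Bk = (\<Prod>j<k. B ^ m k j)"
    have Bk: "0 \<le> Bk" unfolding Bk_def using B by (auto intro: prod_nonneg)
    define K' where "K' = \<Lambda> * K * C * T + (\<Lambda> * M * (2 * C) * T + Bk * (2 * C))"
    have K': "0 \<le> K'" unfolding K'_def using \<Lambda> K C T M0 Bk by simp
    have "\<bar>flow m h p t c - flow m h' p t c\<bar> \<le> max K K' * (T / N)"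
      if N: "0 < N" and h: "tame_inputs n T C h" "tame_inputs n T C h'" and p: "\<forall>c<n. \<bar>p c\<bar> \<le> P"
        and cells: "\<forall>i<N. \<forall>c<n. integral {real i * (T / N)..real (Suc i) * (T / N)} (\<lambda>t. h t c)
                   = integral {real i * (T / N)..real (Suc i) * (T / N)} (\<lambda>t. h' t c)"
        and t: "t \<in> {0..T}" and c: "c < Suc k" for N :: nat and h h' p t c
    proof -
      have IH: "\<bar>flow m h p s j - flow m h' p s j\<bar> \<le> K * (T / N)" if "s \<in> {0..T}" "j < k" for s j
        using QK N h p cells that by blast
      have TN: "0 < T / N" using T N by simp
      show ?thesis
      proof (cases "c = k")
        case False
        then have "\<bar>flow m h p t c - flow m h' p t c\<bar> \<le> K * (T / N)" using IH t c by auto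
        also have "\<dots> \<le> max K K' * (T / N)" using TN by (intro mult_right_mono) auto
        finally show ?thesis .
      next
        case [simp]: True
        let ?G = "\<lambda>s. \<Prod>j<k. flow m h p s j ^ m k j" and ?G' = "\<lambda>s. \<Prod>j<k. flow m h' p s j ^ m k j"
        have reg: "regular_input (\<lambda>t. h t c)" "regular_input (\<lambda>t. h' t c)" if "c < n" for c
          using h that by (auto simp: tame_inputs_def)
        have contf: "continuous_on {0..s} (\<lambda>t. flow m h p t j)" "continuous_on {0..s} (\<lambda>t. flow m h' p t
            j)" if "j < k" for j s
          using reg that kn by (auto intro!: flow_continuous[of n])
        have contG: "continuous_on {0..s} ?G" "continuous_on {0..s} ?G'" for s
          using contf by (auto intro!: continuous_on_prod continuous_on_power)
        have int: "(\<lambda>s. ?G s * h s k) integrable_on {0..t}" "(\<lambda>s. ?G' s * h s k) integrable_on {0..t}"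
             "(\<lambda>s. ?G' s * h' s k) integrable_on {0..t}"
          using contG reg kn by (auto intro!: regular_input_integrable)
        have "\<bar>integral {0..t} (\<lambda>s. ?G s * h s k - ?G' s * h s k)\<bar> \<le> \<Lambda> * (K * (T / N)) * C * (t - 0)"
        proof (rule abs_integral_le)
          fix s assume s: "s \<in> {0..t}"
          have "\<bar>?G s - ?G' s\<bar> \<le> \<Lambda> * (K * (T / N))"
          proof (intro lip allI impI conjI)
            fix j assume "j < k"
            then show "\<bar>flow m h p s j - flow m h' p s j\<bar> \<le> K * (T / N)"
              "\<bar>flow m h p s j\<bar> \<le> B" "\<bar>flow m h' p s j\<bar> \<le> B"
              using s t kn h p by (auto intro!: IH[unfolded times_divide_eq_right] le_B)
          qed (rule mult_nonneg_nonneg[OF K less_imp_le[OF TN]])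
          moreover have "\<bar>h s k\<bar> \<le> C" using h(1) s t kn by (auto simp: tame_inputs_def)
          ultimately have "\<bar>?G s - ?G' s\<bar> * \<bar>h s k\<bar> \<le> \<Lambda> * (K * (T / N)) * C"
            using \<Lambda> K TN by (intro mult_mono) auto
          then show "\<bar>?G s * h s k - ?G' s * h s k\<bar> \<le> \<Lambda> * (K * (T / N)) * C"
            by (simp add: abs_mult flip: left_diff_distrib)
        qed (use int t in \<open>auto intro: integrable_diff\<close>)
        also have "\<dots> \<le> \<Lambda> * (K * (T / N)) * C * T"
          using \<Lambda> K C TN t by (intro mult_left_mono) auto
        finally have 1: "\<bar>integral {0..t} (\<lambda>s. ?G s * h s k - ?G' s * h s k)\<bar> \<le> \<Lambda> * K * C * T * (T / N)"
          by (simp add: mult_ac)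
        have 2: "\<bar>integral {0..t} (\<lambda>s. ?G' s * (h s k - h' s k))\<bar>
            \<le> (\<Lambda> * M * (2 * C) * T + Bk * (2 * C)) * (T / N)"
        proof (rule integral_oscillating[where N = N])
          show "\<bar>?G' s\<bar> \<le> Bk" if "s \<in> {0..T}" for s
            unfolding Bk_def using that kn h p by (intro abs_monomial_le le_B) auto
          show "\<bar>?G' r - ?G' s\<bar> \<le> \<Lambda> * M * (r - s)" if "0 \<le> s" "s \<le> r" "r \<le> T" for s r
          proof -
            have "\<bar>flow m h' p r j - flow m h' p s j\<bar> \<le> M * (r - s)" if j: "j < k" for j
            proof -
              have "\<bar>flow m h' p r j - flow m h' p s j\<bar> \<le> (\<Prod>i<j. B ^ m j i) * C * (r - s)"
                using \<open>0 \<le> s\<close> \<open>s \<le> r\<close> \<open>r \<le> T\<close> j kn h p C by (intro flow_lipschitz[of n T] le_B) auto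
              also have "\<dots> \<le> M * (r - s)" using M[of j] j kn \<open>s \<le> r\<close> by (intro mult_right_mono) auto
              finally show ?thesis .
            qed
            then have "\<bar>?G' r - ?G' s\<bar> \<le> \<Lambda> * (M * (r - s))"
              using that kn M0 by (intro lip) (auto intro!: le_B h simp: p)
            then show ?thesis by (simp add: mult_ac)
          qed
          show "regular_input (\<lambda>s. h s k - h' s k)"
            using reg[OF kn] unfolding regular_input_def
            by (auto simp: bounded_minus_comp intro: rev_finite_subset[of "{t. \<not> isCont (\<lambda>t. h t k) t} \<union>
                {t. \<not> isCont (\<lambda>t. h' t k) t}"])
          show "\<bar>h s k - h' s k\<bar> \<le> 2 * C" if "s \<in> {0..T}" for s
            using h kn that unfolding tame_inputs_def by (smt (verit))
          show "integral {real i * (T / real N)..real (Suc i) * (T / real N)} (\<lambda>s. h s k - h' s k) = 0"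
              if "i < N" for i
            using cells kn that regular_input_integrable[of _ _ "\<lambda>_. 1" "\<lambda>t. h t k"]
              regular_input_integrable[of _ _ "\<lambda>_. 1" "\<lambda>t. h' t k"] reg[OF kn]
            by (subst integral_diff) auto
        qed (use contG TN T N t C \<Lambda> M0 Bk in auto)
        have "flow m h p t k - flow m h' p t k
            = integral {0..t} (\<lambda>s. ?G s * h s k) - integral {0..t} (\<lambda>s. ?G' s * h' s k)"
          using flow.simps[of m h p t k] flow.simps[of m h' p t k] by simp
        also have "\<dots> = integral {0..t} (\<lambda>s. ?G s * h s k - ?G' s * h s k) + integral {0..t} (\<lambda>s. ?G' s *
            (h s k - h' s k))"
          using int by (simp add: integral_diff right_diff_distrib)
        finally have "\<bar>flow m h p t k - flow m h' p t k\<bar> \<le> K' * (T / N)"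
          using 1 2 unfolding K'_def by (simp only: distrib_right)
        also have "\<dots> \<le> max K K' * (T / N)" using TN by (intro mult_right_mono) auto
        finally show ?thesis by simp
      qed
    qed
    then have "?Q (Suc k) (max K K')" by blast
    then show ?case using K by (intro exI[of _ "max K K'"]) auto
  qed (auto)
  then show ?thesis by blast
qed

section \<open>Systems with good and bad letters\<close>

type_synonym letter = "nat list"

text \<open>
  A triangular system whose inputs are labelled by letters, encoded as lists: a seed i is the letter
  [i], and eliminating a coordinate with exponent j turns l into j # l. Coordinate c receives the
  input \<open>\<kappa> c\<close> times the control of the letter \<open>L c\<close>. Good letters are free, the letter \<open>drift\<close>
  has control 1, and the other letters stay within \<open>\<rho>\<close> of the reference values e. The tolerance \<open>\<rho>\<close>
  on bad letters is what makes the products of one oscillating coordinate with several bad letters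
  independent; with constant bad letters they would be proportional.
\<close>

locale control_system =
  fixes m :: "nat \<Rightarrow> nat \<Rightarrow> nat" and L :: "nat \<Rightarrow> letter" and \<kappa> :: "nat \<Rightarrow> real"
    and good :: "letter set" and drift :: letter and e :: "letter \<Rightarrow> real" and \<rho> :: real
begin

definition control_values :: "real \<Rightarrow> (letter \<Rightarrow> real) set" where
  "control_values C = {v. v drift = 1 \<and> (\<forall>l. l \<notin> good \<longrightarrow> l \<noteq> drift \<longrightarrow> \<bar>v l - e l\<bar> \<le> \<rho>) \<and>
                          (\<forall>l\<in>good. \<bar>v l\<bar> \<le> C)}"

definition control :: "real \<Rightarrow> (real \<Rightarrow> letter \<Rightarrow> real) \<Rightarrow> bool" where
  "control C v \<longleftrightarrow> (\<forall>l. regular_input (\<lambda>t. v t l)) \<and> range v \<subseteq> control_values C"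

definition input :: "(real \<Rightarrow> letter \<Rightarrow> real) \<Rightarrow> real \<Rightarrow> nat \<Rightarrow> real" where
  "input v = (\<lambda>t c. \<kappa> c * v t (L c))"

definition steers :: "nat \<Rightarrow> real \<Rightarrow> real \<Rightarrow> (nat \<Rightarrow> real) \<Rightarrow> (nat \<Rightarrow> real) \<Rightarrow> bool" where
  "steers n C T p q \<longleftrightarrow> (\<exists>v. control C v \<and> (\<forall>c<n. flow m (input v) p T c = q c))"

text \<open>
  The bound C on the good controls is uniform over the unit box. Uniformity is needed when the
  steering of fewer coordinates is scaled down: its effect on one more coordinate must tend to 0.
\<close>

definition controllable :: "nat \<Rightarrow> bool" where
  "controllable n \<longleftrightarrow> (\<forall>T>0. \<exists>C. \<forall>p q. (\<forall>c<n. \<bar>p c\<bar> \<le> 1 \<and> \<bar>q c\<bar> \<le> 1) \<longrightarrow> steers n C T p q)"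

text \<open>
  The second clause says that the letter of b and its exponents are not an initial part of those of
  a later coordinate c. For b = 0 it says that no other coordinate shares the letter of the first one.
\<close>

definition parity_condition :: "nat \<Rightarrow> bool" where
  "parity_condition n \<longleftrightarrow>
     (\<forall>c<n. \<kappa> c \<noteq> 0 \<and> (L c \<in> good \<or> (\<exists>j<c. odd (m c j)))) \<and>
     (\<forall>b c. b < c \<and> c < n \<longrightarrow> \<not> (L c = L b \<and> (\<forall>j<b. m c j = m b j))) \<and>
     (\<forall>l\<in>good. e l = 0) \<and> drift \<notin> good \<and> e drift = 1 \<and> 0 < \<rho>"

lemma control_regular: "control C v \<Longrightarrow> regular_input (\<lambda>t. v t l)"
  by (simp add: control_def)

lemma control_append:
  assumes "control C v" "control C w"
  shows "control C (\<lambda>t. if t < a then v t else w (t - a))"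
proof -
  have "regular_input (\<lambda>t. (if t < a then v t else w (t - a)) l)" for l
    using regular_input_append[of "\<lambda>t. v t l" "\<lambda>t. w t l" a] assms
    by (simp add: control_def if_distribR)
  then show ?thesis
    using assms by (auto simp: control_def)
qed

lemma control_mono: "control C v \<Longrightarrow> C \<le> C' \<Longrightarrow> control C' v"
  unfolding control_def control_values_def by (blast intro: order_trans)

lemma control_abs_le:
  assumes "parity_condition n" "control C v" "0 \<le> C"
  shows "\<bar>v t l\<bar> \<le> \<bar>e l\<bar> + \<rho> + C"
proof -
  have v: "v t \<in> control_values C" using assms by (auto simp: control_def)
  consider "l \<in> good" | "l = drift" | "l \<notin> good" "l \<noteq> drift" by blast
  then show ?thesis
  proof cases
    case 3
    then have "\<bar>v t l - e l\<bar> \<le> \<rho>" using v by (simp add: control_values_def)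
    then show ?thesis using assms(3) by linarith
  qed (use v assms in \<open>auto simp: control_values_def parity_condition_def\<close>)
qed

definition input_bound :: "nat \<Rightarrow> real \<Rightarrow> real" where
  "input_bound n C = (\<Sum>c<n. \<bar>\<kappa> c\<bar> * (\<bar>e (L c)\<bar> + \<rho> + C))"

lemma input_tame:
  assumes "parity_condition n'" "control C v" "0 \<le> C"
  shows "tame_inputs n T (input_bound n C) (input v)" "0 \<le> input_bound n C"
proof -
  have \<rho>: "0 < \<rho>" using assms(1) by (simp add: parity_condition_def)
  have "\<bar>input v t c\<bar> \<le> input_bound n C" if "c < n" for t c
  proof -
    have "\<bar>input v t c\<bar> \<le> \<bar>\<kappa> c\<bar> * (\<bar>e (L c)\<bar> + \<rho> + C)"
      using control_abs_le[OF assms] by (simp add: input_def abs_mult mult_left_mono)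
    also have "\<dots> \<le> input_bound n C"
      unfolding input_bound_def using that \<rho> assms(3) by (intro member_le_sum) auto
    finally show ?thesis .
  qed
  then show "tame_inputs n T (input_bound n C) (input v)"
    using control_regular[OF assms(2)] by (simp add: tame_inputs_def input_def regular_input_cmult)
  show "0 \<le> input_bound n C"
    unfolding input_bound_def using \<rho> assms(3) by (intro sum_nonneg) auto
qed

lemma steers_mono: "steers n C T p q \<Longrightarrow> C \<le> C' \<Longrightarrow> steers n C' T p q"
  unfolding steers_def using control_mono by blast

lemma steers_cong:
  assumes "steers n C T p q" "0 \<le> T" "\<And>c. c < n \<Longrightarrow> p c = p' c" "\<And>c. c < n \<Longrightarrow> q c = q' c"
  shows "steers n C T p' q'"
proof -
  obtain v where "control C v" and v: "\<And>c. c < n \<Longrightarrow> flow m (input v) p T c = q c"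
    using assms(1) by (auto simp: steers_def)
  moreover have "flow m (input v) p' T c = q' c" if "c < n" for c
    using flow_cong[of n m m T "input v" "input v" p p' T c] assms that v by simp
  ultimately show ?thesis by (auto simp: steers_def)
qed

lemma steers_append:
  assumes "steers n C S p q" "steers n C T q r" "0 \<le> S" "0 \<le> T"
  shows "steers n C (S + T) p r"
proof -
  obtain v where v: "control C v" "\<And>c. c < n \<Longrightarrow> flow m (input v) p S c = q c"
    using assms(1) by (auto simp: steers_def)
  obtain w where w: "control C w" "\<And>c. c < n \<Longrightarrow> flow m (input w) q T c = r c"
    using assms(2) by (auto simp: steers_def)
  let ?u = "\<lambda>t. if t < S then v t else w (t - S)"
  have u: "input ?u = (\<lambda>t. if t < S then input v t else input w (t - S))"
    by (auto simp: input_def)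
  have "flow m (input ?u) p (S + T) c = r c" if "c < n" for c
  proof -
    have "flow m (input ?u) p (S + T) c = flow m (input w) (flow m (input v) p S) T c"
      unfolding u using v(1) w(1) assms(3,4) that
      by (intro flow_append[of n]) (simp_all add: input_def regular_input_cmult control_regular)
    also have "\<dots> = flow m (input w) q T c"
      using v(2) that assms(4) by (intro flow_cong[where T = T and n = n]) auto
    finally show ?thesis using w(2) that by simp
  qed
  then show ?thesis
    using control_append[OF v(1) w(1)] by (auto simp: steers_def)
qed

text \<open>
  The degree of a coordinate in the good letters.
\<close>

fun weight :: "nat \<Rightarrow> nat" where
  "weight c = (if L c \<in> good then 1 else 0) + (\<Sum>j<c. m c j * weight j)"

declare weight.simps [simp del]

text \<open>
  A coordinate with a bad letter has an odd, hence positive, exponent at some earlier coordinate.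
\<close>

lemma weight_pos:
  assumes "parity_condition n" "c < n"
  shows "0 < weight c"
  using assms(2)
proof (induction c rule: less_induct)
  case (less c)
  consider "L c \<in> good" | j where "j < c" "odd (m c j)"
    using assms(1) less.prems by (auto simp: parity_condition_def)
  then show ?case
  proof cases
    case 2
    then have "0 < m c j * weight j" using less by (auto intro: odd_pos)
    also have "\<dots> \<le> (\<Sum>j<c. m c j * weight j)" using 2 by (intro member_le_sum) auto
    finally show ?thesis by (subst weight.simps) simp
  qed (subst weight.simps, simp)
qed

lemma steers_scale:
  assumes "parity_condition n'" "steers n C T p q" "0 \<le> \<mu>" "0 \<le> T"
  shows "steers n (\<mu> * C) T (\<lambda>c. \<mu> ^ weight c * p c) (\<lambda>c. \<mu> ^ weight c * q c)"
proof -
  obtain v where v: "control C v" "\<And>c. c < n \<Longrightarrow> flow m (input v) p T c = q c"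
    using assms(2) by (auto simp: steers_def)
  let ?w = "\<lambda>t l. (if l \<in> good then \<mu> else 1) * v t l"
  have "control (\<mu> * C) ?w"
    using v(1) assms(1,3)
    by (auto simp: control_def control_values_def parity_condition_def abs_mult mult_left_mono
        image_subset_iff intro: regular_input_cmult)
  moreover have "flow m (input ?w) (\<lambda>c. \<mu> ^ weight c * p c) T c = \<mu> ^ weight c * q c" if "c < n" for c
  proof -
    have "input ?w = (\<lambda>t c. \<mu> ^ (if L c \<in> good then 1 else 0) * input v t c)"
      by (intro ext) (simp add: input_def)
    then show ?thesis
      using flow_scale[of n weight "\<lambda>c. if L c \<in> good then 1 else 0" m c T \<mu> "input v" p, OF weight.simps]
        that assms(4) v(2) by simp
  qed
  ultimately show ?thesis by (auto simp: steers_def)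
qed

text \<open>
  The last coordinate is not a factor of any coordinate, so a shift of its initial value is
  only carried along.
\<close>

lemma steers_translate:
  assumes "steers (Suc n) C T p q" "0 \<le> T"
  shows "steers (Suc n) C T (p(n := p n + d)) (q(n := q n + d))"
proof -
  obtain v where v: "control C v" "\<And>c. c < Suc n \<Longrightarrow> flow m (input v) p T c = q c"
    using assms(1) by (auto simp: steers_def)
  let ?p = "p(n := p n + d)"
  have below: "flow m (input v) ?p t c = flow m (input v) p t c" if "c < n" "0 \<le> t" for t c
    using that by (intro flow_cong[where n = n and T = t]) auto
  have "integral {0..T} (\<lambda>s. (\<Prod>j<n. flow m (input v) ?p s j ^ m n j) * input v s n)
      = integral {0..T} (\<lambda>s. (\<Prod>j<n. flow m (input v) p s j ^ m n j) * input v s n)"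
    using below by (intro Henstock_Kurzweil_Integration.integral_cong) simp
  then have "flow m (input v) ?p T n = q n + d"
    using v(2)[of n] flow.simps[of m "input v" ?p T n] flow.simps[of m "input v" p T n] by simp
  then have "flow m (input v) ?p T c = (q(n := q n + d)) c" if "c < Suc n" for c
    using below[of c T] v(2)[of c] that assms(2) by (auto simp: less_Suc_eq)
  then show ?thesis using v(1) by (auto simp: steers_def)
qed

text \<open>
  The displacement of the next coordinate does not depend on its initial value, which may therefore
  be taken to be 0; then \<open>flow_bound\<close> bounds it uniformly over the unit box.
\<close>

lemma steers_extend:
  assumes "parity_condition n'" "0 \<le> C" "0 \<le> T"
  shows "\<exists>K\<ge>0. \<forall>p q. (\<forall>c<n. \<bar>p c\<bar> \<le> 1) \<and> steers n C T p q \<longrightarrow>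
           (\<exists>z. \<bar>z - p n\<bar> \<le> K \<and> steers (Suc n) C T p (q(n := z)))"
proof -
  have "0 \<le> input_bound (Suc n) C"
    unfolding input_bound_def using assms by (intro sum_nonneg) (auto simp: parity_condition_def)
  then obtain K where K: "0 \<le> K" and le_K: "\<And>h p t c. \<lbrakk>tame_inputs (Suc n) T (input_bound (Suc n) C) h;
      \<forall>c<Suc n. \<bar>p c\<bar> \<le> 1; t \<in> {0..T}; c < Suc n\<rbrakk> \<Longrightarrow> \<bar>flow m h p t c\<bar> \<le> K"
    using flow_bound[OF assms(3), of "input_bound (Suc n) C" "Suc n" 1 m] by metis
  have "\<exists>z. \<bar>z - p n\<bar> \<le> K \<and> steers (Suc n) C T p (q(n := z))"
    if p: "\<forall>c<n. \<bar>p c\<bar> \<le> 1" and pq: "steers n C T p q" for p q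
  proof -
    obtain v where v: "control C v" "\<And>c. c < n \<Longrightarrow> flow m (input v) p T c = q c"
      using pq by (auto simp: steers_def)
    let ?z = "flow m (input v) (p(n := 0)) T n"
    have "\<bar>?z\<bar> \<le> K"
      using p assms(3) input_tame(1)[OF assms(1) v(1) assms(2)] by (intro le_K) (auto simp: less_Suc_eq)
    have "flow m (input v) (p(n := 0)) T c = (q(n := ?z)) c" if "c < Suc n" for c
      using flow_cong[of n m m T "input v" "input v" "p(n := 0)" p T c] v(2)[of c] that assms(3)
      by (auto simp: less_Suc_eq)
    then have "steers (Suc n) C T (p(n := 0)) (q(n := ?z))"
      using v(1) unfolding steers_def by blast
    from steers_translate[OF this assms(3), of "p n"]
    have "steers (Suc n) C T p (q(n := ?z + p n))" by simp
    with \<open>\<bar>?z\<bar> \<le> K\<close> show ?thesis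
      by (intro exI[of _ "?z + p n"]) simp
  qed
  with K show ?thesis by blast
qed

text \<open>
  A single coordinate has no factors, so its letter is good and a constant control does.
\<close>

lemma steers_one:
  assumes "parity_condition 1" "0 < T"
  shows "\<exists>C. \<forall>p q. \<bar>p 0\<bar> \<le> 1 \<and> \<bar>q 0\<bar> \<le> 1 \<longrightarrow> steers 1 C T p q"
proof -
  have sys: "\<kappa> 0 \<noteq> 0" "L 0 \<in> good" "drift \<notin> good" "e drift = 1" "0 < \<rho>"
    using assms(1) by (auto simp: parity_condition_def)
  have "steers 1 (2 / \<bar>\<kappa> 0 * T\<bar>) T p q" if pq: "\<bar>p 0\<bar> \<le> 1" "\<bar>q 0\<bar> \<le> 1" for p q
  proof -
    let ?a = "(q 0 - p 0) / (\<kappa> 0 * T)"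
    let ?v = "\<lambda>(t::real) l. if l \<in> good then ?a else e l"
    have "\<bar>?a\<bar> \<le> 2 / \<bar>\<kappa> 0 * T\<bar>"
      using pq unfolding abs_divide by (intro divide_right_mono) auto
    then have "control (2 / \<bar>\<kappa> 0 * T\<bar>) ?v"
      using sys by (auto simp: control_def control_values_def regular_input_const)
    moreover have "flow m (input ?v) p T 0 = q 0"
      using sys assms(2) by (subst flow.simps) (simp add: input_def)
    ultimately show ?thesis by (auto simp: steers_def)
  qed
  then show ?thesis by blast
qed

text \<open>
  Scaling brings arbitrary end points into the unit box.
\<close>

lemma steers_global:
  assumes sys: "parity_condition n" and "controllable n" "0 < T"
  shows "\<exists>C. steers n C T p q"
proof -
  obtain C where C: "\<And>p q. \<forall>c<n. \<bar>p c\<bar> \<le> 1 \<and> \<bar>q c\<bar> \<le> 1 \<Longrightarrow> steers n C T p q"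
    using assms(2,3) unfolding controllable_def by blast
  \<comment> \<open>at least 1, so that every power with a positive exponent dominates the entries of p and q\<close>
  define \<mu> where "\<mu> = 1 + (\<Sum>c<n. \<bar>p c\<bar> + \<bar>q c\<bar>)"
  have \<mu>: "1 \<le> \<mu>" by (simp add: \<mu>_def sum_nonneg)
  have le: "\<bar>p c\<bar> \<le> \<mu> ^ weight c" "\<bar>q c\<bar> \<le> \<mu> ^ weight c" if "c < n" for c
  proof -
    have "\<bar>p c\<bar> + \<bar>q c\<bar> \<le> (\<Sum>c<n. \<bar>p c\<bar> + \<bar>q c\<bar>)"
      using that by (intro member_le_sum[of c "{..<n}" "\<lambda>c. \<bar>p c\<bar> + \<bar>q c\<bar>"]) auto
    moreover have "\<mu> ^ 1 \<le> \<mu> ^ weight c"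
      using \<mu> weight_pos[OF sys that] by (intro power_increasing) auto
    ultimately show "\<bar>p c\<bar> \<le> \<mu> ^ weight c" "\<bar>q c\<bar> \<le> \<mu> ^ weight c" by (auto simp: \<mu>_def)
  qed
  have "steers n C T (\<lambda>c. p c / \<mu> ^ weight c) (\<lambda>c. q c / \<mu> ^ weight c)"
    using le \<mu> by (intro C) (auto simp: abs_divide divide_le_eq)
  from steers_scale[OF sys this, of \<mu>] \<mu> assms(3)
  have "steers n (\<mu> * C) T (\<lambda>c. \<mu> ^ weight c * (p c / \<mu> ^ weight c)) (\<lambda>c. \<mu> ^ weight c * (q c / \<mu> ^
      weight c))"
    by simp
  then have "steers n (\<mu> * C) T p q"
    by (rule steers_cong) (use \<mu> assms(3) in auto)
  then show ?thesis by blast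
qed

section \<open>Adding the last coordinate\<close>

text \<open>
  The hypothesis on approximate motions gives the two directions in which the last coordinate can
  be pushed; controllability of the first n coordinates makes the motions into exact loops. Loops
  of both signs scale to loops with any prescribed effect, and a general motion is a return to 0
  of the first n coordinates, a loop that corrects the last coordinate, and a departure from 0.
\<close>

lemma controllable_Suc:
  assumes sys: "parity_condition (Suc n)" and IH: "controllable n"
    and approx: "\<And>T. 0 < T \<Longrightarrow> \<exists>\<delta>>0. \<forall>\<sigma>\<in>{1, -1}. \<forall>\<epsilon>>0. \<exists>C q.
        steers (Suc n) C T (\<lambda>_. 0) q \<and> (\<forall>c<n. \<bar>q c\<bar> \<le> \<epsilon>) \<and> \<bar>q n - \<sigma> * \<delta>\<bar> \<le> \<epsilon>"
  shows "controllable (Suc n)"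
proof -
  have IH': "\<exists>C\<ge>0. \<forall>p q. (\<forall>c<n. \<bar>p c\<bar> \<le> 1 \<and> \<bar>q c\<bar> \<le> 1) \<longrightarrow> steers n C T p q" if T: "0 < T" for T
  proof -
    obtain C where "\<forall>p q. (\<forall>c<n. \<bar>p c\<bar> \<le> 1 \<and> \<bar>q c\<bar> \<le> 1) \<longrightarrow> steers n C T p q"
      using IH T unfolding controllable_def by blast
    then show ?thesis
      using steers_mono[of n C T _ _ "max C 0"] by (intro exI[of _ "max C 0"]) auto
  qed
  define last_coord where "last_coord = (\<lambda>a::real. (\<lambda>c. if c = n then a else 0))"
  have loop: "\<exists>C a. 0 < \<sigma> * a \<and> steers (Suc n) C T (last_coord 0) (last_coord a)" if T: "0 < T"
      and \<sigma>: "\<sigma> \<in> {1, -1}" for T \<sigma> :: real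
  proof -
    have T2: "0 < T / 2" using T by simp
    obtain \<delta> where \<delta>: "0 < \<delta>" and near: "\<And>\<epsilon>. 0 < \<epsilon> \<Longrightarrow> \<exists>C q. steers (Suc n) C (T / 2) (\<lambda>_. 0) q \<and>
        (\<forall>c<n. \<bar>q c\<bar> \<le> \<epsilon>) \<and> \<bar>q n - \<sigma> * \<delta>\<bar> \<le> \<epsilon>"
      using approx[OF T2] \<sigma> by blast
    obtain C1 where C1: "0 \<le> C1" and return: "\<And>p q. \<forall>c<n. \<bar>p c\<bar> \<le> 1 \<and> \<bar>q c\<bar> \<le> 1 \<Longrightarrow> steers n C1 (T / 2) p q"
      using IH'[OF T2] by blast
    obtain K where K: "0 \<le> K" and ext: "\<And>p q. \<lbrakk>\<forall>c<n. \<bar>p c\<bar> \<le> 1; steers n C1 (T / 2) p q\<rbrakk> \<Longrightarrow>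
           \<exists>z. \<bar>z - p n\<bar> \<le> K \<and> steers (Suc n) C1 (T / 2) p (q(n := z))"
      using steers_extend[OF sys C1 less_imp_le[OF T2], of n] by blast
    \<comment> \<open>scale of the return to 0: it moves the last coordinate by at most \<open>\<mu> * K \<le> \<delta> / 4\<close>\<close>
    define \<mu> where "\<mu> = min 1 (\<delta> / (4 * (K + 1)))"
    have \<mu>: "0 < \<mu>" "\<mu> \<le> 1" "K * \<mu> \<le> \<delta> / 4"
    proof -
      show "0 < \<mu>" "\<mu> \<le> 1" using \<delta> K by (auto simp: \<mu>_def)
      have "K * \<mu> \<le> (K + 1) * (\<delta> / (4 * (K + 1)))"
        using K \<delta> by (intro mult_mono) (auto simp: \<mu>_def)
      also have "\<dots> = \<delta> / 4" using K by (simp add: divide_simps)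
      finally show "K * \<mu> \<le> \<delta> / 4" .
    qed
    \<comment> \<open>so small that the end point of the approximate motion is a point of the unit box, scaled by \<open>\<mu>\<close>\<close>
    define \<epsilon> where "\<epsilon> = min (\<delta> / 4) (\<mu> ^ (\<Sum>c<n. weight c))"
    have \<epsilon>: "0 < \<epsilon>" using \<delta> \<mu> by (simp add: \<epsilon>_def)
    have \<epsilon>_le: "\<epsilon> \<le> \<mu> ^ weight c" if "c < n" for c
    proof -
      have "weight c \<le> (\<Sum>c<n. weight c)" using that by (intro member_le_sum) auto
      then have "\<mu> ^ (\<Sum>c<n. weight c) \<le> \<mu> ^ weight c"
        using \<mu> by (intro power_decreasing) auto
      then show ?thesis by (simp add: \<epsilon>_def)
    qed
    obtain C2 y where y: "steers (Suc n) C2 (T / 2) (\<lambda>_. 0) y" "\<forall>c<n. \<bar>y c\<bar> \<le> \<epsilon>" "\<bar>y n - \<sigma> * \<delta>\<bar> \<le> \<epsilon>"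
      using near[OF \<epsilon>] by blast
    define y' where "y' = (\<lambda>c. if c < n then y c / \<mu> ^ weight c else 0)"
    have y': "\<bar>y' c\<bar> \<le> 1" for c
    proof (cases "c < n")
      case True
      then have "\<bar>y c\<bar> \<le> \<mu> ^ weight c" using \<epsilon>_le[of c] y(2) by fastforce
      then show ?thesis using True \<mu> by (simp add: y'_def)
    qed (simp add: y'_def)
    obtain z where z: "\<bar>z\<bar> \<le> K" "steers (Suc n) C1 (T / 2) y' (last_coord z)"
    proof -
      have "steers n C1 (T / 2) y' (last_coord 0)" using y' by (intro return) (auto simp: last_coord_def)
      from ext[OF _ this] y' obtain z where "\<bar>z - y' n\<bar>
          \<le> K" "steers (Suc n) C1 (T / 2) y' ((last_coord 0)(n := z))"
        by blast
      moreover have "(last_coord 0)(n := z) = last_coord z" by (auto simp: last_coord_def)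
      ultimately show ?thesis by (intro that[of z]) (auto simp: y'_def)
    qed
    let ?C = "max (\<mu> * C1) C2" and ?a = "y n + \<mu> ^ weight n * z"
    have "steers (Suc n) (\<mu> * C1) (T / 2) (\<lambda>c. \<mu> ^ weight c * y' c) (\<lambda>c. \<mu> ^ weight c * last_coord z c)"
      using sys \<mu> T z(2) by (intro steers_scale) auto
    from steers_translate[OF this less_imp_le[OF T2], of "y n"]
    have "steers (Suc n) (\<mu> * C1) (T / 2) y (last_coord ?a)"
      by (rule steers_cong) (use \<mu> T in \<open>auto simp: y'_def last_coord_def\<close>)
    from steers_append[OF steers_mono[OF y(1), of ?C] steers_mono[OF this, of ?C]]
    have "steers (Suc n) ?C (T / 2 + T / 2) (\<lambda>_. 0) (last_coord ?a)"
      using T by simp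
    then have "steers (Suc n) ?C T (last_coord 0) (last_coord ?a)" by (simp add: last_coord_def)
    moreover have "0 < \<sigma> * ?a"
    proof -
      have "\<mu> ^ weight n \<le> \<mu> ^ 1"
        using \<mu> weight_pos[OF sys, of n] by (intro power_decreasing) auto
      then have "\<bar>\<mu> ^ weight n * z\<bar> \<le> \<mu> * K"
        unfolding abs_mult using z \<mu> by (intro mult_mono) auto
      then have "\<bar>\<mu> ^ weight n * z\<bar> \<le> \<delta> / 4"
        using \<mu>(3) by (simp add: mult.commute)
      moreover have "\<bar>y n - \<sigma> * \<delta>\<bar> \<le> \<delta> / 4"
        using y(3) by (simp add: \<epsilon>_def)
      ultimately have "\<bar>?a - \<sigma> * \<delta>\<bar> \<le> \<delta> / 2"
        by linarith
      then show ?thesis using \<sigma> \<delta> unfolding abs_le_iff by auto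
    qed
    ultimately show ?thesis by blast
  qed
  have shift: "\<exists>C. \<forall>d. \<bar>d\<bar> \<le> D \<longrightarrow> steers (Suc n) C T (last_coord 0) (last_coord d)" if T: "0 < T"
      and D: "0 < D" for T D
  proof -
    have scaled: "\<exists>C. \<forall>d. \<bar>d\<bar> \<le> D \<and> 0 \<le> \<sigma> * d \<longrightarrow> steers (Suc n) C T (last_coord 0) (last_coord d)"
        if \<sigma>: "\<sigma> \<in> {1, -1}" for \<sigma>
    proof -
      obtain C a where a: "0 < \<sigma> * a" and C: "steers (Suc n) C T (last_coord 0) (last_coord a)"
        using loop[OF T \<sigma>] by blast
      let ?C = "max C 0" and ?r = "root (weight n)"
      have w: "0 < weight n" using weight_pos[OF sys] by simp
      have "steers (Suc n) (?r (D / \<bar>a\<bar>) * ?C) T (last_coord 0) (last_coord d)"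
          if d: "\<bar>d\<bar> \<le> D" "0 \<le> \<sigma> * d" for d
      proof -
        have da: "0 \<le> d / a" "\<bar>d / a\<bar> = d / a" "a \<noteq> 0"
          using \<sigma> d a by (auto simp: zero_le_divide_iff)
        have "steers (Suc n) (?r (d / a) * ?C) T (\<lambda>c. ?r (d / a) ^ weight c * last_coord 0 c) (\<lambda>c. ?r (d
            / a) ^ weight c * last_coord a c)"
          using sys C T da by (intro steers_scale) (auto intro: steers_mono real_root_ge_zero)
        then have "steers (Suc n) (?r (d / a) * ?C) T (last_coord 0) (last_coord d)"
          by (rule steers_cong) (use T w da in \<open>auto simp: last_coord_def real_root_pow_pos2\<close>)
        moreover have "?r (d / a) * ?C \<le> ?r (D / \<bar>a\<bar>) * ?C"
        proof -
          have "d / a \<le> D / \<bar>a\<bar>"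
            using d(1) da by (metis abs_divide divide_right_mono abs_ge_zero)
          then show ?thesis using w by (intro mult_right_mono) auto
        qed
        ultimately show ?thesis by (rule steers_mono)
      qed
      then show ?thesis by blast
    qed
    have "\<exists>C. \<forall>d. \<bar>d\<bar> \<le> D \<and> 0 \<le> d \<longrightarrow> steers (Suc n) C T (last_coord 0) (last_coord d)"
      using scaled[of 1] by simp
    then obtain C where C: "\<And>d. \<bar>d\<bar> \<le> D \<Longrightarrow> 0 \<le> d \<Longrightarrow> steers (Suc n) C T (last_coord 0) (last_coord d)"
      by blast
    have "\<exists>C. \<forall>d. \<bar>d\<bar> \<le> D \<and> d \<le> 0 \<longrightarrow> steers (Suc n) C T (last_coord 0) (last_coord d)"
      using scaled[of "-1"] by simp
    then obtain C' where C': "\<And>d. \<bar>d\<bar> \<le> D \<Longrightarrow> d \<le> 0 \<Longrightarrow> steers (Suc n) C' T (last_coord 0) (last_coord d)"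
      by blast
    have "steers (Suc n) (max C C') T (last_coord 0) (last_coord d)" if d: "\<bar>d\<bar> \<le> D" for d
    proof (cases "0 \<le> d")
      case True
      then show ?thesis by (intro steers_mono[OF C[OF d]]) auto
    next
      case False
      then show ?thesis by (intro steers_mono[OF C'[OF d]]) auto
    qed
    then show ?thesis by blast
  qed
  have "\<exists>C. \<forall>p q. (\<forall>c<Suc n. \<bar>p c\<bar> \<le> 1 \<and> \<bar>q c\<bar> \<le> 1) \<longrightarrow> steers (Suc n) C T p q" if T: "0 < T" for T
  proof -
    have T3: "0 < T / 3" using T by simp
    obtain C1 where C1: "0 \<le> C1" and move: "\<And>p q. \<forall>c<n. \<bar>p c\<bar> \<le> 1 \<and> \<bar>q c\<bar> \<le> 1 \<Longrightarrow> steers n C1 (T / 3) p q"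
      using IH'[OF T3] by blast
    obtain K where K: "0 \<le> K" and ext: "\<And>p q. \<lbrakk>\<forall>c<n. \<bar>p c\<bar> \<le> 1; steers n C1 (T / 3) p q\<rbrakk> \<Longrightarrow>
           \<exists>z. \<bar>z - p n\<bar> \<le> K \<and> steers (Suc n) C1 (T / 3) p (q(n := z))"
      using steers_extend[OF sys C1 less_imp_le[OF T3], of n] by blast
    obtain C2 where C2: "\<And>d. \<bar>d\<bar> \<le> 2 + 2 * K \<Longrightarrow> steers (Suc n) C2 (T / 3) (last_coord 0) (last_coord d)"
      using shift[OF T3, of "2 + 2 * K"] K by auto
    have "steers (Suc n) (max C1 C2) T p q" if pq: "\<forall>c<Suc n. \<bar>p c\<bar> \<le> 1 \<and> \<bar>q c\<bar> \<le> 1" for p q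
    proof -
      have "steers n C1 (T / 3) p (last_coord 0)" using pq by (intro move) (auto simp: last_coord_def)
      from ext[OF _ this] pq obtain z1 where z1: "\<bar>z1 - p n\<bar>
          \<le> K" "steers (Suc n) C1 (T / 3) p ((last_coord 0)(n := z1))"
        by auto
      have "steers n C1 (T / 3) (last_coord 0) q" using pq by (intro move) (auto simp: last_coord_def)
      from ext[OF _ this] obtain z2 where z2: "\<bar>z2\<bar>
          \<le> K" "steers (Suc n) C1 (T / 3) (last_coord 0) (q(n := z2))"
        by (auto simp: last_coord_def)
      have "steers (Suc n) C2 (T / 3) (last_coord 0) (last_coord (q n - z2 - z1))"
        using z1(1) z2(1) pq by (intro C2) (smt (verit, best) lessI)
      from steers_translate[OF this, of z1]
      have 2: "steers (Suc n) C2 (T / 3) ((last_coord 0)(n := z1)) (last_coord (q n - z2))"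
        by (rule steers_cong) (use T in \<open>auto simp: last_coord_def\<close>)
      from steers_translate[OF z2(2), of "q n - z2"]
      have 3: "steers (Suc n) C1 (T / 3) (last_coord (q n - z2)) q"
        by (rule steers_cong) (use T in \<open>auto simp: last_coord_def\<close>)
      have "steers (Suc n) (max C1 C2) (T / 3 + T / 3 + T / 3) p q"
        using T by (intro steers_append[OF steers_append[OF steers_mono[OF z1(2)] steers_mono[OF 2]]
            steers_mono[OF 3]]) auto
      then show ?thesis by simp
    qed
    then show ?thesis by blast
  qed
  then show ?thesis by (auto simp: controllable_def)
qed

end

section \<open>Moments\<close>

text \<open>
  The columns of \<open>\<beta>\<close> are the coefficients of the Lagrange basis: interpolating the monomial of degree
  j at the nodes reproduces it, and \<open>\<beta> k i\<close> is the coefficient of degree i of the k-th Lagrange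
  polynomial.
\<close>

lemma moments_dual_basis:
  fixes x :: "nat \<Rightarrow> real"
  assumes inj: "inj_on x {..<R}"
  shows "\<exists>\<beta>. \<forall>i<R. \<forall>j<R. (\<Sum>k<R. \<beta> k i * x k ^ j) = (if j = i then 1 else 0)"
proof -
  \<comment> \<open>the Lagrange basis polynomials of the nodes x\<close>
  define Lag where "Lag = (\<lambda>k. \<Prod>i\<in>{..<R} - {k}. smult (1 / (x k - x i)) [:- x i, 1:])"
  have at_node: "poly (Lag k) (x i) = (if i = k then 1 else 0)" if "k < R" "i < R" for k i
  proof (cases "i = k")
    case True
    have "poly (smult (1 / (x k - x j)) [:- x j, 1:]) (x k) = 1" if "j \<in> {..<R} - {k}" for j
    proof -
      have "x k \<noteq> x j" using inj \<open>k < R\<close> that by (auto simp: inj_on_def)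
      then show ?thesis by (simp flip: diff_divide_distrib)
    qed
    then have "poly (Lag k) (x k) = 1"
      unfolding Lag_def poly_prod by (rule prod.neutral[OF ballI])
    then show ?thesis using True by simp
  next
    case False
    then have "\<exists>j\<in>{..<R} - {k}. poly (smult (1 / (x k - x j)) [:- x j, 1:]) (x i) = 0"
      using that by (intro bexI[of _ i]) auto
    then show ?thesis using False by (simp add: Lag_def poly_prod prod_zero_iff)
  qed
  have deg: "degree (Lag k) < R" if "k < R" for k
  proof -
    have "degree (Lag k) \<le> (\<Sum>i\<in>{..<R} - {k}. degree (smult (1 / (x k - x i)) [:- x i, 1:]))"
      unfolding Lag_def using degree_prod_sum_le[of "{..<R} - {k}" "\<lambda>i. smult (1 / (x k - x i)) [:- x i,
          1:]"] by (simp add: o_def)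
    also have "\<dots> \<le> (\<Sum>i\<in>{..<R} - {k}. 1)"
      by (intro sum_mono) (simp add: degree_smult_le order_trans[OF degree_smult_le])
    also have "\<dots> < R" using that by simp
    finally show ?thesis .
  qed
  have "(\<Sum>k<R. smult (x k ^ j) (Lag k)) = monom 1 j" if j: "j < R" for j
  proof (rule poly_eqI_degree[of "x ` {..<R}"])
    fix y assume "y \<in> x ` {..<R}"
    then obtain i where i: "i < R" "y = x i" by auto
    have "poly (\<Sum>k<R. smult (x k ^ j) (Lag k)) y = (\<Sum>k<R. if k = i then x k ^ j else 0)"
      unfolding poly_sum using i at_node by (intro sum.cong) auto
    then show "poly (\<Sum>k<R. smult (x k ^ j) (Lag k)) y = poly (monom 1 j) y"
      using i by (simp add: poly_monom)
  next
    have card: "card (x ` {..<R}) = R" using inj by (simp add: card_image)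
    show "degree (\<Sum>k<R. smult (x k ^ j) (Lag k)) < card (x ` {..<R})"
      unfolding card using j deg le_less_trans[OF degree_smult_le]
      by (intro degree_sum_less) auto
    show "degree (monom (1::real) j) < card (x ` {..<R})"
      unfolding card using j by (simp add: degree_monom_eq)
  qed
  then have "(\<Sum>k<R. x k ^ j * coeff (Lag k) i) = (if j = i then 1 else 0)" if "j < R" for i j
    using that by (metis (no_types, lifting) coeff_monom coeff_smult coeff_sum sum.cong)
  then show ?thesis
    by (intro exI[of _ "\<lambda>k i. coeff (Lag k) i"]) (simp add: mult.commute)
qed

lemma sum_odd_power_centered:
  assumes "odd j"
  shows "(\<Sum>k<2 * J + 1. (real k - real J) ^ j) = 0"
proof -
  have "(\<Sum>k<2 * J + 1. (real k - real J) ^ j) = (\<Sum>k<2 * J + 1. (real (2 * J + 1 - Suc k) - real J) ^ j)"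
    by (rule sum.nat_diff_reindex[symmetric])
  also have "\<dots> = (\<Sum>k<2 * J + 1. - ((real k - real J) ^ j))"
  proof (rule sum.cong)
    fix k assume "k \<in> {..<2 * J + 1}"
    then have "real (2 * J + 1 - Suc k) - real J = - (real k - real J)" by (simp add: of_nat_diff)
    then show "(real (2 * J + 1 - Suc k) - real J) ^ j = - ((real k - real J) ^ j)"
      by (simp only: power_minus_odd[OF assms])
  qed simp
  finally show ?thesis by (simp add: sum_negf)
qed

text \<open>
  Moments of the profile t (1 - t), which vanishes at both ends of the unit interval.
\<close>

definition bump_moment :: "nat \<Rightarrow> real" where
  "bump_moment j = integral {0..1} (\<lambda>t. (t * (1 - t)) ^ j)"

lemma bump_moment_0 [simp]: "bump_moment 0 = 1"
  by (simp add: bump_moment_def)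

lemma bump_moment_pos: "0 < bump_moment j"
proof -
  let ?f = "\<lambda>t::real. (t * (1 - t)) ^ j"
  have int: "?f integrable_on {a..b}" for a b
    by (intro integrable_continuous_real continuous_intros)
  have "(3 / 16) ^ j * (3 / 4 - 1 / 4) \<le> integral {1/4..3/4} ?f"
  proof -
    have "(3 / 16) ^ j \<le> ?f t" if "t \<in> {1/4..3/4}" for t
    proof (rule power_mono)
      have "0 \<le> (t - 1/4) * (3/4 - t)" using that by (intro mult_nonneg_nonneg) auto
      moreover have "(t - 1/4) * (3/4 - t) = t * (1 - t) - 3 / 16" by (simp add: field_simps)
      ultimately show "3 / 16 \<le> t * (1 - t)" by linarith
    qed simp
    then have "integral {1/4..3/4} (\<lambda>t::real. (3 / 16) ^ j) \<le> integral {1/4..3/4} ?f"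
      by (intro integral_le int) auto
    then show ?thesis by simp
  qed
  also have "\<dots> \<le> bump_moment j"
    unfolding bump_moment_def by (intro integral_subset_le int) auto
  finally show ?thesis by (rule less_le_trans[rotated]) simp
qed

lemma integral_bump_power:
  assumes "0 < \<tau>"
  shows "integral {0..\<tau>} (\<lambda>t. (S * (t / \<tau> * (1 - t / \<tau>))) ^ j) = \<tau> * S ^ j * bump_moment j"
proof -
  let ?f = "\<lambda>t::real. (S * (t * (1 - t))) ^ j"
  have "(?f has_integral integral {0..1} ?f) {0..1}"
    by (intro integrable_integral integrable_continuous_real continuous_intros)
  from has_integral_stretch_real[of ?f "integral {0..1} ?f" 0 1 "1 / \<tau>"] this assms
  have "((\<lambda>t. ?f (t / \<tau>)) has_integral \<tau> * integral {0..1} ?f) {0..\<tau>}"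
    by (simp add: image_mult_atLeastAtMost_if mult.commute[of _ \<tau>])
  then have "integral {0..\<tau>} (\<lambda>t. ?f (t / \<tau>)) = \<tau> * integral {0..1} ?f"
    by (rule integral_unique)
  then show ?thesis by (simp add: bump_moment_def power_mult_distrib)
qed

lemma integral_bump_velocity:
  fixes S \<tau> t :: real
  assumes "0 < \<tau>" "0 \<le> t"
  shows "integral {0..t} (\<lambda>s. S / \<tau> * (1 - 2 * s / \<tau>)) = S * (t / \<tau> * (1 - t / \<tau>))"
proof -
  have "((\<lambda>s. S / \<tau> * (1 - 2 * s / \<tau>)) has_integral
      S * (t / \<tau> * (1 - t / \<tau>)) - S * (0 / \<tau> * (1 - 0 / \<tau>))) {0..t}"
    by (rule fundamental_theorem_of_calculus)
       (use assms in \<open>auto intro!: derivative_eq_intros simp: field_simps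
          simp flip: has_real_derivative_iff_has_vector_derivative\<close>)
  moreover have "S * (0 / \<tau> * (1 - 0 / \<tau>)) = 0" by simp
  ultimately show ?thesis by (metis integral_unique diff_zero)
qed

section \<open>Excursions of the first coordinate\<close>

context control_system begin

text \<open>
  The first coordinate, started at 0. It has no factors, so it only depends on the letter \<open>L 0\<close>.
\<close>

definition first_path :: "(real \<Rightarrow> letter \<Rightarrow> real) \<Rightarrow> real \<Rightarrow> real" where
  "first_path v t = integral {0..t} (\<lambda>s. \<kappa> 0 * v s (L 0))"

lemma first_path_eq: "flow m (input v) (\<lambda>_. 0) t 0 = first_path v t"
  by (subst flow.simps) (simp add: first_path_def input_def)

lemma first_path_continuous:
  assumes "control C v"
  shows "continuous_on {a..b} (first_path v)"
proof -
  have "regular_input (\<lambda>t. \<kappa> 0 * v t (L 0))"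
    using assms by (intro regular_input_cmult control_regular)
  then have int: "(\<lambda>t. \<kappa> 0 * v t (L 0)) integrable_on {c..d}" for c d
    using regular_input_integrable[of c d "\<lambda>_. 1"] by simp
  have "continuous_on ({..0} \<union> {0..max 0 b}) (first_path v)"
  proof (rule continuous_on_closed_Un)
    show "continuous_on {..0} (first_path v)"
      by (rule continuous_on_eq[of _ "\<lambda>_. 0"]) (auto simp: first_path_def le_less)
    show "continuous_on {0..max 0 b} (first_path v)"
      unfolding first_path_def by (intro indefinite_integral_continuous_1 int)
  qed auto
  then show ?thesis
    by (rule continuous_on_subset) auto
qed

text \<open>
  A control on [0, T] that leads the first coordinate from 0 back to 0 within [-S, S], keeps every
  other letter near its reference value, and produces the integrals I of the inputs of the
  eliminated system. The control of \<open>L 0\<close> is bounded, but the bound is left open: it grows when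
  the excursion is compressed in time, and the other coordinates do not feel it, as they have other
  letters.
\<close>

definition excursion :: "real \<Rightarrow> real \<Rightarrow> (real \<Rightarrow> letter \<Rightarrow> real) \<Rightarrow> (nat \<Rightarrow> letter \<Rightarrow> real) \<Rightarrow> bool" where
  "excursion S T v I \<longleftrightarrow> (\<exists>C. control C v) \<and> (\<forall>t l. l \<noteq> L 0 \<longrightarrow> \<bar>v t l - e l\<bar> \<le> \<rho>) \<and>
     (\<forall>t\<in>{0..T}. \<bar>first_path v t\<bar> \<le> S) \<and> first_path v T = 0 \<and>
     (\<forall>j l. l \<noteq> L 0 \<longrightarrow> integral {0..T} (\<lambda>t. first_path v t ^ j * v t l) = I j l)"

lemma first_path_append:
  assumes "control C v" "control C w" "first_path v a = 0" "0 \<le> a" "0 \<le> t"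
  shows "first_path (\<lambda>t. if t < a then v t else w (t - a)) (a + t) = first_path w t"
proof -
  let ?u = "\<lambda>t. if t < a then v t else w (t - a)"
  have "input ?u = (\<lambda>t. if t < a then input v t else input w (t - a))"
    by (auto simp: input_def)
  then have "first_path ?u (a + t) = flow m (input w) (flow m (input v) (\<lambda>_. 0) a) t 0"
    using flow_append[of 1 "input v" "input w" a t 0 m "\<lambda>_. 0"] assms
    by (simp add: first_path_eq[symmetric] input_def regular_input_cmult control_regular)
  also have "\<dots> = flow m (input w) (\<lambda>_. 0) t 0"
    using assms by (intro flow_cong[of 1 _ _ t]) (auto simp: first_path_eq)
  finally show ?thesis by (simp add: first_path_eq)
qed

lemma first_path_append_before:
  assumes "t \<in> {0..a}"
  shows "first_path (\<lambda>t. if t < a then v t else w (t - a)) t = first_path v t"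
proof -
  let ?u = "\<lambda>t. if t < a then v t else w (t - a)"
  have "input ?u = (\<lambda>t. if t < a then input v t else input w (t - a))"
    by (auto simp: input_def)
  then show ?thesis
    using flow_append_before[of t a 0 1 m "input v" "input w" "\<lambda>_. 0"] assms
    by (simp add: first_path_eq[symmetric])
qed

lemma integral_append_before:
  assumes "0 \<le> b" "c \<le> a"
  shows "integral {b..c} (\<lambda>t. first_path (\<lambda>t. if t < a then v t else w (t - a)) t ^ j
            * (if t < a then v t else w (t - a)) l)
      = integral {b..c} (\<lambda>t. first_path v t ^ j * v t l)"
  by (rule integral_spike[of "{a}"]) (use assms in \<open>auto simp: first_path_append_before\<close>)

lemma integral_append_after:
  assumes "control C v" "control C w" "first_path v a = 0" "0 \<le> a" "0 \<le> t"
  shows "integral {a..a + t} (\<lambda>t. first_path (\<lambda>t. if t < a then v t else w (t - a)) t ^ j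
            * (if t < a then v t else w (t - a)) l)
      = integral {0..t} (\<lambda>t. first_path w t ^ j * w t l)"
  unfolding integral_shift_right
  by (intro Henstock_Kurzweil_Integration.integral_cong) (simp add: first_path_append[OF assms(1-4)])

lemma excursion_append:
  assumes "excursion S T v I" "excursion S U w K" "0 \<le> T" "0 \<le> U"
  shows "excursion S (T + U) (\<lambda>t. if t < T then v t else w (t - T)) (\<lambda>j l. I j l + K j l)" (is
      "excursion S _ ?u _")
proof -
  obtain Cv Cw where "control Cv v" "control Cw w"
    using assms by (auto simp: excursion_def)
  then obtain C where C: "control C v" "control C w"
    using control_mono[of Cv v "max Cv Cw"] control_mono[of Cw w "max Cv Cw"] by auto
  have T0: "first_path v T = 0" using assms by (simp add: excursion_def)
  have u: "control C ?u" using C by (rule control_append)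
  have "\<bar>first_path ?u t\<bar> \<le> S" if "t \<in> {0..T + U}" for t
  proof (cases "t \<le> T")
    case True
    then show ?thesis using that assms(1) by (simp add: first_path_append_before excursion_def)
  next
    case False
    then show ?thesis
      using that assms(2) first_path_append[OF C T0 assms(3), of "t - T"] by (simp add: excursion_def)
  qed
  moreover have "first_path ?u (T + U) = 0"
    using first_path_append[OF C T0 assms(3,4)] assms(2) by (simp add: excursion_def)
  moreover have "integral {0..T + U} (\<lambda>t. first_path ?u t ^ j * ?u t l) = I j l + K j l" if l: "l \<noteq> L 0"
      for j l
  proof -
    have "(\<lambda>t. first_path ?u t ^ j * ?u t l) integrable_on {0..T + U}"
      by (intro regular_input_integrable continuous_on_power first_path_continuous[OF u]
          control_regular[OF u])
    then have "integral {0..T + U} (\<lambda>t. first_path ?u t ^ j * ?u t l)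
        = integral {0..T} (\<lambda>t. first_path ?u t ^ j * ?u t l) + integral {T..T + U} (\<lambda>t. first_path ?u t
            ^ j * ?u t l)"
      using assms by (intro Henstock_Kurzweil_Integration.integral_combine[symmetric]) auto
    also have "\<dots> = I j l + K j l"
      using assms l unfolding integral_append_before[OF order_refl order_refl] integral_append_after[OF
          C T0 assms(3,4)]
      by (simp add: excursion_def)
    finally show ?thesis .
  qed
  moreover have "\<bar>?u t l - e l\<bar> \<le> \<rho>" if "l \<noteq> L 0" for t l
    using assms that by (auto simp: excursion_def)
  ultimately show ?thesis using u unfolding excursion_def by blast
qed

text \<open>
  The first coordinate runs along s * (t / \<tau>) * (1 - t / \<tau>) while the other letters stay at a.
\<close>

lemma excursion_bump:
  assumes sys: "parity_condition (Suc n)" and \<tau>: "0 < \<tau>"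
    and a: "a drift = 1" "\<And>l. \<bar>a l - e l\<bar> \<le> \<rho>" and S: "\<bar>s\<bar> \<le> S"
  shows "\<exists>v. excursion S \<tau> v (\<lambda>j l. \<tau> * s ^ j * bump_moment j * a l)"
proof -
  have k0: "\<kappa> 0 \<noteq> 0" "L 0 \<in> good" "drift \<notin> good" "0 < \<rho>" and e_good: "\<And>l. l \<in> good \<Longrightarrow> e l = 0"
    using sys by (auto simp: parity_condition_def)
  \<comment> \<open>regular inputs are bounded on the whole line, hence time is stopped outside the interval\<close>
  define clamp where "clamp = (\<lambda>t. max 0 (min \<tau> t))"
  have clamp: "0 \<le> clamp t" "clamp t \<le> \<tau>" "t \<in> {0..\<tau>} \<Longrightarrow> clamp t = t" for t
    using \<tau> by (auto simp: clamp_def)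
  define V where "V = (\<lambda>t. s / \<tau> * (1 - 2 * clamp t / \<tau>) / \<kappa> 0)"
  define v where "v = (\<lambda>t l. if l = L 0 then V t else a l)"
  have V_le: "\<bar>V t\<bar> \<le> \<bar>s / \<tau> / \<kappa> 0\<bar>" for t
  proof -
    have "0 \<le> clamp t / \<tau>" "clamp t / \<tau> \<le> 1" using clamp[of t] \<tau> by (auto simp: divide_le_eq)
    then have "\<bar>1 - 2 * (clamp t / \<tau>)\<bar> \<le> 1" by linarith
    then have "\<bar>s / \<tau> / \<kappa> 0\<bar> * \<bar>1 - 2 * (clamp t / \<tau>)\<bar> \<le> \<bar>s / \<tau> / \<kappa> 0\<bar> * 1"
      by (intro mult_left_mono) auto
    moreover have "V t = s / \<tau> / \<kappa> 0 * (1 - 2 * (clamp t / \<tau>))" by (simp add: V_def)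
    ultimately show ?thesis by (simp add: abs_mult)
  qed
  have V_reg: "regular_input V"
  proof -
    have "isCont V t" for t unfolding V_def clamp_def by (intro continuous_intros) (use k0 \<tau> in auto)
    moreover have "bounded (range V)" by (rule boundedI) (use V_le in auto)
    ultimately show ?thesis by (simp add: regular_input_def)
  qed
  have path: "first_path v t = s * (t / \<tau> * (1 - t / \<tau>))" if t: "t \<in> {0..\<tau>}" for t
  proof -
    have "first_path v t = integral {0..t} (\<lambda>r. s / \<tau> * (1 - 2 * r / \<tau>))"
      unfolding first_path_def
      by (rule Henstock_Kurzweil_Integration.integral_cong) (use t k0 clamp(3) in \<open>auto simp: v_def V_def\<close>)
    then show ?thesis using integral_bump_velocity[OF \<tau>, of t s] t by simp
  qed
  define C where "C = max \<bar>s / \<tau> / \<kappa> 0\<bar> \<rho>"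
  have "control C v"
  proof -
    have "regular_input (\<lambda>t. v t l)" for l
      using V_reg by (cases "l = L 0") (auto simp: v_def regular_input_const)
    moreover have "v t \<in> control_values C" for t
      unfolding control_values_def
    proof (intro CollectI conjI allI ballI impI)
      show "v t drift = 1" "\<And>l. l \<notin> good \<Longrightarrow> \<bar>v t l - e l\<bar> \<le> \<rho>"
        using k0 a by (auto simp: v_def)
      show "\<bar>v t l\<bar> \<le> C" if "l \<in> good" for l
        using V_le[of t] a(2)[of l] e_good[OF that] by (auto simp: v_def C_def)
    qed
    ultimately show ?thesis by (auto simp: control_def)
  qed
  moreover have "\<bar>first_path v t\<bar> \<le> S" if t: "t \<in> {0..\<tau>}" for t
  proof -
    have "0 \<le> t / \<tau>" "t / \<tau> \<le> 1" using t \<tau> by (auto simp: divide_le_eq)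
    then have "\<bar>s\<bar> * (t / \<tau> * (1 - t / \<tau>)) \<le> \<bar>s\<bar> * (1 * 1)"
      by (intro mult_left_mono mult_mono) auto
    moreover have "\<bar>first_path v t\<bar> = \<bar>s\<bar> * (t / \<tau> * (1 - t / \<tau>))"
    proof -
      have "0 \<le> t / \<tau> * (1 - t / \<tau>)"
        using \<open>0 \<le> t / \<tau>\<close> \<open>t / \<tau> \<le> 1\<close> by (intro mult_nonneg_nonneg) auto
      then show ?thesis by (simp only: path[OF t] abs_mult[of s] abs_of_nonneg)
    qed
    ultimately show ?thesis using S by simp
  qed
  moreover have "first_path v \<tau> = 0" using path[of \<tau>] \<tau> by simp
  moreover have "integral {0..\<tau>} (\<lambda>t. first_path v t ^ j * v t l) = \<tau> * s ^ j * bump_moment j * a l"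
      if "l \<noteq> L 0" for j l
  proof -
    have "integral {0..\<tau>} (\<lambda>t. first_path v t ^ j * v t l)
        = integral {0..\<tau>} (\<lambda>t. (s * (t / \<tau> * (1 - t / \<tau>))) ^ j * a l)"
      using path that by (intro Henstock_Kurzweil_Integration.integral_cong) (simp add: v_def)
    then show ?thesis using integral_bump_power[OF \<tau>, of s j] by simp
  qed
  ultimately have "excursion S \<tau> v (\<lambda>j l. \<tau> * s ^ j * bump_moment j * a l)"
    unfolding excursion_def using a by (auto simp: v_def)
  then show ?thesis by blast
qed

lemma control_rest:
  assumes "parity_condition n"
  shows "control 0 (\<lambda>t. e)"
  using assms by (auto simp: control_def control_values_def parity_condition_def regular_input_const)

lemma excursion_bumps:
  fixes R :: nat
  assumes sys: "parity_condition (Suc n)" and \<tau>: "\<And>k. k < R \<Longrightarrow> 0 < \<tau> k"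
    and a: "\<And>k. k < R \<Longrightarrow> a k drift = 1" "\<And>k l. k < R \<Longrightarrow> \<bar>a k l - e l\<bar> \<le> \<rho>"
    and S: "\<And>k. k < R \<Longrightarrow> \<bar>s k\<bar> \<le> S" "0 \<le> S"
  shows "\<exists>v. excursion S (\<Sum>k<R. \<tau> k) v (\<lambda>j l. \<Sum>k<R. \<tau> k * s k ^ j * bump_moment j * a k l)"
  using \<tau> a S(1)
proof (induction R)
  case 0
  have "excursion S 0 (\<lambda>t. e) (\<lambda>j l. 0)"
    using control_rest[OF sys] sys S(2)
    by (auto simp: excursion_def first_path_def parity_condition_def)
  then show ?case by auto
next
  case (Suc R)
  then obtain v where v: "excursion S (\<Sum>k<R. \<tau> k) v (\<lambda>j l. \<Sum>k<R. \<tau> k * s k ^ j * bump_moment j * a k l)"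
    by fastforce
  obtain w where w: "excursion S (\<tau> R) w (\<lambda>j l. \<tau> R * s R ^ j * bump_moment j * a R l)"
    using excursion_bump[OF sys, of "\<tau> R" "a R" "s R" S] Suc.prems by blast
  have "0 \<le> \<tau> k" if "k < Suc R" for k
    using Suc.prems(1)[OF that] by simp
  then have "0 \<le> (\<Sum>k<R. \<tau> k)" "0 \<le> \<tau> R"
    by (auto intro: sum_nonneg)
  from excursion_append[OF v w this] show ?case by auto
qed

section \<open>Elimination of the first coordinate\<close>

text \<open>
  For these letters j # l, the mean of x_0^j times the input of l vanishes over the symmetric profile,
  with the good letters at their reference value 0.
\<close>

definition lifted_good :: "letter set" where
  "lifted_good = {j # l | j l. l \<in> good \<or> odd j}"

text \<open>
  The bumps have heights proportional to the nodes -J, ..., J, all with the same duration in the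
  reference profile; this is the mean of the j-th powers of the nodes.
\<close>

definition node_mean :: "nat \<Rightarrow> nat \<Rightarrow> real" where
  "node_mean J j = (\<Sum>k<2 * J + 1. (real k - real J) ^ j) / real (2 * J + 1)"

text \<open>
  The mean of x_0^j times the input of l for the reference profile.
\<close>

definition lifted_e :: "nat \<Rightarrow> letter \<Rightarrow> real" where
  "lifted_e J l' = (case l' of [] \<Rightarrow> 0 | j # l \<Rightarrow> e l * bump_moment j * node_mean J j)"

text \<open>
  The parity clause survives since an odd exponent of the first coordinate makes the new letter good;
  the reference values at the new good letters vanish since odd powers of symmetric nodes cancel.
\<close>

lemma lifted_parity_condition:
  assumes "parity_condition (Suc n)" "0 < \<rho>'"
  shows "control_system.parity_condition (\<lambda>c j. m (Suc c) (Suc j)) (\<lambda>c. m (Suc c) 0 # L (Suc c))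
    (\<lambda>c. \<kappa> (Suc c)) lifted_good (0 # drift) (lifted_e J) \<rho>' n"
  unfolding control_system.parity_condition_def
proof (intro conjI allI impI ballI)
  fix c assume c: "c < n"
  then have "\<kappa> (Suc c) \<noteq> 0" and "L (Suc c) \<in> good \<or> (\<exists>j<Suc c. odd (m (Suc c) j))"
    using assms(1) by (auto simp: parity_condition_def)
  then show "\<kappa> (Suc c) \<noteq> 0" "m (Suc c) 0 # L (Suc c) \<in> lifted_good \<or> (\<exists>j<c. odd (m (Suc c) (Suc j)))"
    by (auto simp: lifted_good_def less_Suc_eq_0_disj)
next
  fix b c assume bc: "b < c \<and> c < n"
  show "\<not> (m (Suc c) 0 # L (Suc c) = m (Suc b) 0 # L (Suc b)
      \<and> (\<forall>j<b. m (Suc c) (Suc j) = m (Suc b) (Suc j)))"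
  proof
    assume "m (Suc c) 0 # L (Suc c) = m (Suc b) 0 # L (Suc b)
        \<and> (\<forall>j<b. m (Suc c) (Suc j) = m (Suc b) (Suc j))"
    then have "L (Suc c) = L (Suc b) \<and> (\<forall>j<Suc b. m (Suc c) j = m (Suc b) j)"
      by (auto simp: less_Suc_eq_0_disj)
    moreover have "Suc b < Suc c \<and> Suc c < Suc n" using bc by simp
    ultimately show False
      using assms(1) unfolding parity_condition_def by blast
  qed
next
  fix l' assume "l' \<in> lifted_good"
  then obtain j l where l': "l' = j # l" "l \<in> good \<or> odd j" by (auto simp: lifted_good_def)
  have "e l = 0 \<or> node_mean J j = 0"
    using l'(2)
  proof
    assume "l \<in> good"
    then show ?thesis using assms(1) by (simp add: parity_condition_def)
  next
    assume "odd j"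
    then show ?thesis unfolding node_mean_def by (simp only: sum_odd_power_centered div_0 simp_thms)
  qed
  then show "lifted_e J l' = 0" by (auto simp: l'(1) lifted_e_def)
next
  show "0 # drift \<notin> lifted_good" "lifted_e J (0 # drift) = 1" "0 < \<rho>'"
    using assms by (auto simp: lifted_good_def lifted_e_def node_mean_def parity_condition_def)
qed

text \<open>
  All means near the reference values are attained exactly. The durations of the bumps (for the
  drift letter) and the constant values of the letters during the bumps (for the others) are varied.
  They enter the means linearly once durations times values are taken as unknowns; the linear system
  in the unknowns of one letter is a Vandermonde system, solved by the dual basis of moments.
\<close>

lemma excursion_realize:
  assumes sys: "parity_condition (Suc n)" and F: "finite F" "drift \<in> F" "L 0 \<notin> F"
  shows "\<exists>\<rho>'>0. \<forall>\<tau>>0. \<forall>w. (\<forall>l. \<bar>w l - lifted_e J l\<bar> \<le> \<rho>') \<and> w (0 # drift) = 1 \<longrightarrow>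
           (\<exists>v I. excursion (real J) \<tau> v I \<and> (\<forall>j\<le>J. \<forall>l\<in>F. I j l = \<tau> * w (j # l)))"
proof -
  define R where "R = 2 * J + 1"
  define x where "x = (\<lambda>k. real k - real J)"
  have R: "0 < R" "real R \<noteq> 0" by (auto simp: R_def)
  have "inj_on x {..<R}" by (auto simp: inj_on_def x_def)
  then obtain \<beta> where \<beta>: "\<And>i j. \<lbrakk>i < R; j < R\<rbrakk> \<Longrightarrow> (\<Sum>k<R. \<beta> k i * x k ^ j) = (if j = i then 1 else 0)"
    using moments_dual_basis[of x R] by blast
  have mean: "node_mean J j = (\<Sum>k<R. x k ^ j) / real R" for j
    by (simp add: node_mean_def R_def x_def)
  have \<rho>: "0 < \<rho>" and ez: "e drift = 1" using sys by (auto simp: parity_condition_def)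
  define B where "B = (\<Sum>k<R. \<Sum>j\<le>J. real R * (\<bar>\<beta> k j\<bar> / bump_moment j))"
  define E where "E = (\<Sum>l\<in>F. \<bar>e l\<bar>)"
  have nn: "0 \<le> real R * (\<bar>\<beta> k j\<bar> / bump_moment j)" for k j
    using bump_moment_pos[of j] by simp
  have B: "0 \<le> B" unfolding B_def by (intro sum_nonneg nn)
  have E: "0 \<le> E" "\<And>l. l \<in> F \<Longrightarrow> \<bar>e l\<bar> \<le> E" unfolding E_def using F(1)
      by (auto intro: sum_nonneg member_le_sum)
  \<comment> \<open>bound on the perturbations \<open>A k l - e l\<close> below; with at most 1/2 the durations stay positive, and the
    second term keeps the quotients within \<open>\<rho>\<close> of the reference values\<close>
  define \<eta> where "\<eta> = min (1 / 2) (\<rho> / (2 * (1 + E)))"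
  have \<eta>: "0 < \<eta>" "\<eta> \<le> 1 / 2" "2 * (1 + E) * \<eta> \<le> \<rho>"
  proof -
    show "0 < \<eta>" using \<rho> E(1) by (simp add: \<eta>_def)
    show "\<eta> \<le> 1 / 2" unfolding \<eta>_def by (rule min.cobounded1)
    have "\<eta> \<le> \<rho> / (2 * (1 + E))" by (simp add: \<eta>_def)
    then show "2 * (1 + E) * \<eta> \<le> \<rho>" using E(1) by (simp add: le_divide_eq mult.commute)
  qed
  define \<rho>' where "\<rho>' = \<eta> / (B + 1)"
  have \<rho>': "0 < \<rho>'" "B * \<rho>' \<le> \<eta>"
  proof -
    show "0 < \<rho>'" using \<eta> B by (simp add: \<rho>'_def)
    have "B * \<eta> \<le> (B + 1) * \<eta>" using \<eta> by (intro mult_right_mono) auto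
    then show "B * \<rho>' \<le> \<eta>" using B by (simp add: \<rho>'_def divide_le_eq mult.commute)
  qed
  have "\<exists>v I. excursion (real J) \<tau> v I \<and> (\<forall>j\<le>J. \<forall>l\<in>F. I j l = \<tau> * w (j # l))"
    if \<tau>: "0 < \<tau>" and w: "\<And>l. \<bar>w l - lifted_e J l\<bar> \<le> \<rho>'" "w (0 # drift) = 1" for \<tau> w
  proof -
    \<comment> \<open>R times (relative duration of the k-th bump) times (value of l during it)\<close>
    define A where "A = (\<lambda>k l. e l + real R * (\<Sum>j\<le>J. \<beta> k j * ((w (j # l) - lifted_e J (j # l)) /
        bump_moment j)))"
    have A_le: "\<bar>A k l - e l\<bar> \<le> \<eta>" if k: "k < R" for k l
    proof -
      have "\<bar>A k l - e l\<bar> = \<bar>\<Sum>j\<le>J. real R * (\<beta> k j / bump_moment j) * (w (j # l) - lifted_e J (j # l))\<bar>"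
        by (simp add: A_def sum_distrib_left mult_ac)
      also have "\<dots> \<le> (\<Sum>j\<le>J. real R * (\<bar>\<beta> k j\<bar> / bump_moment j) * \<rho>')"
      proof (rule sum_abs[THEN order_trans], rule sum_mono)
        fix j
        show "\<bar>real R * (\<beta> k j / bump_moment j) * (w (j # l) - lifted_e J (j # l))\<bar>
            \<le> real R * (\<bar>\<beta> k j\<bar> / bump_moment j) * \<rho>'"
        proof -
          have "\<bar>real R * (\<beta> k j / bump_moment j) * (w (j # l) - lifted_e J (j # l))\<bar>
              = real R * (\<bar>\<beta> k j\<bar> / bump_moment j) * \<bar>w (j # l) - lifted_e J (j # l)\<bar>"
            using bump_moment_pos[of j] by (simp add: abs_mult)
          then show ?thesis using mult_left_mono[OF w(1) nn] by metis
        qed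
      qed
      also have "\<dots> \<le> B * \<rho>'"
        unfolding sum_distrib_right[symmetric] B_def
        using k nn \<rho>' by (intro mult_right_mono member_le_sum[of k "{..<R}" "\<lambda>k. \<Sum>j\<le>J. real R * (\<bar>\<beta> k j\<bar>
            / bump_moment j)"]) (auto intro!: sum_nonneg)
      finally show ?thesis using \<rho>' by simp
    qed
    have A_moment: "(\<Sum>k<R. A k l * x k ^ j) * bump_moment j = real R * w (j # l)" if j: "j \<le> J" for j l
    proof -
      let ?d = "\<lambda>i. (w (i # l) - lifted_e J (i # l)) / bump_moment i"
      have "(\<Sum>k<R. (\<Sum>i\<le>J. \<beta> k i * ?d i) * x k ^ j) = (\<Sum>i\<le>J. ?d i * (\<Sum>k<R. \<beta> k i * x k ^ j))"
        unfolding sum_distrib_left sum_distrib_right by (subst sum.swap) (simp add: mult_ac)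
      also have "\<dots> = (\<Sum>i\<le>J. if i = j then ?d i else 0)"
      proof (rule sum.cong)
        fix i assume "i \<in> {..J}"
        then have "i < R" "j < R" using j by (auto simp: R_def)
        then show "?d i * (\<Sum>k<R. \<beta> k i * x k ^ j) = (if i = j then ?d i else 0)"
          using \<beta>[of i j] by simp
      qed simp
      also have "\<dots> = ?d j" using j by simp
      finally have *: "(\<Sum>k<R. (\<Sum>i\<le>J. \<beta> k i * ?d i) * x k ^ j) = ?d j" .
      have "(\<Sum>k<R. A k l * x k ^ j) = e l * (\<Sum>k<R. x k ^ j) + real R * (\<Sum>k<R. (\<Sum>i\<le>J. \<beta> k i * ?d i) * x k
          ^ j)"
        unfolding A_def sum_distrib_left[of "e l"] sum_distrib_left[of "real R" _ "{..<R}"]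
            sum.distrib[symmetric]
        by (intro sum.cong) (simp_all add: distrib_right mult.assoc)
      also have "\<dots> = e l * (real R * node_mean J j) + real R * ?d j"
        unfolding * using R by (simp add: mean)
      finally show ?thesis
        using bump_moment_pos[of j] by (simp add: lifted_e_def field_simps)
    qed
    have Az: "1 / 2 \<le> A k drift" if "k < R" for k
      using A_le[OF that, of drift] \<eta> ez by linarith
    \<comment> \<open>the drift letter has value 1, so \<open>A k drift\<close> is R times the relative duration\<close>
    define a where "a = (\<lambda>k l. if l \<in> F then A k l / A k drift else e l)"
    define d where "d = (\<lambda>k. \<tau> / real R * A k drift)"
    have d: "0 < d k" if "k < R" for k
      using Az[OF that] \<tau> R by (simp add: d_def)
    have a1: "a k drift = 1" if "k < R" for k using Az[OF that] F by (simp add: a_def)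
    have a2: "\<bar>a k l - e l\<bar> \<le> \<rho>" if k: "k < R" for k l
    proof (cases "l \<in> F")
      case True
      have "\<bar>A k l - e l * A k drift\<bar> = \<bar>(A k l - e l) - e l * (A k drift - 1)\<bar>"
        by (simp add: algebra_simps)
      also have "\<dots> \<le> \<bar>A k l - e l\<bar> + \<bar>e l\<bar> * \<bar>A k drift - 1\<bar>"
        using abs_triangle_ineq4[of "A k l - e l" "e l * (A k drift - 1)"] by (simp only: abs_mult)
      also have "\<dots> \<le> \<eta> + E * \<eta>"
        using A_le[OF k, of l] A_le[OF k, of drift] E(2)[OF True] E(1) ez by (intro add_mono mult_mono) auto
      finally have "\<bar>A k l - e l * A k drift\<bar> \<le> (1 + E) * \<eta>" by (simp add: algebra_simps)
      also have "\<dots> \<le> \<rho> * (1 / 2)" using \<eta>(3) by (simp add: algebra_simps)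
      also have "\<dots> \<le> \<rho> * A k drift" using Az[OF k] \<rho> by (intro mult_left_mono) auto
      finally have "\<bar>A k l - e l * A k drift\<bar> / A k drift \<le> \<rho>"
        using Az[OF k] by (simp add: divide_le_eq)
      moreover have "a k l - e l = (A k l - e l * A k drift) / A k drift"
        using Az[OF k] True by (simp add: a_def diff_divide_distrib)
      ultimately show ?thesis using Az[OF k] by (simp add: abs_divide)
    qed (use \<rho> in \<open>simp add: a_def\<close>)
    let ?I = "\<lambda>j l. \<Sum>k<R. d k * x k ^ j * bump_moment j * a k l"
    have "\<exists>v. excursion (real J) (\<Sum>k<R. d k) v ?I"
    proof (rule excursion_bumps[OF sys d a1 a2])
      show "\<bar>x k\<bar> \<le> real J" if "k < R" for k using that by (auto simp: x_def R_def)
    qed auto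
    then obtain v where v: "excursion (real J) (\<Sum>k<R. d k) v ?I" by blast
    have moments: "(\<Sum>k<R. d k * x k ^ j * bump_moment j * a k l) = \<tau> * w (j # l)" if "j \<le> J" "l \<in> F" for j l
    proof -
      have "(\<Sum>k<R. d k * x k ^ j * bump_moment j * a k l)
          = (\<Sum>k<R. \<tau> / real R * (A k l * x k ^ j * bump_moment j))"
      proof (rule sum.cong)
        fix k assume "k \<in> {..<R}"
        then have "A k drift \<noteq> 0" using Az[of k] by auto
        then show "d k * x k ^ j * bump_moment j * a k l = \<tau> / real R * (A k l * x k ^ j * bump_moment j)"
          using that by (simp add: d_def a_def)
      qed simp
      also have "\<dots> = \<tau> / real R * ((\<Sum>k<R. A k l * x k ^ j) * bump_moment j)"
        by (simp add: sum_distrib_left sum_distrib_right)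
      finally show ?thesis using A_moment[OF that(1)] R by simp
    qed
    have total: "(\<Sum>k<R. d k) = \<tau>"
    proof -
      have "(\<Sum>k<R. d k) = (\<Sum>k<R. d k * x k ^ 0 * bump_moment 0 * a k drift)"
        using a1 by (intro sum.cong) auto
      also have "\<dots> = \<tau> * w (0 # drift)" using F by (intro moments) auto
      finally show ?thesis using w(2) by simp
    qed
    show ?thesis
      using v moments unfolding total by (intro exI[of _ v] exI[of _ ?I]) blast
  qed
  with \<rho>'(1) show ?thesis by blast
qed

text \<open>
  Every excursion returns the first coordinate to 0, so excursions on consecutive cells can be
  concatenated without disturbing each other.
\<close>

lemma excursion_cells:
  fixes N :: nat
  assumes sys: "parity_condition (Suc n)" and F: "L 0 \<notin> F" and "0 < \<tau>" "0 \<le> S"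
    and cell: "\<And>i. i < N \<Longrightarrow> \<exists>v I. excursion S \<tau> v I \<and> (\<forall>j\<le>J. \<forall>l\<in>F. I j l = \<tau> * w i (j # l))"
  shows "\<exists>v. (\<exists>I. excursion S (real N * \<tau>) v I) \<and> (\<forall>i<N. \<forall>j\<le>J. \<forall>l\<in>F.
     integral {real i * \<tau>..real (Suc i) * \<tau>} (\<lambda>t. first_path v t ^ j * v t l) = \<tau> * w i (j # l))"
  using cell
proof (induction N)
  case 0
  have "excursion S 0 (\<lambda>t. e) (\<lambda>j l. 0)"
    using control_rest[OF sys] sys \<open>0 \<le> S\<close>
    by (auto simp: excursion_def first_path_def parity_condition_def)
  then show ?case by auto
next
  case (Suc N)
  obtain v I where v: "excursion S (real N * \<tau>) v I"
    and vN: "\<And>i j l. \<lbrakk>i < N; j \<le> J; l \<in> F\<rbrakk> \<Longrightarrow>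
      integral {real i * \<tau>..real (Suc i) * \<tau>} (\<lambda>t. first_path v t ^ j * v t l) = \<tau> * w i (j # l)"
    using Suc.IH[OF Suc.prems[OF less_SucI]] by blast
  obtain u K where u: "excursion S \<tau> u K" and K: "\<And>j l. \<lbrakk>j \<le> J; l \<in> F\<rbrakk> \<Longrightarrow> K j l = \<tau> * w N (j # l)"
    using Suc.prems[of N] by auto
  let ?a = "real N * \<tau>"
  let ?v = "\<lambda>t. if t < ?a then v t else u (t - ?a)"
  have a: "0 \<le> ?a" "?a + \<tau> = real (Suc N) * \<tau>" using \<open>0 < \<tau>\<close> by (auto simp: algebra_simps)
  have ex: "\<exists>I. excursion S (real (Suc N) * \<tau>) ?v I"
    using excursion_append[OF v u a(1)] \<open>0 < \<tau>\<close> unfolding a(2) by auto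
  obtain Cv Cu where "control Cv v" "control Cu u"
    using v u by (auto simp: excursion_def)
  then obtain C where C: "control C v" "control C u"
    using control_mono[of Cv v "max Cv Cu"] control_mono[of Cu u "max Cv Cu"] by auto
  have T0: "first_path v ?a = 0" using v by (simp add: excursion_def)
  have "integral {real i * \<tau>..real (Suc i) * \<tau>} (\<lambda>t. first_path ?v t ^ j * ?v t l) = \<tau> * w i (j # l)"
    if i: "i < Suc N" and jl: "j \<le> J" "l \<in> F" for i j l
  proof (cases "i = N")
    case True
    have "integral {?a..?a + \<tau>} (\<lambda>t. first_path ?v t ^ j * ?v t l)
        = integral {0..\<tau>} (\<lambda>t. first_path u t ^ j * u t l)"
      using integral_append_after[OF C T0 a(1)] \<open>0 < \<tau>\<close> by simp
    also have "\<dots> = \<tau> * w N (j # l)"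
      using u K[OF jl] jl F unfolding excursion_def by metis
    finally show ?thesis unfolding True a(2) .
  next
    case False
    then have "i < N" using i by simp
    then have "real (Suc i) * \<tau> \<le> ?a" using \<open>0 < \<tau>\<close> by (intro mult_right_mono) auto
    then show ?thesis
      using vN[OF \<open>i < N\<close> jl] \<open>0 < \<tau>\<close> by (subst integral_append_before) auto
  qed
  with ex show ?case by blast
qed

text \<open>
  The eliminated system reaches \<open>\<sigma>\<close> on its last axis; shrinking the good controls until they lie
  within the radius of \<open>excursion_realize\<close> leaves \<open>\<sigma> * \<delta>\<close>. The means of that control on the cells of
  a fine grid are realized by excursions of the first coordinate, and averaging bounds the error.
\<close>

lemma approx_from_lifted:
  assumes sys: "parity_condition (Suc n)" and n: "0 < n"
    and IH: "\<And>J \<rho>'. 0 < \<rho>' \<Longrightarrow> control_system.controllable (\<lambda>c j. m (Suc c) (Suc j)) (\<lambda>c. m (Suc c) 0 # L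
        (Suc c))
      (\<lambda>c. \<kappa> (Suc c)) lifted_good (0 # drift) (lifted_e J) \<rho>' n"
    and T: "0 < T"
  shows "\<exists>\<delta>>0. \<forall>\<sigma>\<in>{1, -1}. \<forall>\<epsilon>>0. \<exists>C q.
        steers (Suc n) C T (\<lambda>_. 0) q \<and> (\<forall>c<n. \<bar>q c\<bar> \<le> \<epsilon>) \<and> \<bar>q n - \<sigma> * \<delta>\<bar> \<le> \<epsilon>"
proof -
  define J where "J = (\<Sum>c<n. m (Suc c) 0)"
  define F where "F = insert drift (L ` {1..n})"
  have J: "m (Suc c) 0 \<le> J" if "c < n" for c
    unfolding J_def using that by (intro member_le_sum[of c "{..<n}" "\<lambda>c. m (Suc c) 0"]) auto
  have "finite F" "drift \<in> F" by (auto simp: F_def)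
  have LF: "L (Suc c) \<in> F" if "c < n" for c using that by (auto simp: F_def)
  have "L 0 \<in> good" "drift \<notin> good" and \<rho>: "0 < \<rho>" using sys by (auto simp: parity_condition_def)
  moreover have "L c \<noteq> L 0" if "c \<in> {1..n}" for c
  proof -
    have "0 < c \<and> c < Suc n" using that by auto
    then show ?thesis using sys unfolding parity_condition_def by (metis not_less_zero)
  qed
  ultimately have L0: "L 0 \<notin> F" unfolding F_def by (metis imageE insertE)
  have LS: "L (Suc c) \<noteq> L 0" if "c < n" for c using LF[OF that] L0 by auto
  obtain \<rho>' where \<rho>': "0 < \<rho>'" and realize: "\<And>\<tau> w. \<lbrakk>0 < \<tau>; \<forall>l. \<bar>w l - lifted_e J l\<bar> \<le> \<rho>'; w (0 # drift)
      = 1\<rbrakk> \<Longrightarrow>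
      \<exists>v I. excursion (real J) \<tau> v I \<and> (\<forall>j\<le>J. \<forall>l\<in>F. I j l = \<tau> * w (j # l))"
    using excursion_realize[OF sys \<open>finite F\<close> \<open>drift \<in> F\<close> L0, of J] by blast
  let ?m = "\<lambda>c j. m (Suc c) (Suc j)"
  interpret lifted: control_system ?m "\<lambda>c. m (Suc c) 0 # L (Suc c)" "\<lambda>c. \<kappa> (Suc c)" lifted_good "0 #
      drift" "lifted_e J" \<rho>' .
  have lsys: "lifted.parity_condition n" by (rule lifted_parity_condition[OF sys \<rho>'])
  obtain C' where C': "\<And>p q. \<forall>c<n. \<bar>p c\<bar> \<le> 1 \<and> \<bar>q c\<bar> \<le> 1 \<Longrightarrow> lifted.steers n C' T p q"
    using IH[OF \<rho>', of J] T unfolding lifted.controllable_def by blast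
  \<comment> \<open>shrinks the good controls of the eliminated system into the admissible radius\<close>
  define \<mu> where "\<mu> = min 1 (\<rho>' / max C' 1)"
  have \<mu>: "0 < \<mu>" "\<mu> * C' \<le> \<rho>'"
  proof -
    show "0 < \<mu>" using \<rho>' by (simp add: \<mu>_def)
    then have "\<mu> * C' \<le> \<mu> * max C' 1" by (intro mult_left_mono) auto
    also have "\<dots> \<le> \<rho>' / max C' 1 * max C' 1" by (intro mult_right_mono) (auto simp: \<mu>_def)
    finally show "\<mu> * C' \<le> \<rho>'" by simp
  qed
  define \<delta> where "\<delta> = \<mu> ^ lifted.weight (n - 1)"
  have \<delta>: "0 < \<delta>" using \<mu> by (simp add: \<delta>_def)
  \<comment> \<open>a common bound for the oscillating and for the averaged inputs, independent of the grid\<close>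
  define Cb where "Cb = (\<Sum>c<n. (1 + real J) ^ J * (\<bar>\<kappa> (Suc c)\<bar> * (\<bar>e (L (Suc c))\<bar> + \<rho>))) +
      lifted.input_bound n \<rho>'"
  have ib: "0 \<le> lifted.input_bound n \<rho>'"
    using lifted.input_tame(2)[OF lsys, of \<rho>' "\<lambda>t. lifted_e J"]
      lifted.control_mono[OF lifted.control_rest[OF lsys], of \<rho>'] \<rho>' by simp
  have sb: "0 \<le> (1 + real J) ^ J * (\<bar>\<kappa> (Suc c)\<bar> * (\<bar>e (L (Suc c))\<bar> + \<rho>))" for c
    using \<rho> by simp
  have Cb: "0 \<le> Cb" unfolding Cb_def using ib sb by (intro add_nonneg_nonneg sum_nonneg) auto
  obtain K where K: "0 \<le> K" and avg: "\<forall>N h h' p. 0 < N \<and> tame_inputs n T Cb h \<and> tame_inputs n T Cb h'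
      \<and> (\<forall>c<n. \<bar>p c\<bar> \<le> 0) \<and>
      (\<forall>i<N. \<forall>c<n. integral {real i * (T / real N)..real (Suc i) * (T / real N)} (\<lambda>t. h t c)
                   = integral {real i * (T / real N)..real (Suc i) * (T / real N)} (\<lambda>t. h' t c)) \<longrightarrow>
      (\<forall>t\<in>{0..T}. \<forall>c<n. \<bar>flow ?m h p t c - flow ?m h' p t c\<bar> \<le> K * (T / real N))"
    using flow_average[OF T Cb, of n 0 ?m] by (elim exE conjE) (rule that)
  have "\<exists>C q. steers (Suc n) C T (\<lambda>_. 0) q \<and> (\<forall>c<n. \<bar>q c\<bar> \<le> \<epsilon>) \<and> \<bar>q n - \<sigma> * \<delta>\<bar> \<le> \<epsilon>"
    if \<sigma>: "\<sigma> \<in> {1, -1}" and \<epsilon>: "0 < \<epsilon>" for \<sigma> \<epsilon>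
  proof -
    let ?q = "\<lambda>c. if c = n - 1 then \<sigma> * \<delta> else 0"
    have "lifted.steers n C' T (\<lambda>_. 0) (\<lambda>c. if c = n - 1 then \<sigma> else 0)"
      using \<sigma> by (intro C') auto
    from lifted.steers_scale[OF lsys this, of \<mu>] \<mu>(1) T
    have "lifted.steers n (\<mu> * C') T (\<lambda>c. \<mu> ^ lifted.weight c * 0) (\<lambda>c. \<mu> ^ lifted.weight c * (if c
        = n - 1 then \<sigma> else 0))"
      by simp
    then have "lifted.steers n (\<mu> * C') T (\<lambda>_. 0) ?q"
      by (rule lifted.steers_cong) (use T in \<open>auto simp: \<delta>_def\<close>)
    from lifted.steers_mono[OF this \<mu>(2)]
    obtain v' where v': "lifted.control \<rho>' v'"
        and v'_end: "\<And>c. c < n \<Longrightarrow> flow ?m (lifted.input v') (\<lambda>_. 0) T c = ?q c"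
      by (auto simp: lifted.steers_def)
    have v'_vals: "v' t \<in> lifted.control_values \<rho>'" for t
      using v' by (auto simp: lifted.control_def)
    have dev: "\<bar>v' t l - lifted_e J l\<bar> \<le> \<rho>'" for t l
    proof (cases "l \<in> lifted_good")
      case True
      then show ?thesis using v'_vals[of t] lsys by (simp add: lifted.control_values_def
          lifted.parity_condition_def)
    next
      case False
      then show ?thesis
        using v'_vals[of t] lsys by (cases "l = 0 # drift") (auto simp: lifted.control_values_def
            lifted.parity_condition_def)
    qed
    have v'_int: "(\<lambda>t. v' t l) integrable_on {a..b}" for l a b
      using regular_input_integrable[of a b "\<lambda>_. 1"] lifted.control_regular[OF v'] by simp
    obtain N0 :: nat where N0: "K * T / \<epsilon> < real N0" using reals_Archimedean2 by blast
    define N where "N = Suc N0"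
    define \<tau> where "\<tau> = T / real N"
    have N: "0 < N" "0 < \<tau>" "T = real N * \<tau>" using T by (auto simp: N_def \<tau>_def)
    have small: "K * \<tau> \<le> \<epsilon>"
    proof -
      have "K * T / \<epsilon> \<le> real N" using N0 by (simp add: N_def)
      then show ?thesis using \<epsilon> N(1) by (simp add: \<tau>_def divide_le_eq mult.commute)
    qed
    \<comment> \<open>mean of the letter l of the eliminated system on the i-th cell\<close>
    define w where "w = (\<lambda>i l. integral {real i * \<tau>..real (Suc i) * \<tau>} (\<lambda>t. v' t l) / \<tau>)"
    have cell_len: "real i * \<tau> \<le> real (Suc i) * \<tau>" "real (Suc i) * \<tau> - real i * \<tau> = \<tau>" for i :: nat
      using N(2) by (auto simp: algebra_simps)
    have w: "\<bar>w i l - lifted_e J l\<bar> \<le> \<rho>'" for i l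
    proof -
      have "\<bar>integral {real i * \<tau>..real (Suc i) * \<tau>} (\<lambda>t. v' t l - lifted_e J l)\<bar>
          \<le> \<rho>' * (real (Suc i) * \<tau> - real i * \<tau>)"
        using dev cell_len by (intro abs_integral_le integrable_diff v'_int) auto
      moreover have "integral {real i * \<tau>..real (Suc i) * \<tau>} (\<lambda>t. v' t l - lifted_e J l)
          = \<tau> * (w i l - lifted_e J l)"
      proof -
        have "integral {real i * \<tau>..real (Suc i) * \<tau>} (\<lambda>t. lifted_e J l) = \<tau> * lifted_e J l"
          using cell_len[of i] by (simp only: integral_const_real content_real real_scaleR_def)
        moreover have "integral {real i * \<tau>..real (Suc i) * \<tau>} (\<lambda>t. v' t l - lifted_e J l)
            = integral {real i * \<tau>..real (Suc i) * \<tau>} (\<lambda>t. v' t l) - integral {real i * \<tau>..real (Suc i)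
                * \<tau>} (\<lambda>t. lifted_e J l)"
          by (intro integral_diff v'_int) auto
        moreover have "integral {real i * \<tau>..real (Suc i) * \<tau>} (\<lambda>t. v' t l) = \<tau> * w i l"
          using N(2) by (simp add: w_def)
        ultimately show ?thesis by (simp only: right_diff_distrib)
      qed
      ultimately have "\<tau> * \<bar>w i l - lifted_e J l\<bar> \<le> \<tau> * \<rho>'"
        using N(2) by (simp only: cell_len(2) abs_mult abs_of_pos) (simp only: mult.commute)
      then show ?thesis using N(2) by simp
    qed
    have w1: "w i (0 # drift) = 1" for i
    proof -
      have "v' t (0 # drift) = 1" for t using v'_vals[of t] by (simp add: lifted.control_values_def)
      then have "integral {real i * \<tau>..real (Suc i) * \<tau>} (\<lambda>t. v' t (0 # drift)) = \<tau>"
        using cell_len[of i] by (simp only: integral_const_real content_real real_scaleR_def mult_1_right)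
      then show ?thesis using N(2) by (simp add: w_def)
    qed
    have "\<exists>v I. excursion (real J) \<tau> v I \<and> (\<forall>j\<le>J. \<forall>l\<in>F. I j l = \<tau> * w i (j # l))" for i
      using realize[OF N(2), of "w i"] w w1 by blast
    from excursion_cells[OF sys L0 N(2) of_nat_0_le_iff, of N J J w, OF this]
    obtain v I where ex: "excursion (real J) T v I" and v_cells: "\<And>i j l. \<lbrakk>i < N; j \<le> J; l \<in> F\<rbrakk> \<Longrightarrow>
      integral {real i * \<tau>..real (Suc i) * \<tau>} (\<lambda>t. first_path v t ^ j * v t l) = \<tau> * w i (j # l)"
      unfolding N(3)[symmetric] by blast
    obtain C where C: "control C v" using ex by (auto simp: excursion_def)
    have path_T: "first_path v T = 0" and path_le: "\<And>t. t \<in> {0..T} \<Longrightarrow> \<bar>first_path v t\<bar> \<le> real J"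
      and v_dev: "\<And>t l. l \<noteq> L 0 \<Longrightarrow> \<bar>v t l - e l\<bar> \<le> \<rho>"
      using ex by (auto simp: excursion_def)
    \<comment> \<open>the path of the first coordinate is only bounded on [0, T]\<close>
    define clamp where "clamp = (\<lambda>t. max 0 (min T t))"
    have clamp: "clamp t \<in> {0..T}" "t \<in> {0..T} \<Longrightarrow> clamp t = t" for t
      using T by (auto simp: clamp_def)
    define h where "h = (\<lambda>t c. first_path v (clamp t) ^ m (Suc c) 0 * (\<kappa> (Suc c) * v t (L (Suc c))))"
    have h_le: "\<bar>h t c\<bar> \<le> Cb" if c: "c < n" for t c
    proof -
      have "\<bar>first_path v (clamp t)\<bar> ^ m (Suc c) 0 \<le> (1 + real J) ^ m (Suc c) 0"
        using path_le[OF clamp(1)[of t]] by (intro power_mono) auto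
      also have "\<dots> \<le> (1 + real J) ^ J" using J[OF c] by (intro power_increasing) auto
      finally have "\<bar>first_path v (clamp t)\<bar> ^ m (Suc c) 0 \<le> (1 + real J) ^ J" .
      moreover have "\<bar>v t (L (Suc c))\<bar> \<le> \<bar>e (L (Suc c))\<bar> + \<rho>"
        using v_dev[OF LS[OF c], of t] by linarith
      ultimately have "\<bar>h t c\<bar> \<le> (1 + real J) ^ J * (\<bar>\<kappa> (Suc c)\<bar> * (\<bar>e (L (Suc c))\<bar> + \<rho>))"
        unfolding h_def abs_mult power_abs by (intro mult_mono mult_left_mono) auto
      also have "\<dots> \<le> (\<Sum>c<n. (1 + real J) ^ J * (\<bar>\<kappa> (Suc c)\<bar> * (\<bar>e (L (Suc c))\<bar> + \<rho>)))"
        using c sb by (intro member_le_sum[of c "{..<n}" "\<lambda>c. (1 + real J) ^ J * (\<bar>\<kappa> (Suc c)\<bar> * (\<bar>e (L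
            (Suc c))\<bar> + \<rho>))"]) auto
      finally show ?thesis using ib by (simp add: Cb_def)
    qed
    have h_reg: "regular_input (\<lambda>t. h t c)" if c: "c < n" for c
    proof -
      have "continuous_on UNIV (first_path v \<circ> clamp)"
      proof (rule continuous_on_compose)
        show "continuous_on UNIV clamp" unfolding clamp_def by (intro continuous_intros)
        show "continuous_on (range clamp) (first_path v)"
          using first_path_continuous[OF C, of 0 T] by (rule continuous_on_subset) (use clamp in auto)
      qed
      then have "isCont (\<lambda>t. first_path v (clamp t)) t" for t
        by (simp add: continuous_on_eq_continuous_at o_def)
      then have "{t. \<not> isCont (\<lambda>t. h t c) t} \<subseteq> {t. \<not> isCont (\<lambda>t. v t (L (Suc c))) t}"
        unfolding h_def by (auto intro!: continuous_intros)
      then have "finite {t. \<not> isCont (\<lambda>t. h t c) t}"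
        by (rule finite_subset) (use control_regular[OF C, of "L (Suc c)"] in \<open>simp add: regular_input_def\<close>)
      moreover have "bounded (range (\<lambda>t. h t c))"
        by (rule boundedI[of _ Cb]) (use h_le[OF c] in auto)
      ultimately show ?thesis by (simp add: regular_input_def)
    qed
    have tame_h: "tame_inputs n T Cb h" using h_le h_reg by (simp add: tame_inputs_def)
    have "tame_inputs n T (lifted.input_bound n \<rho>') (lifted.input v')"
      using lifted.input_tame(1)[OF lsys v'] \<rho>' by simp
    moreover have "lifted.input_bound n \<rho>' \<le> Cb"
      unfolding Cb_def using sb sum_nonneg[of "{..<n}" "\<lambda>c. (1 + real J) ^ J * (\<bar>\<kappa> (Suc c)\<bar> * (\<bar>e (L
          (Suc c))\<bar> + \<rho>))"] by simp
    ultimately have tame_h': "tame_inputs n T Cb (lifted.input v')"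
      unfolding tame_inputs_def by (meson order_trans)
    have cells: "integral {real i * \<tau>..real (Suc i) * \<tau>} (\<lambda>t. h t c)
        = integral {real i * \<tau>..real (Suc i) * \<tau>} (\<lambda>t. lifted.input v' t c)" if i: "i < N"
            and c: "c < n" for i c
    proof -
      have "real (Suc i) * \<tau> \<le> real N * \<tau>" using i N(2) by (intro mult_right_mono) auto
      then have "real (Suc i) * \<tau> \<le> T" unfolding N(3) .
      moreover have "0 \<le> real i * \<tau>" using N(2) by simp
      ultimately have inT: "t \<in> {0..T}" if "t \<in> {real i * \<tau>..real (Suc i) * \<tau>}" for t
        using that by (meson atLeastAtMost_iff order_trans)
      have "integral {real i * \<tau>..real (Suc i) * \<tau>} (\<lambda>t. h t c)
          = integral {real i * \<tau>..real (Suc i) * \<tau>} (\<lambda>t. \<kappa> (Suc c) * (first_path v t ^ m (Suc c) 0 * v t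
              (L (Suc c))))"
        by (rule Henstock_Kurzweil_Integration.integral_cong) (use inT clamp(2) in \<open>simp add: h_def\<close>)
      also have "\<dots> = \<kappa> (Suc c) * (\<tau> * w i (m (Suc c) 0 # L (Suc c)))"
        using v_cells[OF i J[OF c] LF[OF c]] by simp
      also have "\<dots> = integral {real i * \<tau>..real (Suc i) * \<tau>} (\<lambda>t. lifted.input v' t c)"
        using N(2) by (simp add: w_def lifted.input_def)
      finally show ?thesis .
    qed
    have close: "\<bar>flow m (input v) (\<lambda>_. 0) T (Suc c) - ?q c\<bar> \<le> \<epsilon>" if c: "c < n" for c
    proof -
      have "flow m (input v) (\<lambda>_. 0) T (Suc c) = flow ?m h (\<lambda>_. 0) T c"
        unfolding flow_Suc first_path_eq using c T clamp(2)
        by (intro flow_cong[of n _ _ T]) (auto simp: h_def input_def)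
      moreover have "\<bar>flow ?m h (\<lambda>_. 0) T c - flow ?m (lifted.input v') (\<lambda>_. 0) T c\<bar> \<le> K * (T / real N)"
        using cells T c N(1) tame_h tame_h' unfolding \<tau>_def by (intro avg[rule_format]) auto
      ultimately show ?thesis using small v'_end[OF c] by (simp add: \<tau>_def)
    qed
    have "\<bar>flow m (input v) (\<lambda>_. 0) T c\<bar> \<le> \<epsilon>" if c: "c < n" for c
    proof (cases c)
      case 0
      then show ?thesis using path_T \<epsilon> by (simp add: first_path_eq)
    next
      case (Suc c')
      then show ?thesis using close[of c'] c by (auto split: if_splits)
    qed
    moreover have "\<bar>flow m (input v) (\<lambda>_. 0) T n - \<sigma> * \<delta>\<bar> \<le> \<epsilon>"
      using close[of "n - 1"] n by simp
    moreover have "steers (Suc n) C T (\<lambda>_. 0) (flow m (input v) (\<lambda>_. 0) T)"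
      using C by (auto simp: steers_def)
    ultimately show ?thesis by blast
  qed
  with \<delta> show ?thesis by blast
qed

end

text \<open>
  The induction generalizes the whole system: the eliminated system has new letters,
  reference values and tolerance.
\<close>

lemma controllable_of_parity:
  assumes "control_system.parity_condition m L \<kappa> good drift e \<rho> n"
  shows "control_system.controllable m L \<kappa> good drift e \<rho> n"
  using assms
proof (induction n arbitrary: m L \<kappa> good drift e \<rho>)
  case 0
  interpret control_system m L \<kappa> good drift e \<rho> .
  show ?case
    using control_rest[OF 0] by (auto simp: controllable_def steers_def)
next
  case (Suc n)
  interpret control_system m L \<kappa> good drift e \<rho> .
  show ?case
  proof (cases "n = 0")
    case True
    then show ?thesis using steers_one Suc.prems by (simp add: controllable_def)
  next
    case False
    have "parity_condition n"
      using Suc.prems unfolding parity_condition_def by (meson less_Suc_eq)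
    then have "controllable n" by (rule Suc.IH)
    moreover have "control_system.controllable (\<lambda>c j. m (Suc c) (Suc j)) (\<lambda>c. m (Suc c) 0 # L (Suc c))
      (\<lambda>c. \<kappa> (Suc c)) lifted_good (0 # drift) (lifted_e J) \<rho>' n" if "0 < \<rho>'" for J \<rho>'
      by (rule Suc.IH) (rule lifted_parity_condition[OF Suc.prems that])
    ultimately show ?thesis
      using False by (intro controllable_Suc[OF Suc.prems] approx_from_lifted[OF Suc.prems]) auto
  qed
qed

section \<open>Absolutely continuous functions\<close>

lemma abs_continuous_on_lipschitz:
  fixes f :: "real \<Rightarrow> real"
  assumes lip: "\<And>s t. \<lbrakk>0 \<le> s; s \<le> t; t \<le> T\<rbrakk> \<Longrightarrow> \<bar>f t - f s\<bar> \<le> M * (t - s)" and M: "0 \<le> M"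
  shows "abs_continuous_on {0..T} f"
  unfolding abs_continuous_on_def
proof (intro allI impI)
  fix \<epsilon> :: real assume \<epsilon>: "0 < \<epsilon>"
  have "(\<Sum>K\<in>\<D>. \<bar>f (Sup K) - f (Inf K)\<bar>) < \<epsilon>"
    if D: "\<D> division_of S" "S \<subseteq> {0..T}" "(\<Sum>K\<in>\<D>. Sup K - Inf K) < \<epsilon> / (M + 1)" for \<D> S
  proof -
    have "(\<Sum>K\<in>\<D>. \<bar>f (Sup K) - f (Inf K)\<bar>) \<le> (\<Sum>K\<in>\<D>. M * (Sup K - Inf K))"
    proof (rule sum_mono)
      fix K assume K: "K \<in> \<D>"
      then obtain a b where "K = cbox a b" "K \<noteq> {}"
        using division_ofD(3,4)[OF D(1)] by blast
      then have ab: "K = {a..b}" "a \<le> b" by auto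
      have "K \<subseteq> {0..T}" using division_ofD(2)[OF D(1) K] D(2) by blast
      then show "\<bar>f (Sup K) - f (Inf K)\<bar> \<le> M * (Sup K - Inf K)"
        using ab lip[of a b] by simp
    qed
    also have "\<dots> \<le> M * (\<epsilon> / (M + 1))"
      unfolding sum_distrib_left[symmetric] using D(3) M by (intro mult_left_mono) auto
    also have "\<dots> < \<epsilon>" using M \<epsilon> by (simp add: divide_less_eq algebra_simps)
    finally show ?thesis .
  qed
  moreover have "0 < \<epsilon> / (M + 1)" using \<epsilon> M by simp
  ultimately show "\<exists>\<delta>>0. \<forall>\<D> S. \<D> division_of S \<and> S \<subseteq> {0..T} \<and> (\<Sum>K\<in>\<D>. Sup K - Inf K) < \<delta> \<longrightarrow>
        (\<Sum>K\<in>\<D>. \<bar>f (Sup K) - f (Inf K)\<bar>) < \<epsilon>"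
    by blast
qed

lemma flow_abs_continuous:
  assumes h: "tame_inputs n T C h" and c: "c < n" and C: "0 \<le> C" and T: "0 \<le> T"
  shows "abs_continuous_on {0..T} (\<lambda>t. flow m h p t c)"
proof -
  define P where "P = (\<Sum>c<n. \<bar>p c\<bar>)"
  have "\<forall>c<n. \<bar>p c\<bar> \<le> P"
    unfolding P_def by (auto intro: member_le_sum[of _ "{..<n}" "\<lambda>c. \<bar>p c\<bar>"])
  then obtain K where K: "0 \<le> K" "\<And>t c. \<lbrakk>t \<in> {0..T}; c < n\<rbrakk> \<Longrightarrow> \<bar>flow m h p t c\<bar> \<le> K"
    using flow_bound[OF T C, of n P m] h by blast
  show ?thesis
  proof (rule abs_continuous_on_lipschitz)
    show "\<bar>flow m h p t c - flow m h p s c\<bar> \<le> (\<Prod>j<c. K ^ m c j) * C * (t - s)"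
      if "0 \<le> s" "s \<le> t" "t \<le> T" for s t
      using that K(2) c by (intro flow_lipschitz[OF h c _ C]) auto
    show "0 \<le> (\<Prod>j<c. K ^ m c j) * C"
      using K(1) C by (intro mult_nonneg_nonneg prod_nonneg) auto
  qed
qed

lemma abs_continuous_on_diff:
  assumes "abs_continuous_on I f" "abs_continuous_on I g"
  shows "abs_continuous_on I (\<lambda>t. f t - g t)"
  unfolding abs_continuous_on_def
proof (intro allI impI)
  fix \<epsilon> :: real assume \<epsilon>: "0 < \<epsilon>"
  then have "0 < \<epsilon> / 2" by simp
  obtain d1 where d1: "0 < d1" "\<And>\<D> S. \<lbrakk>\<D> division_of S; S \<subseteq> I; (\<Sum>K\<in>\<D>. Sup K - Inf K) < d1\<rbrakk> \<Longrightarrow>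
        (\<Sum>K\<in>\<D>. \<bar>f (Sup K) - f (Inf K)\<bar>) < \<epsilon> / 2"
    using assms(1) \<open>0 < \<epsilon> / 2\<close> unfolding abs_continuous_on_def by meson
  obtain d2 where d2: "0 < d2" "\<And>\<D> S. \<lbrakk>\<D> division_of S; S \<subseteq> I; (\<Sum>K\<in>\<D>. Sup K - Inf K) < d2\<rbrakk> \<Longrightarrow>
        (\<Sum>K\<in>\<D>. \<bar>g (Sup K) - g (Inf K)\<bar>) < \<epsilon> / 2"
    using assms(2) \<open>0 < \<epsilon> / 2\<close> unfolding abs_continuous_on_def by meson
  have "(\<Sum>K\<in>\<D>. \<bar>f (Sup K) - g (Sup K) - (f (Inf K) - g (Inf K))\<bar>) < \<epsilon>"
    if D: "\<D> division_of S" "S \<subseteq> I" "(\<Sum>K\<in>\<D>. Sup K - Inf K) < min d1 d2" for \<D> S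
  proof -
    have "(\<Sum>K\<in>\<D>. \<bar>f (Sup K) - g (Sup K) - (f (Inf K) - g (Inf K))\<bar>)
        \<le> (\<Sum>K\<in>\<D>. \<bar>f (Sup K) - f (Inf K)\<bar> + \<bar>g (Sup K) - g (Inf K)\<bar>)"
      by (intro sum_mono) linarith
    also have "\<dots> < \<epsilon> / 2 + \<epsilon> / 2"
      unfolding sum.distrib using d1(2)[OF D(1,2)] d2(2)[OF D(1,2)] D(3) by (intro add_strict_mono) auto
    finally show ?thesis by simp
  qed
  then show "\<exists>\<delta>>0. \<forall>\<D> S. \<D> division_of S \<and> S \<subseteq> I \<and> (\<Sum>K\<in>\<D>. Sup K - Inf K) < \<delta> \<longrightarrow>
        (\<Sum>K\<in>\<D>. \<bar>f (Sup K) - g (Sup K) - (f (Inf K) - g (Inf K))\<bar>) < \<epsilon>"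
    using d1(1) d2(1) by (intro exI[of _ "min d1 d2"]) auto
qed

lemma division_length_le:
  fixes \<D> :: "real set set"
  assumes D: "\<D> division_of S" and "S \<subseteq> U" "U \<in> sets lebesgue" "emeasure lebesgue U < ennreal \<delta>"
  shows "(\<Sum>K\<in>\<D>. Sup K - Inf K) < \<delta>"
proof -
  have len: "Sup K - Inf K = measure lborel K" "K
      \<in> lmeasurable" "((\<lambda>x. 1::real) has_integral measure lborel K) K" if K: "K \<in> \<D>" for K
  proof -
    obtain a b where "K = cbox a b" "K \<noteq> {}"
      using division_ofD(3,4)[OF D K] by blast
    then have "K = {a..b}" "a \<le> b" by auto
    then show "Sup K - Inf K = measure lborel K" "K
        \<in> lmeasurable" "((\<lambda>x. 1::real) has_integral measure lborel K) K"
      using has_integral_const_real[of "1::real" a b] by (auto simp: lmeasurable_interval)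
  qed
  have S: "S \<in> lmeasurable"
    using D len(2) fmeasurable.finite_Union[of \<D> lebesgue] by (auto simp: division_of_def)
  have "((\<lambda>x. 1::real) has_integral (\<Sum>K\<in>\<D>. measure lborel K)) S"
    by (rule has_integral_combine_division[OF D len(3)])
  then have "measure lebesgue S = (\<Sum>K\<in>\<D>. Sup K - Inf K)"
    using lmeasure_integral[OF S] len(1) by (simp add: integral_unique)
  moreover have "ennreal (measure lebesgue S) < ennreal \<delta>"
    using emeasure_mono[OF assms(2,3)] assms(4) S by (simp flip: emeasure_eq_measure2)
  then have "measure lebesgue S < \<delta>" by (simp add: ennreal_less_iff)
  ultimately show ?thesis by simp
qed

text \<open>
  Take a tagged division that is fine for a gauge chosen as follows. At points with derivative 0,
  the increments over intervals of the division are at most \<open>\<eta>\<close> times their lengths. The remaining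
  points, together with 0 and T, form a null set N, covered by an open set U of small measure; the
  intervals with tags in N lie in U, so absolute continuity makes the sum of their increments small.
\<close>

lemma abs_continuous_zero_derivative:
  fixes f :: "real \<Rightarrow> real"
  assumes ac: "abs_continuous_on {0..T} f"
    and deriv: "AE t in lebesgue_on {0<..<T}. (f has_real_derivative 0) (at t)"
    and t: "t \<in> {0..T}"
  shows "f t = f 0"
proof -
  have "AE s in lebesgue. s \<in> {0<..<T} \<longrightarrow> (f has_real_derivative 0) (at s)"
    using deriv by (subst (asm) AE_restrict_space_iff) auto
  then obtain N0 where N0: "N0 \<in> null_sets lebesgue"
    "{s \<in> space lebesgue. \<not> (s \<in> {0<..<T} \<longrightarrow> (f has_real_derivative 0) (at s))} \<subseteq> N0"
    unfolding eventually_ae_filter by blast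
  define N where "N = N0 \<union> {0, T}"
  have "{0, T} \<in> null_sets lebesgue"
    by (simp flip: negligible_iff_null_sets)
  then have N: "N \<in> null_sets lebesgue"
    unfolding N_def using N0(1) by (rule null_sets.Un[rotated])
  have off_N: "(f has_real_derivative 0) (at s)" if "s \<in> {0..T} - N" for s
    using that N0(2) by (auto simp: N_def less_le)
  have "\<bar>f t - f 0\<bar> \<le> \<epsilon>" if \<epsilon>: "0 < \<epsilon>" for \<epsilon>
  proof -
    \<comment> \<open>the increments with tags outside the null set sum to at most \<open>\<eta> * t\<close>\<close>
    define \<eta> where "\<eta> = \<epsilon> / (2 * (t + 1))"
    have \<eta>: "0 < \<eta>" "\<eta> * t \<le> \<epsilon> / 2"
      using \<epsilon> t by (auto simp: \<eta>_def field_simps)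
    obtain \<delta> where \<delta>: "0 < \<delta>" and small: "\<And>\<D> S. \<lbrakk>\<D> division_of S; S \<subseteq> {0..T}; (\<Sum>K\<in>\<D>. Sup K - Inf K) < \<delta>\<rbrakk> \<Longrightarrow>
        (\<Sum>K\<in>\<D>. \<bar>f (Sup K) - f (Inf K)\<bar>) < \<epsilon> / 2"
      using ac \<epsilon> unfolding abs_continuous_on_def by (meson half_gt_zero)
    obtain U where U: "open U" "N \<subseteq> U" "emeasure lebesgue (U - N) < ennreal \<delta>"
      using sets_lebesgue_outer_open[OF null_setsD2[OF N] \<delta>] by blast
    have "emeasure lebesgue U = emeasure lebesgue (U - N)"
      using U(1) N by (intro emeasure_Diff_null_set[symmetric]) auto
    then have eU: "emeasure lebesgue U < ennreal \<delta>" "U \<in> sets lebesgue" using U by auto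
    have "\<exists>d>0. (s \<in> N \<longrightarrow> ball s d \<subseteq> U) \<and>
        (s \<in> {0..T} - N \<longrightarrow> (\<forall>r. \<bar>r - s\<bar> < d \<longrightarrow> \<bar>f r - f s\<bar> \<le> \<eta> * \<bar>r - s\<bar>))" for s
    proof (cases "s \<in> {0..T} - N")
      case True
      from off_N[OF this] have "(f has_derivative (\<lambda>h. 0 * h)) (at s)"
        by (simp only: has_field_derivative_def)
      then have "\<forall>c>0. \<exists>d>0. \<forall>r. norm (r - s) < d \<longrightarrow> norm (f r - f s - 0 * (r - s)) \<le> c * norm (r - s)"
        unfolding has_derivative_at_alt by (rule conjunct2)
      then obtain d where "0 < d" "\<And>r. norm (r - s) < d \<Longrightarrow> norm (f r - f s - 0 * (r - s)) \<le> \<eta> * norm (r - s)"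
        using \<eta>(1) by blast
      then show ?thesis using True by auto
    next
      case False
      show ?thesis
      proof (cases "s \<in> N")
        case True
        then obtain d where "0 < d" "ball s d \<subseteq> U" using U openE by blast
        with False show ?thesis by blast
      qed (use False in \<open>auto intro: exI[of _ 1]\<close>)
    qed
    then have "\<exists>d. \<forall>s. d s > 0 \<and> (s \<in> N \<longrightarrow> ball s (d s) \<subseteq> U) \<and>
        (s \<in> {0..T} - N \<longrightarrow> (\<forall>r. \<bar>r - s\<bar> < d s \<longrightarrow> \<bar>f r - f s\<bar> \<le> \<eta> * \<bar>r - s\<bar>))"
      by (intro choice allI)
    then obtain d where d: "\<And>s. 0 < d s" "\<And>s. s \<in> N \<Longrightarrow> ball s (d s) \<subseteq> U"
      "\<And>s r. \<lbrakk>s \<in> {0..T} - N; \<bar>r - s\<bar> < d s\<rbrakk> \<Longrightarrow> \<bar>f r - f s\<bar> \<le> \<eta> * \<bar>r - s\<bar>"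
      by blast
    have "gauge (\<lambda>s. ball s (d s))" using d(1) by (rule gauge_ball_dependent[rule_format])
    then obtain p where p: "p tagged_division_of {0..t}" "(\<lambda>s. ball s (d s)) fine p"
      by (rule fine_division_exists_real)
    have fin: "finite p" using p(1) by auto
    let ?v = "\<lambda>K. f (Sup K) - f (Inf K)"
    define p1 where "p1 = {(s, K) \<in> p. s \<in> N}"
    define p2 where "p2 = p - p1"
    have p1_sub: "p1 \<subseteq> p" by (auto simp: p1_def)
    have elt: "\<exists>a b. K = {a..b} \<and> a \<le> s \<and> s \<le> b \<and> {a..b} \<subseteq> {0..t} \<and> {a..b} \<subseteq> ball s (d s)"
        if sK: "(s, K) \<in> p" for s K
    proof -
      obtain a b where "K = cbox a b" using tagged_division_ofD(4)[OF p(1) sK] by blast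
      then have "K = {a..b}" by simp
      moreover have "s \<in> K" "K \<subseteq> {0..t}"
        using tagged_division_ofD(2,3)[OF p(1) sK] by auto
      moreover have "K \<subseteq> ball s (d s)" using fineD[OF p(2) sK] .
      ultimately show ?thesis by auto
    qed
    have "f t - f 0 = (\<Sum>(s, K)\<in>p. ?v K)"
      using additive_tagged_division_1[OF _ p(1), of f] t by simp
    also have "\<dots> = (\<Sum>(s, K)\<in>p1. ?v K) + (\<Sum>(s, K)\<in>p2. ?v K)"
      unfolding p2_def using sum.subset_diff[OF p1_sub fin] by (simp add: add.commute)
    finally have split: "f t - f 0 = (\<Sum>(s, K)\<in>p1. ?v K) + (\<Sum>(s, K)\<in>p2. ?v K)" .
    have "\<bar>\<Sum>(s, K)\<in>p2. ?v K\<bar> \<le> (\<Sum>(s, K)\<in>p2. \<eta> * measure lborel K)"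
    proof (rule sum_abs[THEN order_trans], rule sum_mono)
      fix sK assume sK: "sK \<in> p2"
      obtain s K where [simp]: "sK = (s, K)" by fastforce
      have "(s, K) \<in> p" "s \<notin> N" using sK by (auto simp: p1_def p2_def)
      then obtain a b where ab: "K = {a..b}" "a \<le> s" "s \<le> b" "{a..b} \<subseteq> {0..t}" "{a..b} \<subseteq> ball s (d s)"
        using elt by blast
      have "s \<in> {0..T} - N" using ab t \<open>s \<notin> N\<close> by auto
      moreover have "a \<in> ball s (d s)" "b \<in> ball s (d s)"
        using ab(2,3) by (intro subsetD[OF ab(5)]; simp)+
      then have "\<bar>a - s\<bar> < d s" "\<bar>b - s\<bar> < d s" by (auto simp: dist_real_def)
      ultimately have "\<bar>f a - f s\<bar> \<le> \<eta> * (s - a)" "\<bar>f b - f s\<bar> \<le> \<eta> * (b - s)"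
        using d(3)[of s a] d(3)[of s b] ab(2,3) by auto
      then have "\<bar>f b - f a\<bar> \<le> \<eta> * (s - a) + \<eta> * (b - s)" by linarith
      then have "\<bar>f b - f a\<bar> \<le> \<eta> * (b - a)" by (simp add: algebra_simps)
      then show "\<bar>case sK of (s, K) \<Rightarrow> ?v K\<bar> \<le> (case sK of (s, K) \<Rightarrow> \<eta> * measure lborel K)"
        using ab by simp
    qed
    also have "\<dots> \<le> (\<Sum>(s, K)\<in>p. \<eta> * measure lborel K)"
      using fin \<eta> by (intro sum_mono2) (auto simp: p2_def)
    also have "\<dots> = \<eta> * (\<Sum>(s, K)\<in>p. measure lborel K)"
      by (simp add: sum_distrib_left case_prod_unfold)
    also have "\<dots> = \<eta> * t"
      using additive_content_tagged_division[of p 0 t] p(1) t by simp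
    finally have b2: "\<bar>\<Sum>(s, K)\<in>p2. ?v K\<bar> \<le> \<epsilon> / 2" using \<eta> by simp
    have "p tagged_partial_division_of {0..t}"
      using p(1) by (simp add: tagged_division_of_def)
    then have part: "p1 tagged_partial_division_of {0..t}"
      by (rule tagged_partial_division_subset[OF _ p1_sub])
    have div: "snd ` p1 division_of \<Union>(snd ` p1)"
      by (rule partial_division_of_tagged_division[OF part])
    have p1_in: "K \<subseteq> {0..T} \<inter> U" if K: "K \<in> snd ` p1" for K
    proof -
      obtain s where "(s, K) \<in> p" "s \<in> N" using K by (auto simp: p1_def)
      then have "K \<subseteq> {0..t}" "K \<subseteq> ball s (d s)" "ball s (d s) \<subseteq> U"
        using elt[of s K] d(2)[of s] by auto
      then show ?thesis using t by fastforce
    qed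
    have "(\<Sum>K\<in>snd ` p1. \<bar>?v K\<bar>) < \<epsilon> / 2"
    proof (rule small[OF div])
      show "\<Union>(snd ` p1) \<subseteq> {0..T}" using p1_in by blast
      have "\<Union>(snd ` p1) \<subseteq> U" using p1_in by blast
      from division_length_le[OF div this eU(2,1)]
      show "(\<Sum>K\<in>snd ` p1. Sup K - Inf K) < \<delta>" .
    qed
    moreover have "(\<Sum>(s, K)\<in>p1. \<bar>?v K\<bar>) = (\<Sum>K\<in>snd ` p1. \<bar>?v K\<bar>)"
    proof -
      \<comment> \<open>set to 0 at the empty set, where Sup and Inf are unspecified; the degenerate intervals, which
        several tags may share, contribute 0 anyway\<close>
      let ?g = "\<lambda>K. if K = {} then 0 else \<bar>?v K\<bar>"
      have ne: "K \<noteq> {}" if "(s, K) \<in> p1" for s K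
        using elt[of s K] that by (auto simp: p1_def)
      have "(\<Sum>(s, K)\<in>p1. \<bar>?v K\<bar>) = (\<Sum>(s, K)\<in>p1. ?g K)"
        using ne by (intro sum.cong) auto
      also have "\<dots> = (\<Sum>K\<in>snd ` p1. ?g K)"
      proof (rule sum.over_tagged_division_lemma[OF tagged_partial_division_of_Union_self[OF part]])
        fix u v :: real assume "box u v = {}"
        then have "cbox u v = {} \<or> cbox u v = {u}" by (auto simp: box_eq_empty)
        then show "?g (cbox u v) = 0" by auto
      qed
      also have "\<dots> = (\<Sum>K\<in>snd ` p1. \<bar>?v K\<bar>)"
        using ne by (intro sum.cong) auto
      finally show ?thesis .
    qed
    moreover have "\<bar>\<Sum>(s, K)\<in>p1. ?v K\<bar> \<le> (\<Sum>(s, K)\<in>p1. \<bar>?v K\<bar>)"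
      by (rule sum_abs[THEN order_trans]) (simp add: case_prod_unfold)
    ultimately show "\<bar>f t - f 0\<bar> \<le> \<epsilon>" using split b2 by linarith
  qed
  then have "\<bar>f t - f 0\<bar> \<le> 0" by (rule field_le_epsilon[of _ 0, simplified])
  then show ?thesis by simp
qed

section \<open>Factorizations in Hall sets\<close>

definition ad_fold :: "'x \<Rightarrow> ('x br \<times> nat) list \<Rightarrow> 'x br" where
  "ad_fold x ams = fold (\<lambda>(a, m). ad a ^^ m) ams (Gen x)"

lemma Hall_setD:
  assumes "Hall_set X B lt"
  shows "B \<subseteq> Br X" "irreflp_on B lt" "transp_on B lt" "totalp_on B lt"
  using assms by (simp_all add: Hall_set_def)

lemma Hall_set_PrdD:
  assumes "Hall_set X B lt" "Prd a b \<in> B"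
  shows "a \<in> B" "b \<in> B" "lt a b" "lt a (Prd a b)"
    "b \<in> Gen ` X \<or> (\<exists>b' b''. b = Prd b' b'' \<and> (lt b' a \<or> b' = a))"
proof -
  have "Prd a b \<in> Br X" using Hall_setD(1)[OF assms(1)] assms(2) by blast
  then have "a \<in> Br X" "b \<in> Br X" by (auto simp: Br_def)
  then have *: "a \<in> B \<and> b \<in> B \<and> lt a b \<and> (b \<in> Gen ` X \<or> (\<exists>b' b''. b = Prd b' b'' \<and> (lt b' a \<or> b' = a)))"
    using assms unfolding Hall_set_def by blast
  then show "a \<in> B" "b \<in> B" "lt a b" "b \<in> Gen ` X \<or> (\<exists>b' b''. b = Prd b' b'' \<and> (lt b' a \<or> b' = a))"
    by auto
  show "lt a (Prd a b)"
    using * assms unfolding Hall_set_def by blast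
qed

lemma Hall_trans:
  assumes "Hall_set X B lt" "a \<in> B" "b \<in> B" "c \<in> B" "lt a b" "lt b c"
  shows "lt a c"
  using transp_onD[OF Hall_setD(3)[OF assms(1)]] assms by blast

lemma Hall_irrefl:
  assumes "Hall_set X B lt" "a \<in> B"
  shows "\<not> lt a a"
  using irreflp_onD[OF Hall_setD(2)[OF assms(1)]] assms by blast

lemma Hall_total:
  assumes "Hall_set X B lt" "a \<in> B" "b \<in> B" "a \<noteq> b"
  shows "lt a b \<or> lt b a"
  using totalp_onD[OF Hall_setD(4)[OF assms(1)]] assms by blast

lemma is_factorization_ad_fold: "is_factorization b (x, ams) \<Longrightarrow> b = ad_fold x ams"
  by (simp add: is_factorization_def ad_fold_def)

lemma ad_fold_snoc: "ad_fold x (ams @ [(a, m)]) = (ad a ^^ m) (ad_fold x ams)"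
  by (simp add: ad_fold_def)

text \<open>
  Induction on the bracket. The last clause says that each truncated factorization is a Hall element
  and lies above the factor that is applied to it next; it is the source of prefix-freeness.
\<close>

lemma Hall_factorization:
  assumes H: "Hall_set X B lt" and "b \<in> B" and "is_factorization b (x, ams)"
  shows "sorted_wrt lt (map fst ams) \<and> (\<forall>a \<in> fst ` set ams. a \<in> B \<and> lt a b) \<and>
    (\<forall>k<length ams. ad_fold x (take k ams) \<in> B \<and> lt (fst (ams ! k)) (ad_fold x (take k ams)))"
  using assms(2,3)
proof (induction b arbitrary: ams)
  case (Gen y)
  then show ?case by (simp add: is_factorization_Gen_iff)
next
  case (Prd a b)
  note hall = Hall_set_PrdD[OF H Prd.prems(1)]
  from Prd.prems(2) show ?case
  proof (cases rule: is_factorization_PrdE)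
    case (grow l m)
    note IH = Prd.IH(2)[OF hall(2) grow(3)]
    have below: "a' \<in> B \<and> lt a' (Prd a b)" if "a' \<in> fst ` set l" for a'
    proof -
      have "lt a' a" "a' \<in> B" using IH that by (auto simp: sorted_wrt_append)
      then show ?thesis using Hall_trans[OF H _ hall(1) Prd.prems(1) _ hall(4)] by blast
    qed
    have "ad_fold x (take k ams) \<in> B \<and> lt (fst (ams ! k)) (ad_fold x (take k ams))" if "k < length ams"
        for k
    proof -
      have "k < length (l @ [(a, m)])" using that grow(1) by simp
      moreover have "take k ams = take k (l @ [(a, m)])" "fst (ams ! k) = fst ((l @ [(a, m)]) ! k)"
        using that grow(1) by (auto simp: nth_append less_Suc_eq)
      ultimately show ?thesis using IH by metis
    qed
    moreover have "sorted_wrt lt (map fst ams)" using IH grow(1) by simp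
    ultimately show ?thesis using below hall grow(1) by auto
  next
    case (new l)
    note IH = Prd.IH(2)[OF hall(2) new(2)]
    have last: "lt (fst (last l)) a" if ne: "l \<noteq> []"
    proof -
      obtain l' a' m' where l: "l = l' @ [(a', m')]"
        using ne by (metis rev_exhaust surj_pair)
      with new(2) obtain k where "m' = Suc k"
        by (cases m') (auto simp: is_factorization_def)
      then have b: "b = Prd a' ((ad a' ^^ k) (ad_fold x l'))"
        using is_factorization_ad_fold[OF new(2)] l by (simp add: ad_fold_snoc ad_def)
      then have "lt a' a \<or> a' = a" using hall(5) by auto
      then show ?thesis using new(3) l by auto
    qed
    have lt_a: "a' \<in> B \<and> lt a' a" if "a' \<in> fst ` set l" for a'
    proof -
      have "l \<noteq> []" using that by auto
      then obtain l' p where l: "l = l' @ [p]" by (metis rev_exhaust)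
      have "a' \<in> B" using IH that by auto
      show ?thesis
      proof (cases "a' = fst p")
        case True
        then show ?thesis using last l \<open>a' \<in> B\<close> by auto
      next
        case False
        then have "lt a' (fst p)" "fst p \<in> B" using IH that l by (auto simp: sorted_wrt_append)
        moreover have "lt (fst p) a" using last l by auto
        ultimately show ?thesis
          using Hall_trans[OF H \<open>a' \<in> B\<close> _ hall(1)] \<open>a' \<in> B\<close> by blast
      qed
    qed
    have below: "a' \<in> B \<and> lt a' (Prd a b)" if "a' \<in> fst ` set l" for a'
      using lt_a[OF that] Hall_trans[OF H _ hall(1) Prd.prems(1) _ hall(4)] by blast
    have "ad_fold x (take k ams) \<in> B \<and> lt (fst (ams ! k)) (ad_fold x (take k ams))" if "k < length ams"
        for k
    proof (cases "k < length l")
      case True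
      then show ?thesis using IH new(1) by (auto simp: nth_append)
    next
      case False
      then have "k = length l" using that new(1) by simp
      then show ?thesis
        using new(1) hall is_factorization_ad_fold[OF new(2)] by (auto simp: nth_append)
    qed
    moreover have "sorted_wrt lt (map fst ams)"
      using IH new(1) lt_a by (auto simp: sorted_wrt_append)
    ultimately show ?thesis using below hall new(1) by auto
  qed
qed

lemma is_factorization_seed_factors: "is_factorization b (seed b, factors b)"
  using is_factorization_factorization[of b] by (simp add: seed_def factors_def)

lemma ad_fold_seed_factors: "ad_fold (seed b) (factors b) = b"
  by (rule is_factorization_ad_fold[OF is_factorization_seed_factors, symmetric])

definition mult_of :: "'x br \<Rightarrow> 'x br \<Rightarrow> nat" where
  "mult_of b a = (case map_of (factors b) a of None \<Rightarrow> 0 | Some m \<Rightarrow> m)"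

lemma sorted_wrt_same_set:
  assumes "sorted_wrt R xs" "sorted_wrt R ys" "set xs = set ys"
    and "\<And>x y. \<lbrakk>x \<in> set xs; y \<in> set xs; R x y\<rbrakk> \<Longrightarrow> \<not> R y x"
  shows "xs = ys"
  using assms
proof (induction xs arbitrary: ys)
  case (Cons x xs)
  obtain y ys' where ys: "ys = y # ys'" using Cons.prems(3) by (cases ys) auto
  have "x = y"
  proof (rule ccontr)
    assume "x \<noteq> y"
    then have "x \<in> set ys'" "y \<in> set xs" using Cons.prems(3) ys by auto
    then show False using Cons.prems ys by auto
  qed
  moreover have "\<not> R z z" if "z \<in> set (x # xs)" for z
    using Cons.prems(4)[OF that that] by blast
  then have "x \<notin> set xs" "y \<notin> set ys'"
    using Cons.prems(1-3) ys by auto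
  ultimately have "set xs = set ys'" using Cons.prems(3) ys by auto
  moreover have "sorted_wrt R xs" "sorted_wrt R ys'" using Cons.prems ys by auto
  ultimately have "xs = ys'" using Cons.prems(4) by (intro Cons.IH) auto
  then show ?case using \<open>x = y\<close> ys by simp
qed simp

locale Hall_subset =
  fixes X :: "nat set" and B G :: "nat br set" and lt :: "nat br \<Rightarrow> nat br \<Rightarrow> bool"
  assumes Hall: "Hall_set X B lt" and GB: "G \<subseteq> B" and stable: "factor_stable G" and fin: "finite G"
begin

lemma asym: "\<lbrakk>a \<in> B; b \<in> B; lt a b\<rbrakk> \<Longrightarrow> \<not> lt b a"
  using Hall_trans[OF Hall] Hall_irrefl[OF Hall] by blast

lemma factors_facts:
  assumes "b \<in> G"
  shows "sorted_wrt lt (map fst (factors b))" "distinct (map fst (factors b))"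
    "\<And>a m. (a, m) \<in> set (factors b) \<Longrightarrow> a \<in> G \<and> lt a b \<and> 1 \<le> m"
    "\<And>k. k < length (factors b) \<Longrightarrow> lt (fst (factors b ! k)) (ad_fold (seed b) (take k (factors b)))"
proof -
  have b: "b \<in> B" using assms GB by blast
  note F = Hall_factorization[OF Hall b is_factorization_seed_factors]
  then show sorted: "sorted_wrt lt (map fst (factors b))"
    and "\<And>k. k < length (factors b) \<Longrightarrow> lt (fst (factors b ! k)) (ad_fold (seed b) (take k (factors b)))"
    by auto
  have irr: "distinct xs" if "sorted_wrt lt xs" "set xs \<subseteq> B" for xs
    using that Hall_irrefl[OF Hall] by (induction xs) auto
  have "set (map fst (factors b)) \<subseteq> B" using F by auto
  from irr[OF sorted this] show "distinct (map fst (factors b))" .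
  show "a \<in> G \<and> lt a b \<and> 1 \<le> m" if "(a, m) \<in> set (factors b)" for a m
  proof -
    have "a \<in> Fac b" unfolding Fac_def using that by force
    then have "a \<in> G" using stable assms by (auto simp: factor_stable_def)
    moreover have "lt a b" using F that by force
    moreover have "1 \<le> m" using is_factorization_seed_factors[of b] that by (auto simp:
        is_factorization_def)
    ultimately show ?thesis by blast
  qed
qed

lemma mult_of_factor:
  assumes "b \<in> G" "(a, m) \<in> set (factors b)"
  shows "mult_of b a = m"
  using map_of_is_SomeI[OF factors_facts(2)[OF assms(1)] assms(2)] by (simp add: mult_of_def)

lemma mult_of_pos_iff:
  assumes "b \<in> G"
  shows "0 < mult_of b a \<longleftrightarrow> (a, mult_of b a) \<in> set (factors b)"
proof
  assume "0 < mult_of b a"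
  then obtain m where "map_of (factors b) a = Some m"
    by (cases "map_of (factors b) a") (auto simp: mult_of_def)
  then show "(a, mult_of b a) \<in> set (factors b)"
    using map_of_SomeD[of "factors b" a m] by (simp add: mult_of_def)
next
  assume "(a, mult_of b a) \<in> set (factors b)"
  then show "0 < mult_of b a" using factors_facts(3)[OF assms] by fastforce
qed

text \<open>
  Under the hypotheses the factors of c below b are exactly the factors of b, so b is a truncated
  factorization of c. If it is all of c then b = c; otherwise the next factor of c lies below b, but
  the truncation was made at the first factor that does not lie below b.
\<close>

lemma prefix_free:
  assumes bc: "b \<in> G" "c \<in> G" "lt b c" and "seed c = seed b"
    and mult: "\<And>a. \<lbrakk>a \<in> G; lt a b\<rbrakk> \<Longrightarrow> mult_of c a = mult_of b a"
  shows False
proof -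
  define P where "P = takeWhile (\<lambda>p. lt (fst p) b) (factors c)"
  have B: "b \<in> B" "c \<in> B" using bc GB by auto
  have sortedc: "sorted_wrt (\<lambda>p q. lt (fst p) (fst q)) (factors c)"
    and sortedb: "sorted_wrt (\<lambda>p q. lt (fst p) (fst q)) (factors b)"
    using factors_facts(1)[OF bc(1)] factors_facts(1)[OF bc(2)] by (auto simp: sorted_wrt_map)
  have inB: "fst p \<in> B" if "p \<in> set (factors b) \<union> set (factors c)" for p
    using that factors_facts(3)[OF bc(1), of "fst p" "snd p"] factors_facts(3)[OF bc(2),
        of "fst p" "snd p"] GB by auto
  have P_iff: "p \<in> set P \<longleftrightarrow> p \<in> set (factors c) \<and> lt (fst p) b" for p
  proof
    assume "p \<in> set P"
    then show "p \<in> set (factors c) \<and> lt (fst p) b" unfolding P_def by (auto dest: set_takeWhileD)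
  next
    assume p: "p \<in> set (factors c) \<and> lt (fst p) b"
    have "factors c = P @ dropWhile (\<lambda>p. lt (fst p) b) (factors c)" by (simp add: P_def)
    moreover have "p \<notin> set (dropWhile (\<lambda>p. lt (fst p) b) (factors c))"
    proof
      assume in_drop: "p \<in> set (dropWhile (\<lambda>p. lt (fst p) b) (factors c))"
      then obtain q qs where q: "dropWhile (\<lambda>p. lt (fst p) b) (factors c) = q # qs"
        by (cases "dropWhile (\<lambda>p. lt (fst p) b) (factors c)") auto
      then have nq: "\<not> lt (fst q) b" by (metis hd_dropWhile list.sel(1) list.distinct(1))
      have "q \<in> set (factors c)" using q by (metis list.set_intros(1) set_dropWhileD)
      have "sorted_wrt (\<lambda>p q. lt (fst p) (fst q)) (q # qs)"
        using sortedc q by (metis sorted_wrt_dropWhile)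
      then have "p = q \<or> lt (fst q) (fst p)" using in_drop q by auto
      then show False
        using nq p Hall_trans[OF Hall inB[of q] inB[of p] B(1)] \<open>q \<in> set (factors c)\<close> by blast
    qed
    ultimately show "p \<in> set P" using p by (metis UnE set_append)
  qed
  have "set P = set (factors b)"
  proof (rule set_eqI)
    fix p :: "nat br \<times> nat"
    obtain a k where p: "p = (a, k)" by fastforce
    show "p \<in> set P \<longleftrightarrow> p \<in> set (factors b)"
    proof
      assume "p \<in> set P"
      then have *: "(a, k) \<in> set (factors c)" "lt a b" using P_iff[of p] p by auto
      then have "mult_of c a = k" "a \<in> G" "1 \<le> k"
        using mult_of_factor[OF bc(2)] factors_facts(3)[OF bc(2)] by auto
      then have "mult_of b a = k" using mult[of a] *(2) by simp
      then show "p \<in> set (factors b)" using mult_of_pos_iff[OF bc(1), of a] \<open>1 \<le> k\<close> p by simp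
    next
      assume "p \<in> set (factors b)"
      then have *: "(a, k) \<in> set (factors b)" using p by simp
      then have "mult_of b a = k" "a \<in> G" "lt a b" "1 \<le> k"
        using mult_of_factor[OF bc(1)] factors_facts(3)[OF bc(1)] by auto
      then have "mult_of c a = k" using mult[of a] by simp
      then have "(a, k) \<in> set (factors c)" using mult_of_pos_iff[OF bc(2), of a] \<open>1 \<le> k\<close> by simp
      then show "p \<in> set P" using P_iff[of p] p \<open>lt a b\<close> by simp
    qed
  qed
  then have "P = factors b"
    using sortedb sortedc inB asym unfolding P_def
    by (intro sorted_wrt_same_set[of "\<lambda>p q. lt (fst p) (fst q)"] sorted_wrt_takeWhile) (auto dest:
        set_takeWhileD)
  then have fold_P: "ad_fold (seed c) P = b" using assms(4) ad_fold_seed_factors[of b] by simp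
  show False
  proof (cases "length P < length (factors c)")
    case True
    then have "\<not> lt (fst (factors c ! length P)) b" unfolding P_def using nth_length_takeWhile by blast
    moreover have "take (length P) (factors c) = P" unfolding P_def by (metis takeWhile_eq_take)
    ultimately show False using factors_facts(4)[OF bc(2) True] fold_P by simp
  next
    case False
    then have "P = factors c"
      unfolding P_def by (metis length_takeWhile_le le_neq_implies_less takeWhile_eq_take take_all
          order_refl)
    then have "c = b" using fold_P ad_fold_seed_factors[of c] by simp
    then show False using bc(3) Hall_irrefl[OF Hall B(1)] by simp
  qed
qed

section \<open>The canonical system as a triangular system\<close>

text \<open>
  The position of b in the increasing enumeration of G.
\<close>

definition rank :: "nat br \<Rightarrow> nat" where
  "rank b = card {a \<in> G. lt a b}"

lemma rank_less:
  assumes "a \<in> G" "b \<in> G" "lt a b"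
  shows "rank a < rank b"
  unfolding rank_def
proof (rule psubset_card_mono)
  show "finite {c \<in> G. lt c b}" using fin by simp
  have "a \<in> {c \<in> G. lt c b}" "a \<notin> {c \<in> G. lt c a}"
    using assms Hall_irrefl[OF Hall] GB by auto
  moreover have "{c \<in> G. lt c a} \<subseteq> {c \<in> G. lt c b}"
    using assms Hall_trans[OF Hall] GB by blast
  ultimately show "{c \<in> G. lt c a} \<subset> {c \<in> G. lt c b}" by blast
qed

lemma rank_bij: "bij_betw rank G {..<card G}"
proof -
  have inj: "inj_on rank G"
  proof (rule inj_onI, rule ccontr)
    fix a b assume "a \<in> G" "b \<in> G" "rank a = rank b" "a \<noteq> b"
    then show False using Hall_total[OF Hall, of a b] rank_less[of a b] rank_less[of b a] GB by auto
  qed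
  have "rank ` G \<subseteq> {..<card G}"
  proof
    fix k assume "k \<in> rank ` G"
    then obtain b where b: "b \<in> G" "k = rank b" by blast
    have "{a \<in> G. lt a b} \<subset> G" using b Hall_irrefl[OF Hall] GB by blast
    then show "k \<in> {..<card G}" using b fin by (simp add: rank_def psubset_card_mono)
  qed
  then have "rank ` G = {..<card G}"
    using card_image[OF inj] by (intro card_subset_eq) auto
  with inj show ?thesis by (simp add: bij_betw_def)
qed

definition nth_br :: "nat \<Rightarrow> nat br" where
  "nth_br = the_inv_into G rank"

lemma nth_br: "k < card G \<Longrightarrow> nth_br k \<in> G" "k < card G \<Longrightarrow> rank (nth_br k) = k"
  using rank_bij the_inv_into_into[of rank G k] f_the_inv_into_f[of rank G k]
  by (auto simp: nth_br_def bij_betw_def)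

lemma nth_br_rank: "b \<in> G \<Longrightarrow> nth_br (rank b) = b"
  using rank_bij by (simp add: nth_br_def bij_betw_def the_inv_into_f_f)

lemma rank_lt_card: "b \<in> G \<Longrightarrow> rank b < card G"
  using rank_bij by (auto simp: bij_betw_def)

lemma lt_iff_rank:
  assumes "a \<in> G" "b \<in> G"
  shows "lt a b \<longleftrightarrow> rank a < rank b"
  using rank_less[OF assms] rank_less[OF assms(2,1)] Hall_total[OF Hall, of a b] assms GB
  by (metis nat_neq_iff order_less_asym' subsetD)

definition exponent :: "nat \<Rightarrow> nat \<Rightarrow> nat" where
  "exponent c j = mult_of (nth_br c) (nth_br j)"

definition letter_of :: "nat \<Rightarrow> letter" where
  "letter_of c = [seed (nth_br c)]"

definition coefficient :: "nat \<Rightarrow> real" where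
  "coefficient c = 1 / (\<Prod>j<c. fact (exponent c j))"

lemma canonical_rhs_nth_br:
  assumes c: "c < card G"
  shows "canonical_rhs x u (nth_br c) = coefficient c * (\<Prod>j<c. x (nth_br j) ^ exponent c j)
           * (if seed (nth_br c) = 0 then 1 else u (seed (nth_br c)))"
proof -
  let ?b = "nth_br c"
  let ?f = "\<lambda>a. x a ^ mult_of ?b a / fact (mult_of ?b a)"
  have b: "?b \<in> G" using nth_br(1)[OF c] .
  have dist: "distinct (map fst (factors ?b))" by (rule factors_facts(2)[OF b])
  have "(\<Prod>(a, m)\<leftarrow>factors ?b. x a ^ m / fact m) = (\<Prod>a\<leftarrow>map fst (factors ?b). ?f a)"
    unfolding map_map using mult_of_factor[OF b]
    by (intro arg_cong[where f = prod_list] map_cong) auto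
  also have "\<dots> = (\<Prod>a\<in>Fac ?b. ?f a)"
    using prod.distinct_set_conv_list[OF dist, of ?f] by (simp add: Fac_def)
  also have "\<dots> = (\<Prod>a\<in>nth_br ` {..<c}. ?f a)"
  proof (rule prod.mono_neutral_left)
    show "Fac ?b \<subseteq> nth_br ` {..<c}"
    proof
      fix a assume "a \<in> Fac ?b"
      then obtain k where "(a, k) \<in> set (factors ?b)" by (auto simp: Fac_def)
      then have "a \<in> G" "lt a ?b" using factors_facts(3)[OF b] by auto
      then have "rank a < c" using lt_iff_rank[of a ?b] b nth_br(2)[OF c] by simp
      then show "a \<in> nth_br ` {..<c}" using nth_br_rank[OF \<open>a \<in> G\<close>] by (metis imageI lessThan_iff)
    qed
    show "\<forall>a\<in>nth_br ` {..<c} - Fac ?b. ?f a = 1"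
    proof
      fix a assume "a \<in> nth_br ` {..<c} - Fac ?b"
      then have "mult_of ?b a = 0" using mult_of_pos_iff[OF b, of a] by (force simp: Fac_def)
      then show "?f a = 1" by simp
    qed
  qed simp
  also have "\<dots> = (\<Prod>j<c. ?f (nth_br j))"
  proof (rule prod.reindex_cong[of nth_br])
    show "inj_on nth_br {..<c}"
      using c nth_br(2) by (intro inj_on_inverseI[of _ rank]) auto
  qed auto
  also have "\<dots> = coefficient c * (\<Prod>j<c. x (nth_br j) ^ exponent c j)"
    by (simp add: prod_dividef coefficient_def exponent_def)
  finally show ?thesis by (simp add: canonical_rhs_def)
qed

end

section \<open>Small-time global controllability\<close>

lemma AE_not_finite:
  assumes "finite D"
  shows "AE t in lebesgue_on {0<..<T::real}. t \<in> {0<..<T} - D"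
proof -
  have "D \<in> null_sets lebesgue"
    using assms negligible_finite negligible_iff_null_sets by blast
  then have "AE t in lebesgue. t \<notin> D" by (rule AE_not_in)
  then show ?thesis by (subst AE_restrict_space_iff) auto
qed

theorem theorem3p1:
  fixes q :: nat
    and B Bgood Bbad G :: "nat br set"
    and lt :: "nat br \<Rightarrow> nat br \<Rightarrow> bool"
  assumes "1 \<le> q"
    and "factor_parity_Hall_set {1..q} {0} B lt Bgood Bbad"
    and "finite G" and "G \<subseteq> Bgood" and "factor_stable G"
  shows "\<forall>T>0. \<forall>x0 xstar :: nat br \<Rightarrow> real.
    \<exists>u. Linfty_control q T u \<and>
      (\<exists>x. canonical_solution G T u x0 x \<and>
        (\<forall>y. canonical_solution G T u x0 y \<longrightarrow> (\<forall>t\<in>{0..T}. \<forall>b\<in>G. y t b = x t b)) \<and>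
        (\<forall>b\<in>G. x T b = xstar b))"
proof (intro allI impI)
  fix T :: real and x0 xstar :: "nat br \<Rightarrow> real"
  assume T: "0 < T"
  have Hall: "Hall_set ({1..q} \<union> {0}) B lt" and Bu: "B = Bgood \<union> Bbad"
    and parity: "\<And>b. b \<in> B \<Longrightarrow> b \<in> Bgood \<Longrightarrow> seed b \<in> {1..q} \<or> (\<exists>(a, m)\<in>set (factors b). odd m)"
    using assms(2) unfolding factor_parity_Hall_set_def by blast+
  interpret Hall_subset "{1..q} \<union> {0}" B G lt
    using Hall Bu assms by unfold_locales auto
  define n where "n = card G"
  define good :: "letter set" where "good = (\<lambda>i. [i]) ` {1..q}"
  \<comment> \<open>the seed 0 is the drift; the good seeds have reference value 0\<close>
  define e :: "letter \<Rightarrow> real" where "e = (\<lambda>l. if l = [0] then 1 else 0)"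
  interpret control_system exponent letter_of coefficient good "[0]" e 1 .
  have sys: "parity_condition n"
    unfolding parity_condition_def
  proof (intro conjI allI impI)
    fix c assume c: "c < n"
    have b: "nth_br c \<in> G" "rank (nth_br c) = c" using nth_br c by (auto simp: n_def)
    show "coefficient c \<noteq> 0" by (simp add: coefficient_def)
    have "seed (nth_br c) \<in> {1..q} \<or> (\<exists>(a, k)\<in>set (factors (nth_br c)). odd k)"
      using parity[of "nth_br c"] b(1) assms(4) Bu by blast
    then show "letter_of c \<in> good \<or> (\<exists>j<c. odd (exponent c j))"
    proof
      assume "seed (nth_br c) \<in> {1..q}"
      then show ?thesis by (simp add: letter_of_def good_def)
    next
      assume "\<exists>(a, k)\<in>set (factors (nth_br c)). odd k"
      then obtain a k where ak: "(a, k) \<in> set (factors (nth_br c))" "odd k" by blast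
      then have a: "a \<in> G" "lt a (nth_br c)" using factors_facts(3)[OF b(1)] by auto
      then have "rank a < c" using lt_iff_rank[OF a(1) b(1)] b(2) by simp
      moreover have "exponent c (rank a) = k"
        using mult_of_factor[OF b(1) ak(1)] nth_br_rank[OF a(1)] by (simp add: exponent_def)
      ultimately show ?thesis using ak(2) by blast
    qed
  next
    fix b c assume bc: "b < c \<and> c < n"
    then have G: "nth_br b \<in> G" "nth_br c \<in> G" and r: "rank (nth_br b) = b" "rank (nth_br c) = c"
      using nth_br by (auto simp: n_def)
    show "\<not> (letter_of c = letter_of b \<and> (\<forall>j<b. exponent c j = exponent b j))"
    proof
      assume eq: "letter_of c = letter_of b \<and> (\<forall>j<b. exponent c j = exponent b j)"
      show False
      proof (rule prefix_free[OF G])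
        show "lt (nth_br b) (nth_br c)" using lt_iff_rank[OF G] r bc by simp
        show "seed (nth_br c) = seed (nth_br b)" using eq by (simp add: letter_of_def)
        fix a assume a: "a \<in> G" "lt a (nth_br b)"
        then have "rank a < b" using lt_iff_rank[OF a(1) G(1)] r by simp
        then have "exponent c (rank a) = exponent b (rank a)" using eq by blast
        then show "mult_of (nth_br c) a = mult_of (nth_br b) a"
          using nth_br_rank[OF a(1)] by (simp add: exponent_def)
      qed
    qed
  qed (auto simp: good_def e_def)
  obtain C where "steers n C T (\<lambda>c. x0 (nth_br c)) (\<lambda>c. xstar (nth_br c))"
    using steers_global[OF sys controllable_of_parity[OF sys] T] by blast
  then obtain v where v: "control C v" and
    v_end: "\<And>c. c < n \<Longrightarrow> flow exponent (input v) (\<lambda>c. x0 (nth_br c)) T c = xstar (nth_br c)"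
    unfolding steers_def by blast
  define p where "p = (\<lambda>c. x0 (nth_br c))"
  define u where "u = (\<lambda>t i. v t [i])"
  define x where "x = (\<lambda>t b. flow exponent (input v) p t (rank b))"
  have tame: "tame_inputs n T (input_bound n (max C 0)) (input v)" "0 \<le> input_bound n (max C 0)"
    using input_tame[OF sys control_mono[OF v, of "max C 0"]] by auto
  have reg: "regular_input (\<lambda>t. input v t c)" for c
    unfolding input_def by (intro regular_input_cmult control_regular[OF v])
  have v0: "v t [0] = 1" for t using v by (auto simp: control_def control_values_def)
  have rhs: "canonical_rhs y (u t) (nth_br c) = (\<Prod>j<c. y (nth_br j) ^ exponent c j) * input v t c"
    if "c < n" for y t c
    using canonical_rhs_nth_br[of c y "u t"] that v0
    by (simp add: n_def input_def letter_of_def u_def)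
  have x_nth: "x t (nth_br c) = flow exponent (input v) p t c" if "c < n" for t c
    using nth_br(2)[of c] that by (simp add: x_def n_def)
  have G_nth: "\<exists>c<n. b = nth_br c" if "b \<in> G" for b
    using nth_br_rank[OF that] rank_lt_card[OF that] unfolding n_def by metis
  define D where "D = (\<Union>c<n. {t. \<not> isCont (\<lambda>s. input v s c) t})"
  have "finite D" unfolding D_def using reg by (auto simp: regular_input_def)
  have deriv: "((\<lambda>s. x s b) has_real_derivative canonical_rhs (x t) (u t) b) (at t)"
    if b: "b \<in> G" and t: "t \<in> {0<..<T} - D" for b t
  proof -
    obtain c where c: "c < n" "b = nth_br c" using G_nth[OF b] by blast
    have "isCont (\<lambda>s. input v s c) t" using t c by (auto simp: D_def)
    then have "((\<lambda>s. flow exponent (input v) p s c) has_real_derivative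
        (\<Prod>j<c. flow exponent (input v) p t j ^ exponent c j) * input v t c) (at t)"
      using t c reg by (intro flow_has_derivative[of n]) auto
    moreover have "canonical_rhs (x t) (u t) b
        = (\<Prod>j<c. flow exponent (input v) p t j ^ exponent c j) * input v t c"
      using rhs[OF c(1)] c x_nth by simp
    ultimately show ?thesis using x_nth c by simp
  qed
  have x_ac: "abs_continuous_on {0..T} (\<lambda>t. x t b)" if "b \<in> G" for b
    unfolding x_def using rank_lt_card[OF that] T by (intro flow_abs_continuous[OF tame(1) _ tame(2)])
        (auto simp: n_def)
  have sol: "canonical_solution G T u x0 x"
    unfolding canonical_solution_def
  proof (intro conjI ballI)
    show "AE t in lebesgue_on {0<..<T}. \<forall>b\<in>G. ((\<lambda>s. x s b) has_real_derivative canonical_rhs (x t) (u t)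
        b) (at t)"
      using AE_not_finite[OF \<open>finite D\<close>, of T] by (rule eventually_mono) (use deriv in blast)
    show "x 0 b = x0 b" if "b \<in> G" for b
      using nth_br_rank[OF that] by (simp add: x_def p_def)
  qed (rule x_ac)
  have unique: "y t b = x t b" if y: "canonical_solution G T u x0 y" and t: "t \<in> {0..T}" and b: "b \<in> G"
      for y t b
  proof -
    have "\<forall>t\<in>{0..T}. y t (nth_br c) = x t (nth_br c)" if "c < n" for c
      using that
    proof (induction c rule: less_induct)
      case (less c)
      let ?b = "nth_br c" and ?d = "\<lambda>t. y t (nth_br c) - x t (nth_br c)"
      have bG: "?b \<in> G" using nth_br less.prems by (simp add: n_def)
      have ac: "abs_continuous_on {0..T} ?d"
        using y x_ac[OF bG] bG by (intro abs_continuous_on_diff) (auto simp: canonical_solution_def)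
      have ae: "AE t in lebesgue_on {0<..<T}. (?d has_real_derivative 0) (at t)"
      proof -
        have "AE t in lebesgue_on {0<..<T}. \<forall>b\<in>G. ((\<lambda>s. y s b) has_real_derivative canonical_rhs (y t)
            (u t) b) (at t)"
          using y by (simp add: canonical_solution_def)
        then show ?thesis
          using AE_not_finite[OF \<open>finite D\<close>, of T]
        proof eventually_elim
          case (elim t)
          have "canonical_rhs (y t) (u t) ?b = canonical_rhs (x t) (u t) ?b"
            using less elim(2) unfolding rhs[OF less.prems] by simp
          then show ?case
            using DERIV_diff[OF bspec[OF elim(1) bG] deriv[OF bG elim(2)]] by simp
        qed
      qed
      have "?d 0 = 0" using y sol bG by (simp add: canonical_solution_def)
      then show ?case using abs_continuous_zero_derivative[OF ac ae] by auto
    qed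
    then show ?thesis using G_nth[OF b] t by blast
  qed
  have "Linfty_control q T u"
    unfolding Linfty_control_def
  proof (intro ballI conjI)
    fix i assume "i \<in> {1..q}"
    have r: "regular_input (\<lambda>t. u t i)" unfolding u_def by (rule control_regular[OF v])
    show "(\<lambda>t. u t i) \<in> borel_measurable (lebesgue_on {0<..<T})"
      using regular_input_measurable[OF r] by (simp add: measurable_completion measurable_restrict_space1)
    obtain M where "\<And>t. \<bar>u t i\<bar> \<le> M"
      using r unfolding regular_input_def bounded_iff by auto
    then show "\<exists>C. AE t in lebesgue_on {0<..<T}. \<bar>u t i\<bar> \<le> C" by auto
  qed
  moreover have "x T b = xstar b" if "b \<in> G" for b
    using G_nth[OF that] x_nth v_end by (auto simp: p_def)
  ultimately show "\<exists>u. Linfty_control q T u \<and>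
      (\<exists>x. canonical_solution G T u x0 x \<and>
        (\<forall>y. canonical_solution G T u x0 y \<longrightarrow> (\<forall>t\<in>{0..T}. \<forall>b\<in>G. y t b = x t b)) \<and>
        (\<forall>b\<in>G. x T b = xstar b))"
    using sol unique by (intro exI[of _ u] exI[of _ x] conjI) auto
qed

end
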